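(* Let $\alpha$ be an algebraic number of degree $d\ge 3$ over $\mathbf{Q}$, let $K=\mathbf{Q}(\alpha)$, and let $r$ be the rank of the unit group $\mathbf{Z}_K^\times$. (a) The limit $\displaystyle\lim_{N\to\infty}\frac{|\mathbf{Z}_K^\times(N)|}{(\log N)^r}$ exists and is positive. (b) One has $\displaystyle\liminf_{N\to\infty}\frac{|\mathcal{E}^{(\alpha)}(N)|}{|\mathbf{Z}_K^\times(N)|}>0$. (c) For $0<\nu<1/2$, one has $\displaystyle\liminf_{N\to\infty}\frac{|\mathcal{E}_\nu^{(\alpha)}(N)|}{(\log N)^r}>0$. (d) For $0<\nu<1$ and $d\ge 4$, one has $\displaystyle\liminf_{N\to\infty}\frac{|\tilde{\mathcal{E}}_\nu^{(\alpha)}(N)|}{(\log N)^r}>0$.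
   Context: $\mathbf{Z}_K^\times$ denotes the group of units of the ring of integers of $K$. $\Phi$ is the set of the $d$ embeddings of $K$ into $\mathbf{C}$. For $\gamma\in K$, the house of $\gamma$ is $\overline{|\gamma|}=\max_{\varphi\in\Phi}|\varphi(\gamma)|$. Put $\mathcal{E}^{(\alpha)}=\{\varepsilon\in\mathbf{Z}_K^\times : \mathbf{Q}(\alpha\varepsilon)=K\}$. For $0<\nu<1$, $\mathcal{E}_\nu^{(\alpha)}$ is the set of $\varepsilon\in\mathcal{E}^{(\alpha)}$ for which there exist two distinct elements $\varphi_1,\varphi_2\in\Phi$ with $|\varphi_1(\alpha\varepsilon)|=\overline{|\alpha\varepsilon|}$ and $|\varphi_2(\alpha\varepsilon)|\ge \overline{|\alpha\varepsilon|}^{\,\nu}$. $\mathcal{E}_\nu^{(1/\alpha)}$ is defined in the same way with $\alpha$ replaced by $1/\alpha$. $\tilde{\mathcal{E}}_\nu^{(\alpha)}$ is the set of $\varepsilon\in\mathcal{E}_\nu^{(\alpha)}$ such that $\varepsilon^{-1}\in\mathcal{E}_\nu^{(1/\alpha)}$. For a subset $\mathcal{F}$ of $\mathbf{Z}_K^\times$ and a positive real number $N$, $\mathcal{F}(N)=\{\varepsilon\in\mathcal{F} : \overline{|\alpha\varepsilon|}\le N\}$ and $|\mathcal{F}(N)|$ is its cardinality. *)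

theory Defs
  imports
    "HOL-Analysis.Analysis"
    "HOL-Computational_Algebra.Polynomial"
begin

(* Number fields are concrete subfields of the complex numbers. *)

definition complex_subfield :: "complex set \<Rightarrow> bool" where
  "complex_subfield F \<longleftrightarrow>
     0 \<in> F \<and> 1 \<in> F \<and>
     (\<forall>x\<in>F. \<forall>y\<in>F. x + y \<in> F \<and> x * y \<in> F) \<and>
     (\<forall>x\<in>F. - x \<in> F \<and> inverse x \<in> F)"

(* Q(a); every subfield of the complex numbers contains the rationals *)
definition rat_adjoin :: "complex \<Rightarrow> complex set" where
  "rat_adjoin a = \<Inter>{F. complex_subfield F \<and> a \<in> F}"

(* The degree of the minimal polynomial over Q; meaningful for algebraic a only. *)
definition rat_degree :: "complex \<Rightarrow> nat" where
  "rat_degree a =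
     (LEAST n. \<exists>p :: rat poly. p \<noteq> 0 \<and> degree p = n \<and> poly (map_poly of_rat p) a = 0)"

(* Restricting to extensional functions identifies embeddings that agree on K, so that
   distinct elements of this set are distinct as maps on K. Injectivity is automatic. *)
definition embeddings :: "complex set \<Rightarrow> (complex \<Rightarrow> complex) set" where
  "embeddings K = {\<phi> \<in> extensional K. \<phi> 1 = 1 \<and>
     (\<forall>x\<in>K. \<forall>y\<in>K. \<phi> (x + y) = \<phi> x + \<phi> y \<and> \<phi> (x * y) = \<phi> x * \<phi> y)}"

definition house :: "complex set \<Rightarrow> complex \<Rightarrow> real" where
  "house K \<gamma> = Max ((\<lambda>\<phi>. cmod (\<phi> \<gamma>)) ` embeddings K)"

definition int_ring :: "complex set \<Rightarrow> complex set" where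
  "int_ring K = {x \<in> K. algebraic_int x}"

definition int_units :: "complex set \<Rightarrow> complex set" where
  "int_units K = {x \<in> int_ring K. \<exists>y \<in> int_ring K. x * y = 1}"

definition mult_independent :: "complex set \<Rightarrow> bool" where
  "mult_independent B \<longleftrightarrow>
     (\<forall>k :: complex \<Rightarrow> int. (\<Prod>b\<in>B. b powi k b) = 1 \<longrightarrow> (\<forall>b\<in>B. k b = 0))"

(* Rank of a multiplicative abelian group: the largest number of elements that are linearly
   independent over the integers. *)
definition mult_rank :: "complex set \<Rightarrow> nat" where
  "mult_rank U = (GREATEST n. \<exists>B \<subseteq> U. finite B \<and> card B = n \<and> mult_independent B)"

definition gen_units :: "complex set \<Rightarrow> complex \<Rightarrow> complex set" where
  "gen_units K a = {\<epsilon> \<in> int_units K. rat_adjoin (a * \<epsilon>) = K}"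

definition gen_units_nu :: "complex set \<Rightarrow> real \<Rightarrow> complex \<Rightarrow> complex set" where
  "gen_units_nu K \<nu> a = {\<epsilon> \<in> gen_units K a.
     \<exists>\<phi>\<^sub>1 \<in> embeddings K. \<exists>\<phi>\<^sub>2 \<in> embeddings K. \<phi>\<^sub>1 \<noteq> \<phi>\<^sub>2 \<and>
       cmod (\<phi>\<^sub>1 (a * \<epsilon>)) = house K (a * \<epsilon>) \<and>
       cmod (\<phi>\<^sub>2 (a * \<epsilon>)) \<ge> house K (a * \<epsilon>) powr \<nu>}"

definition gen_units_nu_tilde :: "complex set \<Rightarrow> real \<Rightarrow> complex \<Rightarrow> complex set" where
  "gen_units_nu_tilde K \<nu> a =
     {\<epsilon> \<in> gen_units_nu K \<nu> a. inverse \<epsilon> \<in> gen_units_nu K \<nu> (1 / a)}"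

definition house_le :: "complex set \<Rightarrow> complex \<Rightarrow> complex set \<Rightarrow> real \<Rightarrow> complex set" where
  "house_le K a F N = {\<epsilon> \<in> F. house K (a * \<epsilon>) \<le> N}"

end

theory Submission
  imports Defs "Jordan_Normal_Form.Char_Poly"
begin

text \<open>Map units to the vectors of the logarithms of their absolute conjugates. A pigeonhole argument
  in the order generated by an integral multiple of \<open>\<alpha>\<close>, combined with the finiteness of the number of
  associate classes of bounded norm, shows that every vector of sum zero that is invariant under
  complex conjugation is at bounded distance from the image of a unit.

  A maximal multiplicatively independent set \<open>B\<close> of units has \<open>r\<close> elements and generates a subgroup of
  finite index, so units are counted by integer exponent vectors. Division of the exponents by \<open>k\<close>
  compares the counting function at \<open>k t\<close> with \<open>k ^ r\<close> times its value near \<open>t\<close>, which forces the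
  limit in (a) to exist. For the lower bounds, translate a box of exponents of side proportional to
  \<open>T\<close> by a unit close to \<open>T v\<close>, where \<open>v\<close> has two coordinates equal to its maximum \<open>1\<close> (and, for
  (d), two equal to its minimum \<open>-1\<close>).

  It remains to have \<open>\<phi> (\<alpha> \<epsilon>) \<noteq> \<psi> (\<alpha> \<epsilon>)\<close> for distinct embeddings. If some \<open>b \<in> B\<close> has no power with
  \<open>\<phi> (b ^ j) = \<psi> (b ^ j)\<close>, then every line of the box in direction \<open>b\<close> contains at most one exception.
  Otherwise suitable powers of all elements of \<open>B\<close> have equal images, and a monomial in these powers
  is never an exception because \<open>\<phi> \<alpha> \<noteq> \<psi> \<alpha>\<close>.\<close>

section \<open>The ring of algebraic integers\<close>

text \<open>The rank \<open>r\<close> enters only as the largest size of a multiplicatively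
  independent set of units; its expression by the numbers of real and complex embeddings is nowhere
  derived. Counting by exponent vectors over \<open>B\<close> produces the power \<open>r\<close> by
  itself, and cocompactness serves to place a box of exponents in a prescribed direction.

  The comparison under scaling is one-sided, as in Fekete's lemma on subadditive sequences. It
  yields a limit without computing volumes, but it cannot exclude the limit 0. Positivity in (a)
  comes from the lower bound for units with two large conjugates. The same bound gives (b), since
  these units generate \<open>K\<close> after multiplication by \<alpha>.

  The exceptions occupy a proportion \<open>O(1/T)\<close> of a box whose side is proportional to
  \<open>T\<close>, so a quantity of order \<open>T ^ r\<close> survives. A direction must have sum
  zero and be invariant under conjugation. Two coordinates equal to the maximum 1 leave the
  compensating negative mass to the other embeddings, hence \<open>d \<ge> 3\<close>; two further
  coordinates equal to the minimum -1 require \<open>d \<ge> 4\<close>.\<close>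

lemma algebraic_int_if_int_matrix:
  fixes z :: complex and v :: "nat \<Rightarrow> complex" and A :: "nat \<Rightarrow> nat \<Rightarrow> int"
  assumes eq: "\<And>i. i < n \<Longrightarrow> z * v i = (\<Sum>j<n. of_int (A i j) * v j)"
    and k: "k < n" "v k \<noteq> 0"
  shows "algebraic_int z"
proof -
  define M where "M = mat n n (\<lambda>(i,j). A i j)"
  define Mc :: "complex mat" where "Mc = map_mat of_int M"
  have M: "M \<in> carrier_mat n n" and Mc: "Mc \<in> carrier_mat n n"
    by (auto simp: M_def Mc_def)
  \<comment> \<open>The determinant trick: the relations make \<open>v\<close> an eigenvector for
    \<open>z\<close>, so \<open>z\<close> is a root of a characteristic polynomial that is monic
    with integer coefficients.\<close>
  have "eigenvector Mc (vec n v) z"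
    unfolding eigenvector_def
  proof (intro conjI)
    show "vec n v \<in> carrier_vec (dim_row Mc)" using Mc by auto
    have "vec_index (vec n v) k \<noteq> vec_index (0\<^sub>v (dim_row Mc)) k" using k Mc by auto
    thus "vec n v \<noteq> 0\<^sub>v (dim_row Mc)" by metis
    show "Mc *\<^sub>v vec n v = z \<cdot>\<^sub>v vec n v"
    proof (rule eq_vecI)
      fix i assume "i < dim_vec (z \<cdot>\<^sub>v vec n v)"
      hence i: "i < n" by simp
      show "vec_index (Mc *\<^sub>v vec n v) i = vec_index (z \<cdot>\<^sub>v vec n v) i"
        using i eq[OF i] by (simp add: Mc_def M_def scalar_prod_def atLeast0LessThan)
    qed (use Mc in auto)
  qed
  hence "poly (char_poly Mc) z = 0"
    using eigenvalue_root_char_poly[OF Mc] unfolding eigenvalue_def by blast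
  moreover have "char_poly Mc = map_poly of_int (char_poly M)"
    unfolding Mc_def by (rule of_int_hom.char_poly_hom[OF M])
  ultimately show ?thesis
    unfolding algebraic_int_altdef_ipoly
    using degree_monic_char_poly[OF M] by (intro exI[of _ "char_poly M"]) simp
qed

definition int_span :: "complex set \<Rightarrow> complex set" where
  "int_span S = range (\<lambda>a :: complex \<Rightarrow> int. \<Sum>s\<in>S. of_int (a s) * s)"

lemma int_span_base:
  assumes "finite S" "s \<in> S"
  shows "s \<in> int_span S"
proof -
  have "(\<Sum>t\<in>S. of_int (if t = s then 1 else 0) * t) = (\<Sum>t\<in>S. if t = s then s else 0)"
    by (intro sum.cong) auto
  also have "\<dots> = s" using assms by simp
  finally have "s = (\<Sum>t\<in>S. of_int (if t = s then 1 else 0) * t)" ..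
  thus ?thesis unfolding int_span_def
    by (intro image_eqI[of _ _ "\<lambda>t. if t = s then 1 else 0"]) auto
qed

lemma int_span_0: "0 \<in> int_span S"
  unfolding int_span_def by (rule image_eqI[of _ _ "\<lambda>_. 0"]) auto

lemma int_span_add: "x \<in> int_span S \<Longrightarrow> y \<in> int_span S \<Longrightarrow> x + y \<in> int_span S"
  unfolding int_span_def
proof safe
  fix a b :: "complex \<Rightarrow> int"
  show "(\<Sum>s\<in>S. of_int (a s) * s) + (\<Sum>s\<in>S. of_int (b s) * s)
          \<in> range (\<lambda>a :: complex \<Rightarrow> int. \<Sum>s\<in>S. of_int (a s) * s)"
    by (rule image_eqI[of _ _ "\<lambda>s. a s + b s"]) (auto simp: sum.distrib algebra_simps)
qed

lemma int_span_cmult: "x \<in> int_span S \<Longrightarrow> of_int c * x \<in> int_span S"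
  unfolding int_span_def
proof safe
  fix a :: "complex \<Rightarrow> int"
  show "of_int c * (\<Sum>s\<in>S. of_int (a s) * s)
          \<in> range (\<lambda>a :: complex \<Rightarrow> int. \<Sum>s\<in>S. of_int (a s) * s)"
    by (rule image_eqI[of _ _ "\<lambda>s. c * a s"]) (auto simp: sum_distrib_left algebra_simps)
qed

lemma int_span_sum: "(\<And>i. i \<in> I \<Longrightarrow> f i \<in> int_span S) \<Longrightarrow> sum f I \<in> int_span S"
  by (induction I rule: infinite_finite_induct) (auto intro: int_span_0 int_span_add)

lemma mult_int_span:
  assumes "\<And>s. s \<in> S \<Longrightarrow> x * s \<in> int_span S" "y \<in> int_span S"
  shows "x * y \<in> int_span S"
proof -
  obtain a where "y = (\<Sum>s\<in>S. of_int (a s) * s)" using assms(2) by (auto simp: int_span_def)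
  hence "x * y = (\<Sum>s\<in>S. of_int (a s) * (x * s))" by (simp add: sum_distrib_left mult_ac)
  thus ?thesis using assms(1) by (auto intro!: int_span_sum int_span_cmult)
qed

text \<open>Enumerating the generators turns stability into an integer matrix with eigenvalue
  \<open>z\<close>. The generators may be dependent, so the matrix rests on a choice of
  coefficients; the generator \<open>t\<close> makes the eigenvector nonzero.\<close>

lemma algebraic_int_if_int_span_stable:
  assumes S: "finite S" "t \<in> S" "t \<noteq> 0" and st: "\<And>s. s \<in> S \<Longrightarrow> z * s \<in> int_span S"
  shows "algebraic_int z"
proof -
  obtain v where v: "bij_betw v {..<card S} S"
    using ex_bij_betw_nat_finite[OF S(1)] by (auto simp: atLeast0LessThan)
  obtain k where k: "k < card S" "v k = t"
    using v S(2) by (metis bij_betw_imp_surj_on imageE lessThan_iff)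
  have "\<exists>a :: complex \<Rightarrow> int. z * s = (\<Sum>u\<in>S. of_int (a u) * u)" if "s \<in> S" for s
    using st[OF that] by (auto simp: int_span_def)
  then obtain a :: "complex \<Rightarrow> complex \<Rightarrow> int"
    where a: "\<And>s. s \<in> S \<Longrightarrow> z * s = (\<Sum>u\<in>S. of_int (a s u) * u)" by metis
  show ?thesis
  proof (rule algebraic_int_if_int_matrix[where n = "card S" and v = v and A = "\<lambda>i j. a (v i) (v j)" and k = k])
    fix i assume i: "i < card S"
    hence "v i \<in> S" using v by (auto simp: bij_betw_def)
    thus "z * v i = (\<Sum>j<card S. of_int (a (v i) (v j)) * v j)"
      using a sum.reindex_bij_betw[OF v, of "\<lambda>u. of_int (a (v i) u) * u"] by simp
  qed (use k S in auto)
qed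

lemma algebraic_int_power_reduce:
  fixes x :: complex
  assumes "algebraic_int x"
  obtains n and c :: "nat \<Rightarrow> int" where "n > 0" "x ^ n = (\<Sum>i<n. of_int (c i) * x ^ i)"
proof -
  obtain p where p: "poly (map_poly of_int p) x = 0" "lead_coeff p = 1"
    using assms by (auto simp: algebraic_int_altdef_ipoly)
  define n where "n = degree p"
  have "n \<noteq> 0"
  proof
    assume "n = 0"
    then obtain c where "p = [:c:]" unfolding n_def by (metis degree_eq_zeroE)
    with p show False by (auto simp: map_poly_pCons)
  qed
  have "0 = (\<Sum>i\<le>n. of_int (coeff p i) * x ^ i)"
    using p(1) by (simp add: poly_altdef n_def coeff_map_poly degree_map_poly)
  also have "\<dots> = x ^ n + (\<Sum>i<n. of_int (coeff p i) * x ^ i)"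
    using p(2) by (simp add: lessThan_Suc_atMost[symmetric] n_def)
  finally have "x ^ n = (\<Sum>i<n. of_int (- coeff p i) * x ^ i)"
    by (simp add: sum_negf eq_neg_iff_add_eq_0)
  thus ?thesis using that[of n "\<lambda>i. - coeff p i"] \<open>n \<noteq> 0\<close> by simp
qed

text \<open>The products \<open>x ^ i * y ^ j\<close> below the two degrees span a group stable
  under both numbers. A single group serves for the sum and the product at once.\<close>

lemma algebraic_int_common_span:
  fixes x y :: complex
  assumes "algebraic_int x" "algebraic_int y"
  obtains S where "finite S" "1 \<in> S" "\<And>s. s \<in> S \<Longrightarrow> x * s \<in> int_span S"
    "\<And>s. s \<in> S \<Longrightarrow> y * s \<in> int_span S"
proof -
  obtain n c where n: "n > 0" "x ^ n = (\<Sum>i<n. of_int (c i) * x ^ i)"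
    using assms(1) by (rule algebraic_int_power_reduce)
  obtain m e where m: "m > 0" "y ^ m = (\<Sum>i<m. of_int (e i) * y ^ i)"
    using assms(2) by (rule algebraic_int_power_reduce)
  define S where "S = (\<lambda>(i,j). x ^ i * y ^ j) ` ({..<n} \<times> {..<m})"
  have fin: "finite S" by (simp add: S_def)
  have base: "x ^ i * y ^ j \<in> int_span S" if "i < n" "j < m" for i j
    using that by (intro int_span_base[OF fin]) (auto simp: S_def)
  have X: "x * s \<in> int_span S" if "s \<in> S" for s
  proof -
    obtain i j where ij: "i < n" "j < m" "s = x ^ i * y ^ j" using \<open>s \<in> S\<close> by (auto simp: S_def)
    show ?thesis
    proof (cases "Suc i < n")
      case True
      thus ?thesis using base[of "Suc i" j] ij by (simp add: mult_ac)
    next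
      case False
      hence "Suc i = n" using ij by simp
      hence "x * s = x ^ n * y ^ j" using ij by (auto simp: mult_ac)
      also have "\<dots> = (\<Sum>k<n. of_int (c k) * (x ^ k * y ^ j))"
        unfolding n(2) sum_distrib_right by (simp add: mult_ac)
      also have "\<dots> \<in> int_span S" using ij by (intro int_span_sum int_span_cmult base) auto
      finally show ?thesis .
    qed
  qed
  have Y: "y * s \<in> int_span S" if "s \<in> S" for s
  proof -
    obtain i j where ij: "i < n" "j < m" "s = x ^ i * y ^ j" using \<open>s \<in> S\<close> by (auto simp: S_def)
    show ?thesis
    proof (cases "Suc j < m")
      case True
      thus ?thesis using base[of i "Suc j"] ij by (simp add: mult_ac)
    next
      case False
      hence "Suc j = m" using ij by simp
      hence "y * s = x ^ i * y ^ m" using ij by (auto simp: mult_ac)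
      also have "\<dots> = (\<Sum>k<m. of_int (e k) * (x ^ i * y ^ k))"
        unfolding m(2) sum_distrib_left by (simp add: mult_ac)
      also have "\<dots> \<in> int_span S" using ij by (intro int_span_sum int_span_cmult base) auto
      finally show ?thesis .
    qed
  qed
  have "1 \<in> S" unfolding S_def using n(1) m(1) by (intro image_eqI[of _ _ "(0,0)"]) auto
  from that[OF fin this X Y] show ?thesis .
qed

lemma algebraic_int_add [intro]:
  fixes x y :: complex
  assumes "algebraic_int x" "algebraic_int y"
  shows "algebraic_int (x + y)"
  using assms
  by (rule algebraic_int_common_span)
     (rule algebraic_int_if_int_span_stable[of _ 1], auto simp: distrib_right intro: int_span_add)

lemma algebraic_int_mult [intro]:
  fixes x y :: complex
  assumes "algebraic_int x" "algebraic_int y"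
  shows "algebraic_int (x * y)"
  using assms
  by (rule algebraic_int_common_span)
     (rule algebraic_int_if_int_span_stable[of _ 1], auto simp: mult.assoc intro: mult_int_span)

lemma algebraic_int_sum:
  fixes f :: "'a \<Rightarrow> complex"
  shows "(\<And>i. i \<in> I \<Longrightarrow> algebraic_int (f i)) \<Longrightarrow> algebraic_int (sum f I)"
  by (induction I rule: infinite_finite_induct) auto

lemma algebraic_int_of_int: "algebraic_int (of_int k :: complex)"
  by (rule int_imp_algebraic_int) simp

lemma algebraic_int_1: "algebraic_int (1 :: complex)"
  using algebraic_int_of_int[of 1] by simp

lemma algebraic_int_prod:
  fixes f :: "'a \<Rightarrow> complex"
  shows "(\<And>i. i \<in> I \<Longrightarrow> algebraic_int (f i)) \<Longrightarrow> algebraic_int (prod f I)"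
  by (induction I rule: infinite_finite_induct) (auto simp: algebraic_int_1)

lemma algebraic_int_power: "algebraic_int (x :: complex) \<Longrightarrow> algebraic_int (x ^ n)"
  by (induction n) (auto simp: algebraic_int_1)

lemma algebraic_imp_multiple_algebraic_int:
  fixes x :: complex
  assumes "algebraic x"
  obtains m :: int where "m > 0" "algebraic_int (of_int m * x)"
proof -
  obtain p :: "int poly" where p: "poly (map_poly of_int p) x = 0" "p \<noteq> 0"
    using assms by (auto elim: algebraicE')
  define n a where "n = degree p" and "a = lead_coeff p"
  have a0: "a \<noteq> 0" using p by (simp add: a_def)
  have n0: "n \<noteq> 0"
  proof
    assume "n = 0"
    then obtain c where "p = [:c:]" unfolding n_def by (metis degree_eq_zeroE)
    with p show False by (auto simp: map_poly_pCons)
  qed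
  \<comment> \<open>Multiplying the relation for \<open>x\<close> by \<open>a ^ (n - 1)\<close> and
    absorbing powers of \<open>a\<close> into the variable gives a monic relation for
    \<open>a * x\<close>; the coefficient of index \<open>i\<close> keeps the exponent
    \<open>n - 1 - i\<close>.\<close>
  define q :: "complex poly" where
    "q = monom 1 n + (\<Sum>i<n. monom (of_int (coeff p i * a ^ (n - 1 - i))) i)"
  have dq: "degree (\<Sum>i<n. monom (of_int (coeff p i * a ^ (n - 1 - i))) i :: complex poly) < n"
    using n0 by (intro degree_sum_less) (auto intro: le_less_trans[OF degree_monom_le])
  have dq: "degree q = n"
    unfolding q_def by (subst degree_add_eq_left) (use dq in \<open>auto simp: degree_monom_eq\<close>)
  have cq: "coeff q i \<in> \<int>" for i
    unfolding q_def by (auto simp: coeff_sum intro!: Ints_add Ints_sum)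
  have lq: "lead_coeff q = 1"
    by (auto simp: dq) (auto simp: q_def coeff_sum)
  have "poly q (of_int a * x) = (of_int a * x) ^ n + (\<Sum>i<n. of_int (coeff p i * a ^ (n - 1 - i)) * (of_int a * x) ^ i)"
    by (simp add: q_def poly_sum poly_monom)
  also have "(\<Sum>i<n. of_int (coeff p i * a ^ (n - 1 - i)) * (of_int a * x) ^ i) =
             (\<Sum>i<n. of_int a ^ (n - 1) * (of_int (coeff p i) * x ^ i))"
  proof (rule sum.cong)
    fix i assume "i \<in> {..<n}"
    hence "n - 1 = (n - 1 - i) + i" by auto
    hence "(of_int a :: complex) ^ (n - 1) = of_int a ^ (n - 1 - i) * of_int a ^ i"
      by (metis power_add)
    thus "of_int (coeff p i * a ^ (n - 1 - i)) * (of_int a * x) ^ i =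
       of_int a ^ (n - 1) * (of_int (coeff p i) * x ^ i)"
      by (simp add: power_mult_distrib mult_ac)
  qed simp
  also have "(of_int a * x) ^ n = of_int a ^ (n - 1) * (of_int (coeff p n) * x ^ n)"
    using n0 by (cases n) (auto simp: a_def n_def power_mult_distrib)
  also have "\<dots> + (\<Sum>i<n. of_int a ^ (n - 1) * (of_int (coeff p i) * x ^ i)) =
     of_int a ^ (n - 1) * (\<Sum>i\<le>n. of_int (coeff p i) * x ^ i)"
    by (simp add: lessThan_Suc_atMost[symmetric] sum_distrib_left distrib_left)
  also have "(\<Sum>i\<le>n. of_int (coeff p i) * x ^ i) = poly (map_poly of_int p) x"
    by (simp add: poly_altdef n_def coeff_map_poly degree_map_poly)
  finally have "poly q (of_int a * x) = 0" using p by simp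
  with cq lq have *: "algebraic_int (of_int a * x)" by (intro algebraic_int.intros[of q]) auto
  show ?thesis
  proof (cases "a > 0")
    case True
    thus ?thesis using that * by blast
  next
    case False
    have "algebraic_int (of_int (- a) * x)" using * by simp
    thus ?thesis using that[of "- a"] False a0 by linarith
  qed
qed

section \<open>Simple number fields and their embeddings\<close>

lemma complex_subfieldD:
  assumes "complex_subfield F"
  shows "0 \<in> F" "1 \<in> F" "x \<in> F \<Longrightarrow> y \<in> F \<Longrightarrow> x + y \<in> F" "x \<in> F \<Longrightarrow> y \<in> F \<Longrightarrow> x * y \<in> F"
    "x \<in> F \<Longrightarrow> - x \<in> F" "x \<in> F \<Longrightarrow> inverse x \<in> F"
    "x \<in> F \<Longrightarrow> y \<in> F \<Longrightarrow> x / y \<in> F" "x \<in> F \<Longrightarrow> y \<in> F \<Longrightarrow> x - y \<in> F"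
proof -
  show 1: "0 \<in> F" "1 \<in> F" "x \<in> F \<Longrightarrow> y \<in> F \<Longrightarrow> x + y \<in> F" "x \<in> F \<Longrightarrow> y \<in> F \<Longrightarrow> x * y \<in> F"
    "x \<in> F \<Longrightarrow> - x \<in> F" "x \<in> F \<Longrightarrow> inverse x \<in> F" for x y
    using assms by (auto simp: complex_subfield_def)
  show "x \<in> F \<Longrightarrow> y \<in> F \<Longrightarrow> x / y \<in> F" using 1(4)[of x "inverse y"] 1(6)[of y] by (simp add: field_simps)
  show "x \<in> F \<Longrightarrow> y \<in> F \<Longrightarrow> x - y \<in> F" using 1(3)[of x "- y"] 1(5)[of y] by simp
qed

lemma complex_subfield_of_rat:
  assumes F: "complex_subfield F"
  shows "of_rat q \<in> F"
proof -
  have N: "of_nat n \<in> F" for n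
    by (induction n) (auto intro: complex_subfieldD[OF F])
  have Z: "of_int k \<in> F" for k
    by (cases k rule: int_cases2) (auto intro: N complex_subfieldD[OF F])
  obtain a b where "q = of_int a / of_int b" using quotient_of_div by (metis surj_pair)
  thus ?thesis by (auto simp: of_rat_divide intro: Z complex_subfieldD[OF F])
qed

lemma complex_subfield_rat_adjoin: "complex_subfield (rat_adjoin a)"
  unfolding rat_adjoin_def complex_subfield_def by auto

lemma in_rat_adjoin: "a \<in> rat_adjoin a"
  unfolding rat_adjoin_def by auto

lemma rat_adjoin_least: "complex_subfield F \<Longrightarrow> a \<in> F \<Longrightarrow> rat_adjoin a \<subseteq> F"
  unfolding rat_adjoin_def by auto

section \<open>Rational polynomials evaluated at complex numbers\<close>

definition rpoly :: "rat poly \<Rightarrow> complex \<Rightarrow> complex" where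
  "rpoly q z = poly (map_poly of_rat q) z"

lemma rpoly_0 [simp]: "rpoly 0 z = 0"
  by (simp add: rpoly_def)

lemma rpoly_pCons [simp]: "rpoly (pCons a q) z = of_rat a + z * rpoly q z"
  by (cases "pCons a q = 0") (auto simp: rpoly_def map_poly_pCons)

lemma rpoly_1 [simp]: "rpoly 1 z = 1"
  by (simp add: one_pCons)

lemma rpoly_add [simp]: "rpoly (p + q) z = rpoly p z + rpoly q z"
  by (induction p q rule: poly_induct2) (auto simp: of_rat_add algebra_simps)

lemma rpoly_smult [simp]: "rpoly (Polynomial.smult c q) z = of_rat c * rpoly q z"
  by (induction q) (auto simp: of_rat_mult algebra_simps)

lemma rpoly_minus [simp]: "rpoly (- q) z = - rpoly q z"
  by (induction q) (auto simp: of_rat_minus algebra_simps)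

lemma rpoly_diff [simp]: "rpoly (p - q) z = rpoly p z - rpoly q z"
  using rpoly_add[of p "- q" z] by simp

lemma rpoly_mult [simp]: "rpoly (p * q) z = rpoly p z * rpoly q z"
  by (induction p) (auto simp: algebra_simps)

lemma rpoly_altdef: "degree q < n \<Longrightarrow> rpoly q z = (\<Sum>i<n. of_rat (coeff q i) * z ^ i)"
proof -
  assume n: "degree q < n"
  have "rpoly q z = (\<Sum>i\<le>degree q. of_rat (coeff q i) * z ^ i)"
    by (simp add: rpoly_def poly_altdef degree_map_poly coeff_map_poly)
  also have "\<dots> = (\<Sum>i<n. of_rat (coeff q i) * z ^ i)"
    using n by (intro sum.mono_neutral_left) (auto simp: coeff_eq_0)
  finally show ?thesis .
qed

lemma degree_sum_monom_less: "n > 0 \<Longrightarrow> degree (\<Sum>i<n. monom (c i) i) < n"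
  by (intro degree_sum_less) (auto intro: le_less_trans[OF degree_monom_le])

lemma coeff_sum_monom: "k < n \<Longrightarrow> coeff (\<Sum>i<n. monom (c i) i) k = c k"
  by (simp add: coeff_sum)

lemma rpoly_sum_monom:
  "n > 0 \<Longrightarrow> rpoly (\<Sum>i<n. monom (c i) i) z = (\<Sum>i<n. of_rat (c i) * z ^ i)"
  by (subst rpoly_altdef[OF degree_sum_monom_less]) (auto simp: coeff_sum_monom)

lemma rpoly_eq_0_if_many_roots:
  assumes "finite A" "card A > degree q" "\<And>z. z \<in> A \<Longrightarrow> rpoly q z = 0"
  shows "q = 0"
proof (rule ccontr)
  assume q: "q \<noteq> 0"
  let ?q = "map_poly of_rat q :: complex poly"
  have q': "?q \<noteq> 0" using q by (simp add: map_poly_eq_0_iff)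
  have "A \<subseteq> {z. poly ?q z = 0}" using assms(3) by (auto simp: rpoly_def)
  hence "card A \<le> card {z. poly ?q z = 0}" by (intro card_mono poly_roots_finite q')
  also have "\<dots> \<le> degree ?q" by (rule card_poly_roots_bound[OF q'])
  also have "\<dots> = degree q" by (simp add: degree_map_poly)
  finally show False using assms(2) by simp
qed

lemma embeddingsD:
  assumes "\<phi> \<in> embeddings K" "complex_subfield K"
  shows "\<phi> 1 = 1" "x \<in> K \<Longrightarrow> y \<in> K \<Longrightarrow> \<phi> (x + y) = \<phi> x + \<phi> y"
    "x \<in> K \<Longrightarrow> y \<in> K \<Longrightarrow> \<phi> (x * y) = \<phi> x * \<phi> y" "\<phi> 0 = 0" "x \<in> K \<Longrightarrow> \<phi> (- x) = - \<phi> x"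
    "x \<in> K \<Longrightarrow> y \<in> K \<Longrightarrow> \<phi> (x - y) = \<phi> x - \<phi> y" "\<phi> (of_rat r) = of_rat r"
    "x \<in> K \<Longrightarrow> \<phi> (inverse x) = inverse (\<phi> x)" "x \<in> K \<Longrightarrow> x \<noteq> 0 \<Longrightarrow> \<phi> x \<noteq> 0"
    "x \<in> K \<Longrightarrow> y \<in> K \<Longrightarrow> \<phi> (x / y) = \<phi> x / \<phi> y" "x \<in> K \<Longrightarrow> \<phi> (x ^ n) = \<phi> x ^ n"
    "x \<in> K \<Longrightarrow> \<phi> (x powi k) = \<phi> x powi k"
proof -
  note F = complex_subfieldD[OF assms(2)]
  show one: "\<phi> 1 = 1" and add: "x \<in> K \<Longrightarrow> y \<in> K \<Longrightarrow> \<phi> (x + y) = \<phi> x + \<phi> y"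
    and mult: "x \<in> K \<Longrightarrow> y \<in> K \<Longrightarrow> \<phi> (x * y) = \<phi> x * \<phi> y" for x y
    using assms(1) by (auto simp: embeddings_def)
  show zero: "\<phi> 0 = 0" using add[of 0 0] F(1) by simp
  show minus: "x \<in> K \<Longrightarrow> \<phi> (- x) = - \<phi> x" for x
    using add[of x "- x"] F(5)[of x] zero by (simp add: minus_unique)
  show diff: "x \<in> K \<Longrightarrow> y \<in> K \<Longrightarrow> \<phi> (x - y) = \<phi> x - \<phi> y" for x y
    using add[of x "- y"] minus[of y] F(5)[of y] by simp
  have nat: "of_nat n \<in> K \<and> \<phi> (of_nat n) = of_nat n" for n
    by (induction n) (use add[OF F(2)] in \<open>auto simp: zero one intro: F\<close>)
  have int: "of_int k \<in> K \<and> \<phi> (of_int k) = of_int k" for k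
    by (cases k rule: int_cases2) (auto simp: nat minus F(5))
  obtain a b where ab: "r = of_int a / of_int b" "b > 0"
    using quotient_of_div quotient_of_denom_pos by (metis surj_pair)
  \<comment> \<open>An embedding fixes the integers, and clearing the denominator extends this to
    the rationals.\<close>
  have br: "of_int b * of_rat r = (of_int a :: complex)"
    using ab by (simp add: of_rat_divide)
  have "of_int b * \<phi> (of_rat r) = \<phi> (of_int b * of_rat r)"
    using int[of b] mult[of "of_int b" "of_rat r"] complex_subfield_of_rat[OF assms(2)] by simp
  hence "of_int b * \<phi> (of_rat r) = of_int a" using int[of a] br by simp
  hence "of_int b * \<phi> (of_rat r) = of_int b * of_rat r"
    using br by simp
  thus "\<phi> (of_rat r) = of_rat r" using ab(2) by simp
  show nz: "x \<in> K \<Longrightarrow> x \<noteq> 0 \<Longrightarrow> \<phi> x \<noteq> 0" for x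
    using mult[of x "inverse x"] F(6)[of x] one by auto
  show inv: "x \<in> K \<Longrightarrow> \<phi> (inverse x) = inverse (\<phi> x)" for x
    using mult[of x "inverse x"] F(6)[of x] one zero
    by (cases "x = 0") (auto intro: inverse_unique[symmetric])
  show "x \<in> K \<Longrightarrow> y \<in> K \<Longrightarrow> \<phi> (x / y) = \<phi> x / \<phi> y"
    using mult[of x "inverse y"] inv[of y] F(6)[of y] by (simp add: field_simps)
  have pow: "x \<in> K \<Longrightarrow> x ^ n \<in> K \<and> \<phi> (x ^ n) = \<phi> x ^ n" for x n
    by (induction n) (auto simp: one mult intro: F)
  thus "x \<in> K \<Longrightarrow> \<phi> (x ^ n) = \<phi> x ^ n" by blast
  show "x \<in> K \<Longrightarrow> \<phi> (x powi k) = \<phi> x powi k"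
    using pow inv F(6) by (auto simp: power_int_def)
qed

lemma rpoly_in_subfield:
  assumes "complex_subfield F" "x \<in> F"
  shows "rpoly q x \<in> F"
  by (induction q) (auto intro: assms complex_subfieldD[OF assms(1)] complex_subfield_of_rat)

lemma embedding_rpoly:
  assumes "complex_subfield K" "\<phi> \<in> embeddings K" "x \<in> K"
  shows "\<phi> (rpoly q x) = rpoly q (\<phi> x)"
  using assms
  by (induction q)
     (auto simp: embeddingsD[OF assms(2,1)] complex_subfield_of_rat rpoly_in_subfield complex_subfieldD[OF assms(1)])

locale number_field =
  fixes \<alpha> :: complex and d :: nat and K :: "complex set"
  assumes alg: "algebraic \<alpha>" and degree_eq: "rat_degree \<alpha> = d" and K_eq: "K = rat_adjoin \<alpha>"
begin

text \<open>A minimal polynomial of \<alpha> up to a nonzero factor; it is not made monic because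
  only degree and divisibility matter.\<close>

definition minp :: "rat poly" where
  "minp = (SOME p. p \<noteq> 0 \<and> degree p = d \<and> rpoly p \<alpha> = 0)"

lemma minp: "minp \<noteq> 0" "degree minp = d" "rpoly minp \<alpha> = 0"
  and degree_ge: "\<And>q. q \<noteq> 0 \<Longrightarrow> rpoly q \<alpha> = 0 \<Longrightarrow> d \<le> degree q"
proof -
  obtain p :: "int poly" where p: "poly (map_poly of_int p) \<alpha> = 0" "p \<noteq> 0"
    using alg by (auto elim: algebraicE')
  define P where "P = (\<lambda>n. \<exists>p :: rat poly. p \<noteq> 0 \<and> degree p = n \<and> poly (map_poly of_rat p) \<alpha> = 0)"
  have "map_poly of_rat (map_poly of_int p :: rat poly) = (map_poly of_int p :: complex poly)"
    by (auto simp: poly_eq_iff coeff_map_poly)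
  hence "P (degree (map_poly of_int p :: rat poly))"
    unfolding P_def using p by (intro exI[of _ "map_poly of_int p"]) (auto simp: map_poly_eq_0_iff)
  hence "P (LEAST n. P n)" by (rule LeastI)
  hence "P d" using degree_eq by (simp add: rat_degree_def P_def)
  hence "\<exists>p. p \<noteq> 0 \<and> degree p = d \<and> rpoly p \<alpha> = 0" by (simp add: P_def rpoly_def)
  from someI_ex[OF this] show "minp \<noteq> 0" "degree minp = d" "rpoly minp \<alpha> = 0"
    by (auto simp: minp_def)
  fix q :: "rat poly" assume "q \<noteq> 0" "rpoly q \<alpha> = 0"
  hence "P (degree q)" by (auto simp: P_def rpoly_def)
  hence "(LEAST n. P n) \<le> degree q" by (rule Least_le)
  thus "d \<le> degree q" using degree_eq by (simp add: rat_degree_def P_def)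
qed

lemma d_pos: "d > 0"
proof (rule ccontr)
  assume "\<not> d > 0"
  then obtain c where "minp = [:c:]" using minp(2) by (metis degree_eq_zeroE not_gr_zero)
  with minp show False by auto
qed

lemma minp_dvd:
  assumes "rpoly q \<alpha> = 0"
  shows "minp dvd q"
proof -
  have "q = minp * (q div minp) + q mod minp" by simp
  hence "rpoly q \<alpha> = rpoly minp \<alpha> * rpoly (q div minp) \<alpha> + rpoly (q mod minp) \<alpha>"
    by (metis rpoly_add rpoly_mult)
  hence "rpoly (q mod minp) \<alpha> = 0" using assms minp by simp
  hence "q mod minp = 0"
    using degree_ge[of "q mod minp"] degree_mod_less[OF minp(1), of q] minp(2)
    by (metis leD)
  thus ?thesis by (simp add: mod_eq_0_iff_dvd)
qed

text \<open>Irreducibility of \<open>minp\<close> in the form used below. Euclidean descent passes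
  from \<open>q\<close> to \<open>minp mod q\<close>. A zero remainder would split
  \<open>minp\<close> into two factors of degree below \<open>d\<close>, one of which would vanish
  at \<alpha>, against minimality.\<close>

lemma minp_bezout:
  assumes "q \<noteq> 0" "degree q < d"
  shows "\<exists>u v. u * minp + v * q = 1"
  using assms
proof (induction "degree q" arbitrary: q rule: less_induct)
  case less
  show ?case
  proof (cases "degree q = 0")
    case True
    then obtain c where c: "q = [:c:]" by (metis degree_eq_zeroE)
    hence "0 * minp + [:1 / c:] * q = 1" using less.prems by (simp add: one_pCons)
    thus ?thesis by blast
  next
    case False
    define r where "r = minp mod q"
    have eq: "minp = (minp div q) * q + r" by (simp add: r_def)
    have "r \<noteq> 0"
    proof
      assume "r = 0"
      hence m: "minp = (minp div q) * q" using eq by simp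
      have h: "minp div q \<noteq> 0" using m minp(1) by auto
      have "d = degree (minp div q) + degree q"
        using m h less.prems degree_mult_eq minp(2) by metis
      hence "degree (minp div q) < d" using False by simp
      hence "rpoly (minp div q) \<alpha> \<noteq> 0" using degree_ge[OF h] by auto
      moreover have "rpoly q \<alpha> \<noteq> 0" using degree_ge[of q] less.prems by auto
      ultimately show False using m minp(3) by (metis mult_eq_0_iff rpoly_mult)
    qed
    moreover have "degree r < degree q"
      using degree_mod_less[of q minp] \<open>r \<noteq> 0\<close> less.prems unfolding r_def by auto
    ultimately obtain u v where uv: "u * minp + v * r = 1"
      using less.hyps[of r] less.prems by auto
    have "r = minp - (minp div q) * q" using eq by (simp add: algebra_simps)
    hence "(u + v) * minp + (- (v * (minp div q))) * q = 1"
      using uv unfolding \<open>r = minp - (minp div q) * q\<close> by (simp add: algebra_simps)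
    thus ?thesis by blast
  qed
qed

lemma rpoly_reduce:
  obtains q' where "degree q' < d" "rpoly q' \<alpha> = rpoly q \<alpha>"
proof (rule that[of "q mod minp"])
  show "degree (q mod minp) < d"
    using degree_mod_less[OF minp(1), of q] minp(2) d_pos by auto
  have "q = minp * (q div minp) + q mod minp" by simp
  hence "rpoly q \<alpha> = rpoly minp \<alpha> * rpoly (q div minp) \<alpha> + rpoly (q mod minp) \<alpha>"
    by (metis rpoly_add rpoly_mult)
  thus "rpoly (q mod minp) \<alpha> = rpoly q \<alpha>" using minp by simp
qed

lemma K_subfield: "complex_subfield K"
  by (simp add: K_eq complex_subfield_rat_adjoin)

lemmas K_closed = complex_subfieldD[OF K_subfield]
lemmas embD = embeddingsD[OF _ K_subfield]

lemma alpha_in_K: "\<alpha> \<in> K"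
  by (simp add: K_eq in_rat_adjoin)

text \<open>The polynomial expressions in \<alpha> already form a field: after reduction below
  degree \<open>d\<close>, the Bezout cofactor of \<open>q\<close> evaluates at \<alpha> to the
  inverse.\<close>

lemma K_range: "K = range (\<lambda>q. rpoly q \<alpha>)"
proof
  show "range (\<lambda>q. rpoly q \<alpha>) \<subseteq> K" using rpoly_in_subfield[OF K_subfield alpha_in_K] by auto
  have "complex_subfield (range (\<lambda>q. rpoly q \<alpha>))"
    unfolding complex_subfield_def
  proof (intro conjI ballI)
    show "0 \<in> range (\<lambda>q. rpoly q \<alpha>)" by (rule image_eqI[of _ _ 0]) auto
    show "1 \<in> range (\<lambda>q. rpoly q \<alpha>)" by (rule image_eqI[of _ _ 1]) auto
    fix x y assume "x \<in> range (\<lambda>q. rpoly q \<alpha>)" "y \<in> range (\<lambda>q. rpoly q \<alpha>)"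
    then obtain p q where pq: "x = rpoly p \<alpha>" "y = rpoly q \<alpha>" by blast
    show "x + y \<in> range (\<lambda>q. rpoly q \<alpha>)" by (rule image_eqI[of _ _ "p + q"]) (auto simp: pq)
    show "x * y \<in> range (\<lambda>q. rpoly q \<alpha>)" by (rule image_eqI[of _ _ "p * q"]) (auto simp: pq)
  next
    fix x assume x: "x \<in> range (\<lambda>q. rpoly q \<alpha>)"
    then obtain p where p: "x = rpoly p \<alpha>" by blast
    show "- x \<in> range (\<lambda>q. rpoly q \<alpha>)" by (rule image_eqI[of _ _ "- p"]) (auto simp: p)
    show "inverse x \<in> range (\<lambda>q. rpoly q \<alpha>)"
    proof (cases "x = 0")
      case True
      thus ?thesis by (intro image_eqI[of _ _ 0]) auto
    next
      case False
      obtain q0 where "x = rpoly q0 \<alpha>" using x by auto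
      then obtain q where q: "degree q < d" "rpoly q \<alpha> = x" using rpoly_reduce by metis
      moreover have "q \<noteq> 0" using q False by auto
      ultimately obtain u v where "u * minp + v * q = 1" using minp_bezout by blast
      hence "rpoly (u * minp + v * q) \<alpha> = 1" by simp
      hence "rpoly v \<alpha> * x = 1" using minp(3) q by simp
      hence "inverse x = rpoly v \<alpha>" using False by (simp add: field_simps)
      thus ?thesis by simp
    qed
  qed
  moreover have "\<alpha> \<in> range (\<lambda>q. rpoly q \<alpha>)" by (rule image_eqI[of _ _ "[:0,1:]"]) auto
  ultimately show "K \<subseteq> range (\<lambda>q. rpoly q \<alpha>)" unfolding K_eq by (rule rat_adjoin_least)
qed

lemma K_coeffs:
  assumes "x \<in> K"
  obtains q where "degree q < d" "x = rpoly q \<alpha>"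
proof -
  obtain q where "x = rpoly q \<alpha>" using assms K_range by blast
  thus ?thesis using rpoly_reduce that by metis
qed

section \<open>Conjugates of \<alpha> and embeddings of \<open>K\<close>\<close>

definition roots :: "complex set" where "roots = {z. rpoly minp z = 0}"

text \<open>Separability in characteristic zero: \<open>pderiv minp\<close> is nonzero of degree
  below \<open>d\<close>, so a Bezout identity with \<open>minp\<close> excludes a common
  root.\<close>

lemma card_roots: "card roots = d" "finite roots"
proof -
  let ?p = "map_poly of_rat minp :: complex poly"
  have p0: "?p \<noteq> 0" using minp by (simp add: map_poly_eq_0_iff)
  have deg: "degree ?p = d" by (simp add: degree_map_poly minp(2))
  have roots: "roots = {z. poly ?p z = 0}" by (simp add: roots_def rpoly_def)
  have pd: "pderiv minp \<noteq> 0" using d_pos minp(2) by (simp add: pderiv_eq_0_iff)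
  have pdd: "degree (pderiv minp) < d" using d_pos minp(2) by (simp add: degree_pderiv)
  obtain u v where uv: "u * minp + v * pderiv minp = 1" using minp_bezout[OF pd pdd] by blast
  have "rsquarefree ?p"
    unfolding rsquarefree_roots
  proof (intro allI notI)
    fix z assume z: "poly ?p z = 0 \<and> poly (pderiv ?p) z = 0"
    have "pderiv ?p = map_poly of_rat (pderiv minp)"
      by (auto simp: poly_eq_iff coeff_pderiv coeff_map_poly of_rat_mult of_rat_add)
    hence "rpoly minp z = 0" "rpoly (pderiv minp) z = 0" using z by (auto simp: rpoly_def)
    moreover have "rpoly (u * minp + v * pderiv minp) z = 1" using uv by simp
    ultimately show False by simp
  qed
  hence dec: "?p = Polynomial.smult (lead_coeff ?p) (\<Prod>z|poly ?p z = 0. [:-z, 1:])"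
    using complex_poly_decompose_rsquarefree by metis
  show "finite roots" unfolding roots by (rule poly_roots_finite[OF p0])
  have "degree ?p = degree (\<Prod>z|poly ?p z = 0. [:-z, 1:])"
    using p0 by (subst dec) (simp)
  also have "\<dots> = card roots" unfolding roots by (subst degree_prod_eq_sum_degree) auto
  finally show "card roots = d" using deg by simp
qed

lemma embedding_eqI:
  assumes "\<phi> \<in> embeddings K" "\<psi> \<in> embeddings K" "\<phi> \<alpha> = \<psi> \<alpha>"
  shows "\<phi> = \<psi>"
proof (rule extensionalityI[of _ K])
  show "\<phi> \<in> extensional K" "\<psi> \<in> extensional K" using assms by (auto simp: embeddings_def)
  fix x assume "x \<in> K"
  then obtain q where "x = rpoly q \<alpha>" by (auto elim: K_coeffs)
  thus "\<phi> x = \<psi> x" using embedding_rpoly[OF K_subfield _ alpha_in_K] assms by metis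
qed

lemma bij_embeddings_roots: "bij_betw (\<lambda>\<phi>. \<phi> \<alpha>) (embeddings K) roots"
  unfolding bij_betw_def
proof
  show "inj_on (\<lambda>\<phi>. \<phi> \<alpha>) (embeddings K)" by (rule inj_onI) (rule embedding_eqI)
  show "(\<lambda>\<phi>. \<phi> \<alpha>) ` embeddings K = roots"
  proof safe
    fix \<phi> assume \<phi>: "\<phi> \<in> embeddings K"
    have "rpoly minp (\<phi> \<alpha>) = \<phi> (rpoly minp \<alpha>)"
      using embedding_rpoly[OF K_subfield \<phi> alpha_in_K] by simp
    thus "\<phi> \<alpha> \<in> roots" using minp(3) embD(4)[OF \<phi>] by (simp add: roots_def)
  next
    fix z assume z: "z \<in> roots"
    \<comment> \<open>The embedding sends a value at \<alpha> to the value of the same polynomial at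
      \<open>z\<close>. The chosen representative is immaterial: two of them differ by a multiple of
      \<open>minp\<close>, which also vanishes at \<open>z\<close>.\<close>
    define r where "r = (\<lambda>x. SOME q. x = rpoly q \<alpha>)"
    define \<phi> where "\<phi> = restrict (\<lambda>x. rpoly (r x) z) K"
    have \<phi>: "\<phi> (rpoly q \<alpha>) = rpoly q z" for q
    proof -
      have "rpoly q \<alpha> = rpoly (r (rpoly q \<alpha>)) \<alpha>" unfolding r_def by (rule someI[of _ q]) simp
      hence "minp dvd r (rpoly q \<alpha>) - q" by (intro minp_dvd) simp
      then obtain h where "r (rpoly q \<alpha>) - q = minp * h" by (elim dvdE)
      hence "rpoly (r (rpoly q \<alpha>) - q) z = 0" using z by (simp add: roots_def)
      thus ?thesis using K_range by (simp add: \<phi>_def)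
    qed
    have "\<phi> \<in> embeddings K"
      unfolding embeddings_def
    proof (intro CollectI conjI ballI)
      show "\<phi> \<in> extensional K" by (simp add: \<phi>_def)
      show "\<phi> 1 = 1" using \<phi>[of 1] by simp
      fix x y assume "x \<in> K" "y \<in> K"
      then obtain p q where "x = rpoly p \<alpha>" "y = rpoly q \<alpha>" by (metis K_coeffs)
      thus "\<phi> (x + y) = \<phi> x + \<phi> y" "\<phi> (x * y) = \<phi> x * \<phi> y"
        using \<phi>[of "p + q"] \<phi>[of "p * q"] by (simp_all add: \<phi>)
    qed
    moreover have "\<phi> \<alpha> = z" using \<phi>[of "[:0,1:]"] by simp
    ultimately show "z \<in> (\<lambda>\<phi>. \<phi> \<alpha>) ` embeddings K" by blast
  qed
qed

lemma card_embeddings: "card (embeddings K) = d"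
  using bij_betw_same_card[OF bij_embeddings_roots] card_roots by simp

lemma finite_embeddings: "finite (embeddings K)"
  using bij_betw_finite[OF bij_embeddings_roots] card_roots by simp

lemma rpoly_eq_0_if_embeddings:
  assumes "inj_on (\<lambda>\<phi>. \<phi> \<gamma>) (embeddings K)" "degree q < d" "\<gamma> \<in> K" "rpoly q \<gamma> = 0"
  shows "q = 0"
proof (rule rpoly_eq_0_if_many_roots)
  show "finite ((\<lambda>\<phi>. \<phi> \<gamma>) ` embeddings K)" using finite_embeddings by simp
  show "degree q < card ((\<lambda>\<phi>. \<phi> \<gamma>) ` embeddings K)"
    using assms by (simp add: card_image card_embeddings)
  fix z assume "z \<in> (\<lambda>\<phi>. \<phi> \<gamma>) ` embeddings K"
  then obtain \<phi> where "\<phi> \<in> embeddings K" "z = \<phi> \<gamma>" by auto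
  thus "rpoly q z = 0" using embedding_rpoly[OF K_subfield, of \<phi> \<gamma> q] assms embD(4)[of \<phi>] by auto
qed

text \<open>The powers of \<open>\<gamma>\<close> below \<open>d\<close> are linearly independent over the rationals, since a relation would be
  a polynomial of degree below \<open>d\<close> vanishing at the \<open>d\<close> conjugates.\<close>

lemma rat_adjoin_eq_K:
  assumes \<gamma>: "\<gamma> \<in> K" and inj: "inj_on (\<lambda>\<phi>. \<phi> \<gamma>) (embeddings K)"
  shows "rat_adjoin \<gamma> = K"
proof
  show "rat_adjoin \<gamma> \<subseteq> K" by (rule rat_adjoin_least[OF K_subfield \<gamma>])
  interpret V: vector_space "\<lambda>(q :: rat) (z :: complex). of_rat q * z"
    by unfold_locales (simp_all add: algebra_simps of_rat_add of_rat_mult)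
  define A where "A = (\<lambda>i. \<alpha> ^ i) ` {..<d}"
  define G where "G = (\<lambda>i. \<gamma> ^ i) ` {..<d}"
  note zero = rpoly_eq_0_if_embeddings[OF inj _ \<gamma>]
  have "finite A" "finite G" by (auto simp: A_def G_def)
  have card_A: "card A \<le> d" unfolding A_def using card_image_le[of "{..<d}"] by simp
  have inj_G: "inj_on (\<lambda>i. \<gamma> ^ i) {..<d}"
  proof (rule inj_onI, rule ccontr)
    fix i j assume ij: "i \<in> {..<d}" "j \<in> {..<d}" "\<gamma> ^ i = \<gamma> ^ j" "i \<noteq> j"
    \<comment> \<open>\<open>G\<close> is a set, so coinciding powers must be excluded before its
      size is known to be \<open>d\<close>. A coincidence is itself a relation of degree below
      \<open>d\<close>.\<close>
    define c :: "nat \<Rightarrow> rat" where "c = (\<lambda>k. (if k = i then 1 else 0) - (if k = j then 1 else 0))"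
    have "rpoly (\<Sum>k<d. monom (c k) k) \<gamma> = (\<Sum>k<d. (if k = i then \<gamma> ^ k else 0) - (if k = j then \<gamma> ^ k else 0))"
      unfolding rpoly_sum_monom[OF d_pos] by (intro sum.cong) (auto simp: c_def)
    also have "\<dots> = 0" using ij by (simp add: sum_subtractf)
    finally have "(\<Sum>k<d. monom (c k) k) = 0" using degree_sum_monom_less[OF d_pos] by (intro zero)
    hence "c i = 0" using coeff_sum_monom[of i d c] ij by simp
    thus False using ij by (simp add: c_def)
  qed
  have "V.independent G"
  proof (rule V.independent_if_scalars_zero[OF \<open>finite G\<close>])
    fix f x assume f: "(\<Sum>x\<in>G. of_rat (f x) * x) = 0" and x: "x \<in> G"
    have "rpoly (\<Sum>k<d. monom (f (\<gamma> ^ k)) k) \<gamma> = 0"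
      using f unfolding rpoly_sum_monom[OF d_pos] G_def by (simp add: sum.reindex[OF inj_G])
    hence *: "(\<Sum>k<d. monom (f (\<gamma> ^ k)) k) = 0" using degree_sum_monom_less[OF d_pos] by (intro zero)
    obtain i where "i < d" "x = \<gamma> ^ i" using x by (auto simp: G_def)
    thus "f x = 0" using coeff_sum_monom[of i d "\<lambda>k. f (\<gamma> ^ k)"] * by simp
  qed
  have K_span: "K \<subseteq> V.span A"
  proof
    fix x assume "x \<in> K"
    then obtain q where "degree q < d" "x = rpoly q \<alpha>" by (rule K_coeffs)
    hence "x = (\<Sum>i<d. of_rat (coeff q i) * \<alpha> ^ i)" by (simp add: rpoly_altdef)
    also have "\<dots> \<in> V.span A" by (intro V.span_sum V.span_scale V.span_base) (auto simp: A_def)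
    finally show "x \<in> V.span A" .
  qed
  have pow: "\<gamma> ^ i \<in> F" if "complex_subfield F" "\<gamma> \<in> F" for F i
    by (induction i) (auto intro: that complex_subfieldD[OF that(1)])
  \<comment> \<open>Otherwise \<open>insert \<alpha> G\<close> would consist of \<open>d + 1\<close>
    independent elements in the span of the at most \<open>d\<close> elements of
    \<open>A\<close>.\<close>
  have "\<alpha> \<in> V.span G"
  proof (rule ccontr)
    assume n: "\<alpha> \<notin> V.span G"
    hence "V.independent (insert \<alpha> G)" using \<open>V.independent G\<close> by (simp add: V.independent_insertI)
    moreover have "insert \<alpha> G \<subseteq> V.span A"
      using K_span alpha_in_K pow[OF K_subfield \<gamma>] by (auto simp: G_def)
    ultimately have "card (insert \<alpha> G) \<le> card A"
      using V.independent_span_bound[OF \<open>finite A\<close>] by blast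
    moreover have "\<alpha> \<notin> G" using n V.span_base by blast
    moreover have "card G = d" using card_image[OF inj_G] by (simp add: G_def)
    ultimately show False using card_A \<open>finite G\<close> by simp
  qed
  moreover have "V.span G \<subseteq> rat_adjoin \<gamma>"
  proof (rule V.span_minimal)
    note F = complex_subfield_rat_adjoin[of \<gamma>]
    show "G \<subseteq> rat_adjoin \<gamma>" using pow[OF F in_rat_adjoin] by (auto simp: G_def)
    show "V.subspace (rat_adjoin \<gamma>)"
      by (rule V.subspaceI)
         (auto intro: complex_subfieldD[OF F] complex_subfield_of_rat[OF F])
  qed
  ultimately show "K \<subseteq> rat_adjoin \<gamma>"
    unfolding K_eq by (intro rat_adjoin_least complex_subfield_rat_adjoin) auto
qed

end

section \<open>Characteristic polynomials and finiteness\<close>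

lemma coeff_linear_mult:
  "coeff ([:b, 1:] * p) k = b * coeff p k + (if k = 0 then 0 else coeff p (k - 1))"
  for b :: "'a :: comm_ring_1"
  by (cases k) (auto simp: coeff_pCons)

lemma algebraic_int_coeff_prod_linear:
  fixes a :: "'a \<Rightarrow> complex"
  assumes "finite I" "\<And>i. i \<in> I \<Longrightarrow> algebraic_int (a i)"
  shows "algebraic_int (coeff (\<Prod>i\<in>I. [:- a i, 1:]) k)"
  using assms
proof (induction I arbitrary: k rule: finite_induct)
  case empty
  thus ?case by (auto simp: coeff_1 algebraic_int_1)
next
  case (insert i I)
  thus ?case
    unfolding prod.insert[OF insert.hyps] coeff_linear_mult
    by (intro algebraic_int_add algebraic_int_mult) auto
qed

text \<open>Each linear factor enlarges the bound by at most \<open>1 + B\<close>: the shift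
  contributes 1 and the constant term contributes \<open>B\<close>.\<close>

lemma norm_coeff_prod_linear:
  fixes a :: "'a \<Rightarrow> complex"
  assumes "finite I" "B \<ge> 0" "\<And>i. i \<in> I \<Longrightarrow> cmod (a i) \<le> B"
  shows "cmod (coeff (\<Prod>i\<in>I. [:- a i, 1:]) k) \<le> (1 + B) ^ card I"
  using assms(1,3)
proof (induction I arbitrary: k rule: finite_induct)
  case empty
  thus ?case by (auto simp: coeff_1)
next
  case (insert i I)
  let ?p = "\<Prod>i\<in>I. [:- a i, 1:]"
  have "cmod (- a i * coeff ?p k) \<le> B * (1 + B) ^ card I"
    using insert assms(2) by (simp add: norm_mult mult_mono)
  moreover have "cmod (if k = 0 then 0 else coeff ?p (k - 1)) \<le> (1 + B) ^ card I"
    using insert assms(2) by auto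
  ultimately have "cmod (- a i * coeff ?p k + (if k = 0 then 0 else coeff ?p (k - 1)))
      \<le> B * (1 + B) ^ card I + (1 + B) ^ card I"
    by (intro norm_triangle_le add_mono)
  thus ?case
    unfolding prod.insert[OF insert.hyps] coeff_linear_mult
    using insert.hyps by (simp add: algebra_simps)
qed

lemma finite_Ints_bounded: "finite {z \<in> \<int>. cmod z \<le> C}"
proof (rule finite_subset)
  show "{z \<in> \<int>. cmod z \<le> C} \<subseteq> of_int ` {- \<lfloor>C\<rfloor>..\<lfloor>C\<rfloor>}"
  proof safe
    fix z :: complex assume "z \<in> \<int>" "cmod z \<le> C"
    then obtain k where k: "z = of_int k" "\<bar>real_of_int k\<bar> \<le> C" by (auto elim: Ints_cases)
    hence "k \<le> \<lfloor>C\<rfloor>" "- k \<le> \<lfloor>C\<rfloor>" unfolding le_floor_iff by auto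
    hence "k \<in> {- \<lfloor>C\<rfloor>..\<lfloor>C\<rfloor>}" by simp
    thus "z \<in> of_int ` {- \<lfloor>C\<rfloor>..\<lfloor>C\<rfloor>}" using k by auto
  qed
qed auto

lemma finite_bounded_int_polys:
  "finite {p :: complex poly. degree p \<le> n \<and> (\<forall>k. coeff p k \<in> \<int> \<and> cmod (coeff p k) \<le> C)}"
proof (rule finite_imageD)
  let ?S = "{p :: complex poly. degree p \<le> n \<and> (\<forall>k. coeff p k \<in> \<int> \<and> cmod (coeff p k) \<le> C)}"
  have "(\<lambda>p. restrict (coeff p) {..n}) ` ?S \<subseteq> {..n} \<rightarrow>\<^sub>E {z \<in> \<int>. cmod z \<le> C}"
    by (auto split: if_splits)
  thus "finite ((\<lambda>p. restrict (coeff p) {..n}) ` ?S)"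
    by (rule finite_subset) (intro finite_PiE finite_Ints_bounded, simp)
  show "inj_on (\<lambda>p. restrict (coeff p) {..n}) ?S"
  proof (rule inj_onI)
    fix p q assume pq: "p \<in> ?S" "q \<in> ?S" "restrict (coeff p) {..n} = restrict (coeff q) {..n}"
    have "coeff p k = coeff q k" for k
    proof (cases "k \<le> n")
      case True
      thus ?thesis using fun_cong[OF pq(3), of k] by simp
    next
      case False
      thus ?thesis using pq(1,2) by (simp add: coeff_eq_0)
    qed
    thus "p = q" by (simp add: poly_eq_iff)
  qed
qed

text \<open>A nonzero kernel vector would be the coefficient vector of a polynomial of degree below
  \<open>n\<close> with \<open>n\<close> distinct roots.\<close>

lemma vandermonde_det_nonzero:
  fixes x :: "nat \<Rightarrow> complex"
  assumes inj: "inj_on x {..<n}"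
  shows "det (mat n n (\<lambda>(k,j). x k ^ j)) \<noteq> 0"
proof
  define V where "V = mat n n (\<lambda>(k,j). x k ^ j)"
  have V: "V \<in> carrier_mat n n" by (simp add: V_def)
  assume "det (mat n n (\<lambda>(k,j). x k ^ j)) = 0"
  then obtain v where v: "v \<in> carrier_vec n" "v \<noteq> 0\<^sub>v n" "V *\<^sub>v v = 0\<^sub>v n"
    using det_0_iff_vec_prod_zero_field[OF V] by (auto simp: V_def)
  define p where "p = (\<Sum>j<n. monom (vec_index v j) j)"
  have coeff_p: "coeff p j = vec_index v j" if "j < n" for j
    using that by (simp add: p_def coeff_sum)
  obtain j where j: "j < n" "vec_index v j \<noteq> 0"
  proof (rule ccontr)
    assume "\<not> thesis"
    hence "\<forall>j<n. vec_index v j = 0" using that by blast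
    hence "v = 0\<^sub>v n" using v(1) by (intro eq_vecI) auto
    thus False using v(2) by simp
  qed
  have p0: "p \<noteq> 0" using coeff_p[OF j(1)] j(2) by auto
  have deg: "degree p < n" unfolding p_def using j(1) by (intro degree_sum_monom_less) simp
  have "poly p (x k) = 0" if k: "k < n" for k
  proof -
    have "vec_index (V *\<^sub>v v) k = (\<Sum>j<n. x k ^ j * vec_index v j)"
      using k v(1) by (simp add: V_def scalar_prod_def atLeast0LessThan)
    thus ?thesis using v(3) k by (simp add: p_def poly_sum poly_monom mult_ac)
  qed
  hence "x ` {..<n} \<subseteq> {z. poly p z = 0}" by auto
  hence "card (x ` {..<n}) \<le> card {z. poly p z = 0}" by (intro card_mono poly_roots_finite p0)
  also have "\<dots> \<le> degree p" by (rule card_poly_roots_bound[OF p0])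
  finally show False using deg by (simp add: card_image[OF inj])
qed

section \<open>Characteristic polynomial, norm, and numbers with bounded conjugates\<close>

context number_field
begin

text \<open>For \<open>y\<close> in \<open>K\<close> this is the characteristic polynomial of
  multiplication by \<open>y\<close>, written through the conjugates because these carry the size
  estimates.\<close>

definition cpoly :: "complex \<Rightarrow> complex poly" where
  "cpoly y = (\<Prod>\<phi>\<in>embeddings K. [:- \<phi> y, 1:])"

lemma pow_in_K: "x \<in> K \<Longrightarrow> x ^ n \<in> K"
  by (induction n) (auto intro: K_closed)

text \<open>Multiplication by \<open>y\<close> in the basis of powers of \<open>\<alpha>\<close> has a rational matrix, and the
  Vandermonde matrix of the conjugates of \<open>\<alpha>\<close> diagonalises it.\<close>

lemma cpoly_rational:
  assumes y: "y \<in> K"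
  obtains p where "cpoly y = map_poly of_rat p"
proof -
  obtain f where f: "bij_betw f {..<d} (embeddings K)"
    using ex_bij_betw_nat_finite[OF finite_embeddings] card_embeddings by (auto simp: atLeast0LessThan)
  have fE: "f k \<in> embeddings K" if "k < d" for k
    using f that by (auto simp: bij_betw_def)
  have "\<exists>q. degree q < d \<and> y * \<alpha> ^ i = rpoly q \<alpha>" for i
    using K_coeffs[of "y * \<alpha> ^ i"] y alpha_in_K K_closed(4) pow_in_K by metis
  then obtain q where q: "\<And>i. degree (q i) < d" "\<And>i. y * \<alpha> ^ i = rpoly (q i) \<alpha>" by metis
  define N where "N = mat d d (\<lambda>(j,i). coeff (q i) j)"
  define Nc :: "complex mat" where "Nc = map_mat of_rat N"
  define V where "V = mat d d (\<lambda>(k,j). f k \<alpha> ^ j)"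
  define D where "D = mat d d (\<lambda>(i,j). if i = j then f i y else 0)"
  have carr: "N \<in> carrier_mat d d" "Nc \<in> carrier_mat d d" "V \<in> carrier_mat d d" "D \<in> carrier_mat d d"
    by (simp_all add: N_def Nc_def V_def D_def)
  \<comment> \<open>Column \<open>i\<close> of \<open>N\<close> holds the coordinates of
    \<open>y * \<alpha> ^ i\<close>, so both products have the entry
    \<open>f k (y * \<alpha> ^ i)\<close> in row \<open>k\<close> and column
    \<open>i\<close>.\<close>
  have VN: "V * Nc = D * V"
  proof (rule eq_matI)
    fix k i assume "k < dim_row (D * V)" "i < dim_col (D * V)"
    hence ki: "k < d" "i < d" using carr by auto
    have "(V * Nc) $$ (k, i) = (\<Sum>j<d. f k \<alpha> ^ j * of_rat (coeff (q i) j))"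
      using ki carr by (simp add: scalar_prod_def V_def Nc_def N_def atLeast0LessThan)
    also have "\<dots> = rpoly (q i) (f k \<alpha>)"
      by (simp add: rpoly_altdef[OF q(1)] mult_ac)
    also have "\<dots> = f k (y * \<alpha> ^ i)"
      using embedding_rpoly[OF K_subfield fE[OF ki(1)] alpha_in_K, of "q i"] q(2) by simp
    also have "\<dots> = f k y * f k \<alpha> ^ i"
      using embD(3,11)[OF fE[OF ki(1)]] y alpha_in_K pow_in_K by simp
    also have "\<dots> = (\<Sum>j<d. if k = j then f j y * f j \<alpha> ^ i else 0)"
      using ki by simp
    also have "\<dots> = (\<Sum>j<d. (if k = j then f k y else 0) * f j \<alpha> ^ i)"
      by (intro sum.cong) auto
    also have "\<dots> = (D * V) $$ (k, i)"
      using ki carr by (simp add: scalar_prod_def V_def D_def atLeast0LessThan)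
    finally show "(V * Nc) $$ (k, i) = (D * V) $$ (k, i)" .
  qed (use carr in auto)
  have "inj_on (\<lambda>k. f k \<alpha>) {..<d}"
    using f embedding_eqI fE unfolding bij_betw_def inj_on_def by (metis lessThan_iff)
  hence "det V \<noteq> 0" unfolding V_def by (rule vandermonde_det_nonzero)
  hence "V \<in> Units (ring_mat TYPE(complex) d ())" by (rule det_non_zero_imp_unit[OF carr(3)])
  then obtain Vi where Vi: "Vi \<in> carrier_mat d d" "Vi * V = 1\<^sub>m d" "V * Vi = 1\<^sub>m d"
    by (auto simp: Units_def ring_mat_simps)
  have "Nc = (Vi * V) * Nc" using carr Vi by simp
  also have "\<dots> = Vi * (V * Nc)" using carr Vi by (intro assoc_mult_mat) auto
  also have "\<dots> = Vi * D * V" unfolding VN using carr Vi by (intro assoc_mult_mat[symmetric]) auto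
  finally have "similar_mat Nc D"
    using carr Vi by (intro similar_matI[of _ _ Vi V d]) auto
  hence "char_poly Nc = char_poly D" by (rule char_poly_similar)
  also have "\<dots> = (\<Prod>a\<leftarrow>diag_mat D. [:- a, 1:])"
    by (rule char_poly_upper_triangular[OF carr(4)]) (auto simp: upper_triangular_def D_def)
  also have "diag_mat D = map (\<lambda>i. f i y) [0..<d]"
    by (auto simp: diag_mat_def D_def)
  also have "(\<Prod>a\<leftarrow>\<dots>. [:- a, 1:]) = (\<Prod>i<d. [:- f i y, 1:])"
    by (simp add: prod.distinct_set_conv_list[symmetric] atLeast0LessThan o_def)
  also have "\<dots> = cpoly y"
    unfolding cpoly_def using prod.reindex_bij_betw[OF f, of "\<lambda>\<phi>. [:- \<phi> y, 1:]"] by simp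
  finally have "cpoly y = char_poly Nc" ..
  also have "\<dots> = map_poly of_rat (char_poly N)"
    unfolding Nc_def by (rule of_rat_hom.char_poly_hom[OF carr(1)])
  finally show ?thesis by (rule that)
qed

lemma embedding_algebraic_int:
  assumes "\<phi> \<in> embeddings K" "y \<in> K" "algebraic_int y"
  shows "algebraic_int (\<phi> y)"
proof -
  obtain p where p: "poly (map_poly of_int p) y = 0" "lead_coeff p = 1"
    using assms(3) by (auto simp: algebraic_int_altdef_ipoly)
  have eq: "map_poly of_rat (map_poly of_int p :: rat poly) = (map_poly of_int p :: complex poly)"
    by (auto simp: poly_eq_iff coeff_map_poly)
  have "\<phi> (rpoly (map_poly of_int p) y) = rpoly (map_poly of_int p) (\<phi> y)"
    by (rule embedding_rpoly[OF K_subfield assms(1,2)])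
  hence "poly (map_poly of_int p) (\<phi> y) = 0"
    using p(1) embD(4)[OF assms(1)] by (simp add: rpoly_def eq)
  thus ?thesis using p(2) by (auto simp: algebraic_int_altdef_ipoly)
qed

text \<open>The matrix description makes the coefficients rational and the product over conjugates
  makes them algebraic integers; together they are integers.\<close>

lemma coeff_cpoly_Ints:
  assumes "y \<in> int_ring K"
  shows "coeff (cpoly y) k \<in> \<int>"
proof -
  have y: "y \<in> K" "algebraic_int y" using assms by (auto simp: int_ring_def)
  obtain p where "cpoly y = map_poly of_rat p" using cpoly_rational[OF y(1)] .
  hence "coeff (cpoly y) k \<in> \<rat>" by (simp add: coeff_map_poly)
  moreover have "algebraic_int (coeff (cpoly y) k)"
    unfolding cpoly_def using y
    by (intro algebraic_int_coeff_prod_linear[OF finite_embeddings]) (rule embedding_algebraic_int)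
  ultimately show ?thesis by (simp add: rational_algebraic_int_is_int)
qed

definition nrm :: "complex \<Rightarrow> complex" where
  "nrm y = (\<Prod>\<phi>\<in>embeddings K. \<phi> y)"

lemma nrm_Ints:
  assumes "y \<in> int_ring K"
  shows "nrm y \<in> \<int>"
proof -
  have "coeff (cpoly y) 0 = (\<Prod>\<phi>\<in>embeddings K. - \<phi> y)"
    unfolding poly_0_coeff_0[symmetric] cpoly_def by (simp add: poly_prod)
  also have "\<dots> = (-1) ^ card (embeddings K) * nrm y"
    unfolding nrm_def by (simp flip: prod_constant prod.distrib)
  finally have "nrm y = (-1) ^ card (embeddings K) * coeff (cpoly y) 0" by simp
  thus ?thesis using coeff_cpoly_Ints[OF assms, of 0] by simp
qed

lemma id_embedding: "restrict (\<lambda>x. x) K \<in> embeddings K"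
  by (auto simp: embeddings_def K_closed)

text \<open>Northcott's argument: bounded conjugates bound the integer coefficients of
  \<open>cpoly y\<close>, so only finitely many polynomials occur, and each has finitely many
  roots.\<close>

lemma finite_int_ring_bounded:
  "finite {y \<in> int_ring K. \<forall>\<phi>\<in>embeddings K. cmod (\<phi> y) \<le> B}"
proof (cases "B \<ge> 0")
  case True
  define P where "P = {p :: complex poly. degree p \<le> d \<and>
      (\<forall>k. coeff p k \<in> \<int> \<and> cmod (coeff p k) \<le> (1 + B) ^ d)}"
  let ?S = "{y \<in> int_ring K. \<forall>\<phi>\<in>embeddings K. cmod (\<phi> y) \<le> B}"
  have "?S \<subseteq> (\<Union>p\<in>P - {0}. {z. poly p z = 0})"
  proof
    fix y assume y: "y \<in> ?S"
    hence yK: "y \<in> K" by (auto simp: int_ring_def)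
    have "cpoly y \<noteq> 0" using finite_embeddings by (auto simp: cpoly_def)
    moreover have "poly (cpoly y) y = 0"
      unfolding cpoly_def poly_prod using finite_embeddings id_embedding yK
      by (intro prod_zero) (auto intro!: bexI[of _ "restrict (\<lambda>x. x) K"])
    moreover have "cpoly y \<in> P"
      unfolding P_def
    proof (intro CollectI conjI allI)
      show "degree (cpoly y) \<le> d"
        unfolding cpoly_def by (subst degree_prod_eq_sum_degree) (auto simp: card_embeddings)
      fix k
      show "coeff (cpoly y) k \<in> \<int>" using y by (intro coeff_cpoly_Ints) auto
      show "cmod (coeff (cpoly y) k) \<le> (1 + B) ^ d"
        unfolding cpoly_def card_embeddings[symmetric] using y True
        by (intro norm_coeff_prod_linear finite_embeddings) auto
    qed
    ultimately show "y \<in> (\<Union>p\<in>P - {0}. {z. poly p z = 0})" by blast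
  qed
  moreover have "finite (\<Union>p\<in>P - {0}. {z. poly p z = 0})"
    unfolding P_def by (intro finite_UN_I finite_Diff finite_bounded_int_polys poly_roots_finite) auto
  ultimately show ?thesis by (rule finite_subset)
next
  case False
  have "{y \<in> int_ring K. \<forall>\<phi>\<in>embeddings K. cmod (\<phi> y) \<le> B} = {}"
  proof (rule equals0I)
    fix y assume "y \<in> {y \<in> int_ring K. \<forall>\<phi>\<in>embeddings K. cmod (\<phi> y) \<le> B}"
    hence "cmod (restrict (\<lambda>x. x) K y) \<le> B" using id_embedding by blast
    thus False using False order_trans[OF norm_ge_zero] by blast
  qed
  thus ?thesis by (simp only: finite.emptyI)
qed

end

section \<open>Units with prescribed logarithms\<close>

text \<open>A pigeonhole substitute for Minkowski's theorem on linear forms. The integer points of a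
  large cube outnumber the cells with sides \<open>w \<phi>\<close> that cover their values, and two
  points in one cell have a suitable difference.\<close>

lemma pigeonhole_linear_forms:
  fixes L :: "'p \<Rightarrow> nat \<Rightarrow> real" and w :: "'p \<Rightarrow> real"
  assumes P: "finite P" "card P = d" and c: "c \<ge> 0" "\<And>\<phi> i. \<phi> \<in> P \<Longrightarrow> i < d \<Longrightarrow> \<bar>L \<phi> i\<bar> \<le> c"
    and pos: "\<And>\<phi>. \<phi> \<in> P \<Longrightarrow> w \<phi> > 0" and d: "d > 0"
    and prod: "(\<Prod>\<phi>\<in>P. w \<phi>) = (2 * real d * c + 2) ^ d"
  obtains a :: "nat \<Rightarrow> int" where "\<exists>i<d. a i \<noteq> 0"
    "\<And>\<phi>. \<phi> \<in> P \<Longrightarrow> \<bar>\<Sum>i<d. of_int (a i) * L \<phi> i\<bar> \<le> w \<phi>"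
proof -
  define C where "C = 2 * real d * c + 2"
  \<comment> \<open>\<open>A\<close> bounds every \<open>w \<phi>\<close>, so the rounding term 2 in
    a number of cells is at most \<open>2 * A / w \<phi>\<close>. As the forms are bounded by
    \<open>D = d * c * A\<close>, each direction has at most
    \<open>(2 * d * c + 2) * A / w \<phi>\<close> cells, which explains the prescribed
    product.\<close>
  obtain A :: nat where A: "(\<Sum>\<phi>\<in>P. w \<phi>) \<le> real A" "A \<ge> 1"
  proof -
    obtain A0 :: nat where "(\<Sum>\<phi>\<in>P. w \<phi>) \<le> real A0" using real_arch_simple by blast
    thus ?thesis using that[of "max A0 1"] by simp
  qed
  have A': "w \<phi> \<le> real A" if "\<phi> \<in> P" for \<phi>
    using member_le_sum[of \<phi> P w] pos P(1) A(1) that by (force intro: less_imp_le)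
  define S where "S = {..<d} \<rightarrow>\<^sub>E {0..int A}"
  define F where "F = (\<lambda>a \<phi>. \<Sum>i<d. real_of_int (a i) * L \<phi> i)"
  define D where "D = real d * c * real A"
  define h where "h = (\<lambda>a. \<lambda>\<phi>\<in>P. \<lfloor>F a \<phi> / w \<phi>\<rfloor>)"
  define T where "T = (\<Pi>\<^sub>E \<phi>\<in>P. {\<lfloor>- D / w \<phi>\<rfloor>..\<lfloor>D / w \<phi>\<rfloor>})"
  have F_bound: "\<bar>F a \<phi>\<bar> \<le> D" if a: "a \<in> S" and \<phi>: "\<phi> \<in> P" for a \<phi>
  proof -
    have "\<bar>F a \<phi>\<bar> \<le> (\<Sum>i<d. \<bar>real_of_int (a i) * L \<phi> i\<bar>)" unfolding F_def by (rule sum_abs)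
    also have "\<dots> \<le> (\<Sum>i<d. real A * c)"
    proof (rule sum_mono)
      fix i assume i: "i \<in> {..<d}"
      hence "a i \<in> {0..int A}" using PiE_mem[OF a[unfolded S_def]] by blast
      hence "\<bar>real_of_int (a i)\<bar> \<le> real A" by auto
      thus "\<bar>real_of_int (a i) * L \<phi> i\<bar> \<le> real A * c"
        unfolding abs_mult using c i \<phi> by (intro mult_mono) auto
    qed
    finally show ?thesis by (simp add: D_def mult_ac)
  qed
  have "h ` S \<subseteq> T"
  proof
    fix f assume "f \<in> h ` S"
    then obtain a where a: "a \<in> S" "f = h a" by blast
    show "f \<in> T"
      unfolding T_def
    proof (rule PiE_I)
      fix \<phi> assume \<phi>: "\<phi> \<in> P"
      have "- D \<le> F a \<phi>" "F a \<phi> \<le> D" using F_bound[OF a(1) \<phi>] by linarith+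
      hence "- D / w \<phi> \<le> F a \<phi> / w \<phi>" "F a \<phi> / w \<phi> \<le> D / w \<phi>"
        using pos[OF \<phi>] by (intro divide_right_mono; simp)+
      thus "f \<phi> \<in> {\<lfloor>- D / w \<phi>\<rfloor>..\<lfloor>D / w \<phi>\<rfloor>}"
        using \<phi> by (auto simp: a h_def intro!: floor_mono)
    qed (auto simp: a h_def)
  qed
  moreover have "finite T" unfolding T_def by (intro finite_PiE P) auto
  ultimately have "card (h ` S) \<le> card T" by (intro card_mono)
  also have "real (card T) = (\<Prod>\<phi>\<in>P. real (card {\<lfloor>- D / w \<phi>\<rfloor>..\<lfloor>D / w \<phi>\<rfloor>}))"
    unfolding T_def by (simp add: card_PiE[OF P(1)])
  also have "\<dots> \<le> (\<Prod>\<phi>\<in>P. C * real A / w \<phi>)"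
  proof (rule prod_mono, intro conjI)
    fix \<phi> assume \<phi>: "\<phi> \<in> P"
    have "D / w \<phi> \<ge> 0" using pos[OF \<phi>] c by (simp add: D_def)
    hence "\<lfloor>- D / w \<phi>\<rfloor> \<le> \<lfloor>D / w \<phi>\<rfloor>" by (intro floor_mono) simp
    hence "real (card {\<lfloor>- D / w \<phi>\<rfloor>..\<lfloor>D / w \<phi>\<rfloor>}) = \<lfloor>D / w \<phi>\<rfloor> - \<lfloor>- D / w \<phi>\<rfloor> + 1"
      by simp
    also have "\<dots> \<le> 2 * D / w \<phi> + 2"
      using of_int_floor_le[of "D / w \<phi>"] floor_correct[of "- D / w \<phi>"]
      unfolding times_divide_eq_right[symmetric] minus_divide_left[symmetric] by linarith
    also have "\<dots> \<le> 2 * D / w \<phi> + 2 * (real A / w \<phi>)"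
    proof -
      have "1 \<le> real A / w \<phi>" using A'[OF \<phi>] pos[OF \<phi>] by (simp add: pos_le_divide_eq)
      thus ?thesis by linarith
    qed
    also have "\<dots> = C * real A / w \<phi>" by (simp add: C_def D_def field_simps add_divide_distrib)
    finally show "real (card {\<lfloor>- D / w \<phi>\<rfloor>..\<lfloor>D / w \<phi>\<rfloor>}) \<le> C * real A / w \<phi>" .
  qed auto
  also have "\<dots> = real A ^ d"
  proof -
    have "(\<Prod>\<phi>\<in>P. w \<phi>) \<noteq> 0" using pos P(1) by (auto simp: less_le)
    thus ?thesis using P prod by (simp add: prod_dividef C_def power_mult_distrib)
  qed
  \<comment> \<open>There are at most \<open>A ^ d\<close> cells, while coordinates from 0 to
    \<open>A\<close> inclusive give \<open>(A + 1) ^ d\<close> points.\<close>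
  also have "real A ^ d < real (A + 1) ^ d" using d by (intro power_strict_mono) auto
  also have "\<dots> = real (card S)" unfolding S_def by (simp add: card_PiE add.commute nat_add_distrib)
  finally have "card (h ` S) < card S" by simp
  hence "\<not> inj_on h S" by (rule pigeonhole)
  then obtain a b where ab: "a \<in> S" "b \<in> S" "a \<noteq> b" "h a = h b" by (auto simp: inj_on_def)
  show ?thesis
  proof (rule that[of "\<lambda>i. a i - b i"])
    show "\<exists>i<d. a i - b i \<noteq> 0"
      using PiE_ext[of a "{..<d}" "\<lambda>_. {0..int A}" b] ab by (auto simp: S_def)
    fix \<phi> assume \<phi>: "\<phi> \<in> P"
    have "\<lfloor>F a \<phi> / w \<phi>\<rfloor> = \<lfloor>F b \<phi> / w \<phi>\<rfloor>" using fun_cong[OF ab(4), of \<phi>] \<phi> by (simp add: h_def)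
    hence "\<bar>F a \<phi> / w \<phi> - F b \<phi> / w \<phi>\<bar> \<le> 1" by linarith
    hence "\<bar>F a \<phi> - F b \<phi>\<bar> \<le> w \<phi>"
      using pos[OF \<phi>] by (simp add: abs_divide flip: diff_divide_distrib)
    thus "\<bar>\<Sum>i<d. of_int (a i - b i) * L \<phi> i\<bar> \<le> w \<phi>"
      by (simp add: F_def algebra_simps sum_subtractf)
  qed
qed

context number_field
begin

section \<open>Conjugation of embeddings and an order in \<open>K\<close>\<close>

lemma emb_sum:
  assumes "\<phi> \<in> embeddings K" "\<And>i. i \<in> I \<Longrightarrow> f i \<in> K"
  shows "sum f I \<in> K \<and> \<phi> (sum f I) = (\<Sum>i\<in>I. \<phi> (f i))"
  using assms(2)
  by (induction I rule: infinite_finite_induct) (auto simp: embD[OF assms(1)] K_closed)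

lemma of_int_in_K: "of_int k \<in> K"
  using complex_subfield_of_rat[OF K_subfield, of "of_int k"] by simp

lemma emb_of_int: "\<phi> \<in> embeddings K \<Longrightarrow> \<phi> (of_int k) = of_int k"
  using embD(7)[of \<phi> "of_int k"] by simp

text \<open>Restriction keeps the result extensional. Among the embeddings, the real ones are the
  fixed points of \<open>cj\<close>.\<close>

definition cj :: "(complex \<Rightarrow> complex) \<Rightarrow> complex \<Rightarrow> complex" where
  "cj \<phi> = restrict (\<lambda>x. cnj (\<phi> x)) K"

lemma cj_apply [simp]: "x \<in> K \<Longrightarrow> cj \<phi> x = cnj (\<phi> x)"
  by (simp add: cj_def)

lemma cj_embedding: "\<phi> \<in> embeddings K \<Longrightarrow> cj \<phi> \<in> embeddings K"
  unfolding embeddings_def by (auto simp: K_closed cj_def)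

lemma cj_cj: "\<phi> \<in> embeddings K \<Longrightarrow> cj (cj \<phi>) = \<phi>"
  by (rule embedding_eqI) (auto intro: cj_embedding simp: alpha_in_K)

definition den :: int where
  "den = (SOME m. m > 0 \<and> algebraic_int (of_int m * \<alpha>))"

lemma den: "den > 0" "algebraic_int (of_int den * \<alpha>)"
proof -
  have "\<exists>m :: int. m > 0 \<and> algebraic_int (of_int m * \<alpha>)"
    using algebraic_imp_multiple_algebraic_int[OF alg] by metis
  from someI_ex[OF this] show "den > 0" "algebraic_int (of_int den * \<alpha>)" by (auto simp: den_def)
qed

definition bas :: "nat \<Rightarrow> complex" where
  "bas i = (of_int den * \<alpha>) ^ i"

text \<open>Integer coordinates on the order generated by \<open>den * \<alpha>\<close>. Units will
  arise as quotients of its elements, and such quotients may lie outside the order.\<close>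

definition lat :: "(nat \<Rightarrow> int) \<Rightarrow> complex" where
  "lat a = (\<Sum>i<d. of_int (a i) * bas i)"

lemma bas_in: "bas i \<in> K" "algebraic_int (bas i)"
  unfolding bas_def
  by (auto intro!: pow_in_K K_closed of_int_in_K alpha_in_K algebraic_int_power den)

lemma lat_in_K: "lat a \<in> K"
  unfolding lat_def
  by (intro conjunct1[OF emb_sum[OF id_embedding]] K_closed(4) of_int_in_K bas_in(1))

lemma algebraic_int_lat: "algebraic_int (lat a)"
  unfolding lat_def by (intro algebraic_int_sum algebraic_int_mult algebraic_int_of_int bas_in)

lemma lat_in_int_ring: "lat a \<in> int_ring K"
  by (simp add: int_ring_def lat_in_K algebraic_int_lat)

lemma emb_lat:
  assumes \<phi>: "\<phi> \<in> embeddings K"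
  shows "\<phi> (lat a) = (\<Sum>i<d. of_int (a i) * \<phi> (bas i))"
proof -
  have "\<phi> (lat a) = (\<Sum>i<d. \<phi> (of_int (a i) * bas i))"
    unfolding lat_def
    by (intro conjunct2[OF emb_sum[OF \<phi>]] K_closed(4) of_int_in_K bas_in(1))
  also have "\<dots> = (\<Sum>i<d. of_int (a i) * \<phi> (bas i))"
    by (simp add: embD(3)[OF \<phi>] of_int_in_K bas_in emb_of_int[OF \<phi>])
  finally show ?thesis .
qed

lemma lat_eq_0:
  assumes "lat a = 0" "i < d"
  shows "a i = 0"
proof -
  let ?c = "\<lambda>i. of_int (a i) * of_int den ^ i :: rat"
  have "rpoly (\<Sum>i<d. monom (?c i) i) \<alpha> = lat a"
    unfolding rpoly_sum_monom[OF d_pos] lat_def bas_def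
    by (simp add: of_rat_mult of_rat_power power_mult_distrib mult_ac)
  hence "(\<Sum>i<d. monom (?c i) i) = 0"
    using assms(1) degree_ge degree_sum_monom_less[OF d_pos, of ?c] by (metis not_less)
  hence "?c i = 0" using coeff_sum_monom[OF assms(2), of ?c] by simp
  thus ?thesis using den(1) by simp
qed

text \<open>Splitting \<open>\<phi> x\<close> into \<open>Re \<plusminus> Im\<close> treats real embeddings and conjugate pairs uniformly: the two forms
  coincide for a real embedding and are swapped by conjugation.\<close>

lemma cmod_le_if_Re_Im:
  assumes "\<bar>Re z + Im z\<bar> \<le> b" "\<bar>Re z - Im z\<bar> \<le> b"
  shows "cmod z \<le> b"
proof -
  have "(Re z + Im z)\<^sup>2 \<le> b\<^sup>2" "(Re z - Im z)\<^sup>2 \<le> b\<^sup>2"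
    using assms by (simp_all add: abs_le_square_iff[symmetric])
  hence "(cmod z)\<^sup>2 \<le> b\<^sup>2" unfolding cmod_power2 by (simp add: power2_eq_square algebra_simps)
  moreover have "b \<ge> 0" using assms(1) by linarith
  ultimately show ?thesis by (rule power2_le_imp_le)
qed

text \<open>One real form \<open>Re + Im\<close> for each embedding; symmetry of \<open>w\<close>
  supplies the bound for \<open>Re - Im\<close> through the conjugate embedding. The constant
  \<open>C\<close> is chosen before \<open>w\<close>, and this uniformity makes the final distance
  bound independent of the target vector.\<close>

lemma small_lattice_elements:
  obtains C where "C \<ge> 1" "\<And>w. \<lbrakk>\<And>\<phi>. \<phi> \<in> embeddings K \<Longrightarrow> w \<phi> > 0 \<and> w (cj \<phi>) = w \<phi>;
     (\<Prod>\<phi>\<in>embeddings K. w \<phi>) = C ^ d\<rbrakk> \<Longrightarrow>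
     \<exists>a. lat a \<noteq> 0 \<and> (\<forall>\<phi>\<in>embeddings K. cmod (\<phi> (lat a)) \<le> w \<phi>)"
proof -
  define L where "L = (\<lambda>\<phi> i. Re (\<phi> (bas i)) + Im (\<phi> (bas i)))"
  define c where "c = (\<Sum>\<phi>\<in>embeddings K. \<Sum>i<d. \<bar>L \<phi> i\<bar>)"
  have c0: "c \<ge> 0" by (simp add: c_def sum_nonneg)
  have L: "\<bar>L \<phi> i\<bar> \<le> c" if "\<phi> \<in> embeddings K" "i < d" for \<phi> i
  proof -
    have "\<bar>L \<phi> i\<bar> \<le> (\<Sum>i<d. \<bar>L \<phi> i\<bar>)" using that by (intro member_le_sum) auto
    also have "\<dots> \<le> c" unfolding c_def
      using that finite_embeddings by (intro member_le_sum) (auto simp: sum_nonneg)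
    finally show ?thesis .
  qed
  show ?thesis
  proof (rule that[of "2 * real d * c + 2"])
    show "2 * real d * c + 2 \<ge> 1" using c0 by (simp add: add_increasing)
    fix w :: "(complex \<Rightarrow> complex) \<Rightarrow> real"
    assume w: "\<And>\<phi>. \<phi> \<in> embeddings K \<Longrightarrow> w \<phi> > 0 \<and> w (cj \<phi>) = w \<phi>"
      and prod: "(\<Prod>\<phi>\<in>embeddings K. w \<phi>) = (2 * real d * c + 2) ^ d"
    obtain a where a: "\<exists>i<d. a i \<noteq> 0"
        "\<And>\<phi>. \<phi> \<in> embeddings K \<Longrightarrow> \<bar>\<Sum>i<d. of_int (a i) * L \<phi> i\<bar> \<le> w \<phi>"
      by (rule pigeonhole_linear_forms[OF finite_embeddings card_embeddings c0 L _ d_pos prod]) (use w in auto)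
    have L_eq: "(\<Sum>i<d. of_int (a i) * L \<phi> i) = Re (\<phi> (lat a)) + Im (\<phi> (lat a))"
      if "\<phi> \<in> embeddings K" for \<phi>
      by (simp add: emb_lat[OF that] L_def distrib_left sum.distrib)
    show "\<exists>a. lat a \<noteq> 0 \<and> (\<forall>\<phi>\<in>embeddings K. cmod (\<phi> (lat a)) \<le> w \<phi>)"
    proof (intro exI[of _ a] conjI ballI)
      show "lat a \<noteq> 0" using a(1) lat_eq_0 by blast
      fix \<phi> assume \<phi>: "\<phi> \<in> embeddings K"
      show "cmod (\<phi> (lat a)) \<le> w \<phi>"
      proof (rule cmod_le_if_Re_Im)
        show "\<bar>Re (\<phi> (lat a)) + Im (\<phi> (lat a))\<bar> \<le> w \<phi>" using a(2)[OF \<phi>] L_eq[OF \<phi>] by simp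
        show "\<bar>Re (\<phi> (lat a)) - Im (\<phi> (lat a))\<bar> \<le> w \<phi>"
          using a(2)[OF cj_embedding[OF \<phi>]] L_eq[OF cj_embedding[OF \<phi>]] w[OF \<phi>]
          by (simp add: lat_in_K)
      qed
    qed
  qed
qed

section \<open>Norms and finiteness of associate classes\<close>

lemma norm_nrm_ge_1:
  assumes "y \<in> int_ring K" "y \<noteq> 0"
  shows "cmod (nrm y) \<ge> 1"
proof -
  have "nrm y \<noteq> 0"
    using assms embD(9) finite_embeddings by (auto simp: nrm_def int_ring_def)
  moreover obtain k where "nrm y = of_int k" using nrm_Ints[OF assms(1)] by (auto elim: Ints_cases)
  ultimately show ?thesis by simp
qed

text \<open>The quotient is the product of the conjugates at the embeddings other than the
  inclusion; these are integral even where they leave \<open>K\<close>.\<close>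

lemma nrm_div_algebraic_int:
  assumes "y \<in> int_ring K" "y \<noteq> 0"
  shows "algebraic_int (nrm y / y)"
proof -
  let ?id = "restrict (\<lambda>x. x) K"
  have y: "y \<in> K" "algebraic_int y" using assms by (auto simp: int_ring_def)
  have "nrm y = ?id y * (\<Prod>\<phi>\<in>embeddings K - {?id}. \<phi> y)"
    unfolding nrm_def by (rule prod.remove[OF finite_embeddings id_embedding])
  hence "nrm y / y = (\<Prod>\<phi>\<in>embeddings K - {?id}. \<phi> y)" using assms(2) y by simp
  also have "algebraic_int \<dots>"
    using y by (intro algebraic_int_prod) (auto intro: embedding_algebraic_int)
  finally show ?thesis .
qed

text \<open>The congruences give \<open>lat a = lat b + n * lat e\<close>, and \<open>lat b\<close>
  divides its own norm \<open>n\<close> among the algebraic integers.\<close>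

lemma associate_algebraic_int:
  assumes nz: "lat b \<noteq> 0" and n: "nrm (lat b) = of_int n" and cong: "\<And>i. i < d \<Longrightarrow> a i mod n = b i mod n"
  shows "algebraic_int (lat a / lat b)"
proof -
  define e where "e = (\<lambda>i. (a i - b i) div n)"
  have "lat a - lat b = (\<Sum>i<d. of_int (a i - b i) * bas i)"
    by (simp add: lat_def sum_subtractf algebra_simps)
  also have "\<dots> = (\<Sum>i<d. of_int n * (of_int (e i) * bas i))"
  proof (rule sum.cong)
    fix i assume "i \<in> {..<d}"
    hence "n dvd a i - b i" using cong by (simp add: mod_eq_dvd_iff)
    hence "a i - b i = n * e i" by (simp add: e_def)
    thus "of_int (a i - b i) * bas i = of_int n * (of_int (e i) * bas i)" by simp
  qed simp
  finally have "lat a = lat b + of_int n * lat e" by (simp add: lat_def sum_distrib_left algebra_simps)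
  hence eq: "lat a / lat b = 1 + nrm (lat b) / lat b * lat e" using nz n by (simp add: field_simps)
  show ?thesis
    unfolding eq
    by (intro algebraic_int_add algebraic_int_mult algebraic_int_1 algebraic_int_lat
          nrm_div_algebraic_int lat_in_int_ring nz)
qed

text \<open>Two elements with the same norm \<open>n\<close> and coordinates congruent modulo
  \<open>n\<close> divide each other, so their quotient is a unit. Since \<open>n\<close> is nonzero
  and bounded, only finitely many pairs of norm and residues occur.\<close>

lemma finite_associate_reps:
  fixes M :: real
  obtains R where "finite R" "\<And>b. b \<in> R \<Longrightarrow> lat b \<noteq> 0"
    "\<And>a. lat a \<noteq> 0 \<Longrightarrow> cmod (nrm (lat a)) \<le> M \<Longrightarrow> \<exists>b\<in>R. lat a / lat b \<in> int_units K"
proof -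
  define n where "n = (\<lambda>a. \<lfloor>Re (nrm (lat a))\<rfloor>)"
  have n: "nrm (lat a) = of_int (n a)" for a
    using nrm_Ints[OF lat_in_int_ring, of a] by (auto simp: n_def elim!: Ints_cases)
  define X where "X = {a. lat a \<noteq> 0 \<and> cmod (nrm (lat a)) \<le> M}"
  define \<kappa> where "\<kappa> = (\<lambda>a. (n a, restrict (\<lambda>i. a i mod n a) {..<d}))"
  have nX: "n a \<noteq> 0" "\<bar>n a\<bar> \<le> \<lfloor>M\<rfloor>" if "a \<in> X" for a
  proof -
    have "cmod (nrm (lat a)) \<ge> 1" using that by (intro norm_nrm_ge_1 lat_in_int_ring) (auto simp: X_def)
    thus "n a \<noteq> 0" using n[of a] by auto
    have "\<bar>real_of_int (n a)\<bar> \<le> M" using that n[of a] by (simp add: X_def)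
    thus "\<bar>n a\<bar> \<le> \<lfloor>M\<rfloor>" by (simp add: le_floor_iff)
  qed
  have "\<kappa> ` X \<subseteq> {-\<lfloor>M\<rfloor>..\<lfloor>M\<rfloor>} \<times> ({..<d} \<rightarrow>\<^sub>E {-\<lfloor>M\<rfloor>..\<lfloor>M\<rfloor>})"
  proof
    fix k assume "k \<in> \<kappa> ` X"
    then obtain a where a: "a \<in> X" "k = \<kappa> a" by blast
    have "\<bar>a i mod n a\<bar> \<le> \<lfloor>M\<rfloor>" for i
      using abs_mod_less[OF nX(1)[OF a(1)], of "a i"] nX(2)[OF a(1)] by linarith
    thus "k \<in> {-\<lfloor>M\<rfloor>..\<lfloor>M\<rfloor>} \<times> ({..<d} \<rightarrow>\<^sub>E {-\<lfloor>M\<rfloor>..\<lfloor>M\<rfloor>})"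
      using nX(2)[OF a(1)] by (auto simp: a(2) \<kappa>_def abs_le_iff minus_le_iff)
  qed
  hence "finite (\<kappa> ` X)" by (rule finite_subset) (auto intro!: finite_PiE)
  then obtain R where R: "R \<subseteq> X" "finite R" "\<kappa> ` X = \<kappa> ` R"
    using finite_subset_image[of "\<kappa> ` X" \<kappa> X] by blast
  show ?thesis
  proof (rule that[OF R(2)])
    show "lat b \<noteq> 0" if "b \<in> R" for b using that R(1) by (auto simp: X_def)
    fix a assume "lat a \<noteq> 0" "cmod (nrm (lat a)) \<le> M"
    hence a: "a \<in> X" by (simp add: X_def)
    then obtain b where b: "b \<in> R" "\<kappa> a = \<kappa> b" using R(3) by blast
    have nn: "n a = n b" using b(2) by (simp add: \<kappa>_def)
    have cong: "a i mod n a = b i mod n a" if "i < d" for i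
    proof -
      have "snd (\<kappa> a) i = snd (\<kappa> b) i" using b(2) by simp
      thus ?thesis using that nn by (simp add: \<kappa>_def)
    qed
    have nz: "lat a \<noteq> 0" "lat b \<noteq> 0" using a b(1) R(1) by (auto simp: X_def)
    have "algebraic_int (lat a / lat b)"
      using cong nn by (intro associate_algebraic_int[OF nz(2) n]) auto
    moreover have "algebraic_int (lat b / lat a)"
      using cong by (intro associate_algebraic_int[OF nz(1) n]) auto
    moreover have "lat a / lat b \<in> K" "lat b / lat a \<in> K" by (auto intro: K_closed lat_in_K)
    ultimately have "lat a / lat b \<in> int_units K"
      unfolding int_units_def using nz
      by (auto simp: int_ring_def intro!: bexI[of _ "lat b / lat a"])
    thus "\<exists>b\<in>R. lat a / lat b \<in> int_units K" using b(1) by blast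
  qed
qed

section \<open>Logarithms and the approximation by units\<close>

definition lg :: "(complex \<Rightarrow> complex) \<Rightarrow> complex \<Rightarrow> real" where
  "lg \<phi> x = ln (cmod (\<phi> x))"

lemma lg_div:
  "\<phi> \<in> embeddings K \<Longrightarrow> x \<in> K \<Longrightarrow> y \<in> K \<Longrightarrow> x \<noteq> 0 \<Longrightarrow> y \<noteq> 0 \<Longrightarrow> lg \<phi> (x / y) = lg \<phi> x - lg \<phi> y"
  using embD(9) by (simp add: lg_def embD norm_divide ln_div)

text \<open>This is the content of Dirichlet's unit theorem: the logarithmic image of the unit group is
  cocompact in the trace zero hyperplane.\<close>

lemma units_cocompact:
  obtains C where "\<And>v. \<lbrakk>\<And>\<phi>. \<phi> \<in> embeddings K \<Longrightarrow> v (cj \<phi>) = v \<phi>; (\<Sum>\<phi>\<in>embeddings K. v \<phi>) = 0\<rbrakk> \<Longrightarrow>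
     \<exists>\<epsilon>\<in>int_units K. \<forall>\<phi>\<in>embeddings K. \<bar>lg \<phi> \<epsilon> - v \<phi>\<bar> \<le> C"
proof -
  obtain C where C: "C \<ge> 1" "\<And>w. \<lbrakk>\<And>\<phi>. \<phi> \<in> embeddings K \<Longrightarrow> w \<phi> > 0 \<and> w (cj \<phi>) = w \<phi>;
     (\<Prod>\<phi>\<in>embeddings K. w \<phi>) = C ^ d\<rbrakk> \<Longrightarrow>
     \<exists>a. lat a \<noteq> 0 \<and> (\<forall>\<phi>\<in>embeddings K. cmod (\<phi> (lat a)) \<le> w \<phi>)"
    by (rule small_lattice_elements) blast
  define M where "M = C ^ d"
  have M1: "M \<ge> 1" using C(1) by (simp add: M_def)
  obtain R where R: "finite R" "\<And>b. b \<in> R \<Longrightarrow> lat b \<noteq> 0"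
    "\<And>a. lat a \<noteq> 0 \<Longrightarrow> cmod (nrm (lat a)) \<le> M \<Longrightarrow> \<exists>b\<in>R. lat a / lat b \<in> int_units K"
    by (rule finite_associate_reps[of M]) blast
  define B where "B = (\<Sum>b\<in>R. \<Sum>\<phi>\<in>embeddings K. \<bar>lg \<phi> (lat b)\<bar>)"
  have B: "\<bar>lg \<phi> (lat b)\<bar> \<le> B" if "b \<in> R" "\<phi> \<in> embeddings K" for b \<phi>
  proof -
    have "\<bar>lg \<phi> (lat b)\<bar> \<le> (\<Sum>\<phi>\<in>embeddings K. \<bar>lg \<phi> (lat b)\<bar>)"
      using that finite_embeddings by (intro member_le_sum) auto
    also have "\<dots> \<le> B" unfolding B_def
      using that R(1) by (intro member_le_sum) (auto simp: sum_nonneg)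
    finally show ?thesis .
  qed
  show ?thesis
  proof (rule that[of "ln M + ln C + B"])
    fix v assume v: "\<And>\<phi>. \<phi> \<in> embeddings K \<Longrightarrow> v (cj \<phi>) = v \<phi>" "(\<Sum>\<phi>\<in>embeddings K. v \<phi>) = (0 :: real)"
    \<comment> \<open>Since \<open>v\<close> has sum zero, these weights have the required product
      \<open>C ^ d\<close>; hence the element found has norm at most \<open>M\<close>, whatever
      \<open>v\<close> is.\<close>
    define w where "w = (\<lambda>\<phi>. C * exp (v \<phi>))"
    have w_pos: "w \<phi> > 0" for \<phi> using C(1) by (simp add: w_def)
    have prod_w: "(\<Prod>\<phi>\<in>embeddings K. w \<phi>) = M"
      using v(2) finite_embeddings
      by (simp add: w_def prod.distrib card_embeddings M_def flip: exp_sum)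
    then obtain a where a: "lat a \<noteq> 0" "\<And>\<phi>. \<phi> \<in> embeddings K \<Longrightarrow> cmod (\<phi> (lat a)) \<le> w \<phi>"
      using C(2)[of w] w_pos v(1) by (auto simp: M_def w_def)
    have nrm_prod: "cmod (nrm (lat a)) = (\<Prod>\<phi>\<in>embeddings K. cmod (\<phi> (lat a)))"
      by (simp add: nrm_def prod_norm)
    have "cmod (nrm (lat a)) \<le> M"
      unfolding nrm_prod prod_w[symmetric] using a(2) by (intro prod_mono) auto
    then obtain b where b: "b \<in> R" "lat a / lat b \<in> int_units K" using R(3) a(1) by blast
    show "\<exists>\<epsilon>\<in>int_units K. \<forall>\<phi>\<in>embeddings K. \<bar>lg \<phi> \<epsilon> - v \<phi>\<bar> \<le> ln M + ln C + B"
    proof (intro bexI[OF _ b(2)] ballI)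
      fix \<phi> assume \<phi>: "\<phi> \<in> embeddings K"
      have pos: "cmod (\<phi> (lat a)) > 0" using embD(9)[OF \<phi> lat_in_K a(1)] by simp
      have ln_w: "ln (w \<phi>) = ln C + v \<phi>" using C(1) by (simp add: w_def ln_mult)
      have upper: "lg \<phi> (lat a) \<le> ln (w \<phi>)"
        unfolding lg_def using a(2)[OF \<phi>] pos by (simp add: w_pos)
      \<comment> \<open>Upper bounds at all embeddings imply a lower bound at each: the norm is at
        least 1 and the other conjugates stay below their weights, so \<open>\<phi> (lat a)\<close>
        loses at most the factor \<open>M\<close> against \<open>w \<phi>\<close>.\<close>
      have "w \<phi> * 1 \<le> w \<phi> * (\<Prod>\<phi>\<in>embeddings K. cmod (\<phi> (lat a)))"
        using norm_nrm_ge_1[OF lat_in_int_ring a(1)] w_pos[of \<phi>] nrm_prod by (intro mult_left_mono) auto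
      also have "\<dots> = w \<phi> * (cmod (\<phi> (lat a)) * (\<Prod>\<psi>\<in>embeddings K - {\<phi>}. cmod (\<psi> (lat a))))"
        by (subst prod.remove[OF finite_embeddings \<phi>]) simp
      also have "\<dots> \<le> w \<phi> * (cmod (\<phi> (lat a)) * (\<Prod>\<psi>\<in>embeddings K - {\<phi>}. w \<psi>))"
        using w_pos[of \<phi>] a(2) by (intro mult_left_mono prod_mono) auto
      also have "\<dots> = cmod (\<phi> (lat a)) * (w \<phi> * (\<Prod>\<psi>\<in>embeddings K - {\<phi>}. w \<psi>))"
        by (simp add: mult_ac)
      also have "w \<phi> * (\<Prod>\<psi>\<in>embeddings K - {\<phi>}. w \<psi>) = M"
        unfolding prod_w[symmetric] by (rule prod.remove[OF finite_embeddings \<phi>, symmetric])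
      finally have "ln (w \<phi>) \<le> ln (cmod (\<phi> (lat a)) * M)"
        using w_pos[of \<phi>] pos M1 by simp
      hence lower: "ln (w \<phi>) - ln M \<le> lg \<phi> (lat a)"
        using pos M1 by (simp add: lg_def ln_mult)
      have "lg \<phi> (lat a / lat b) = lg \<phi> (lat a) - lg \<phi> (lat b)"
        by (intro lg_div \<phi> lat_in_K a(1) R(2)[OF b(1)])
      moreover have "ln M \<ge> 0" "ln C \<ge> 0" using M1 C(1) by auto
      ultimately show "\<bar>lg \<phi> (lat a / lat b) - v \<phi>\<bar> \<le> ln M + ln C + B"
        using upper lower ln_w B[OF b(1) \<phi>] by linarith
    qed
  qed
qed

end

section \<open>The structure of the unit group\<close>

definition monomial :: "complex set \<Rightarrow> (complex \<Rightarrow> int) \<Rightarrow> complex" where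
  "monomial B k = (\<Prod>b\<in>B. b powi k b)"

lemma mult_independentD: "mult_independent B \<Longrightarrow> monomial B k = 1 \<Longrightarrow> b \<in> B \<Longrightarrow> k b = 0"
  unfolding mult_independent_def monomial_def by blast

lemma monomial_cong: "(\<And>b. b \<in> B \<Longrightarrow> k b = l b) \<Longrightarrow> monomial B k = monomial B l"
  unfolding monomial_def by (intro prod.cong) auto

lemma monomial_add:
  "0 \<notin> B \<Longrightarrow> monomial B (\<lambda>b. k b + l b) = monomial B k * monomial B l"
  unfolding monomial_def prod.distrib[symmetric]
  by (intro prod.cong) (auto intro!: power_int_add)

lemma monomial_minus:
  "monomial B (\<lambda>b. - k b) = inverse (monomial B k)"
  unfolding monomial_def power_int_minus by (simp add: prod_inversef[symmetric] o_def)

lemma monomial_diff: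
  "0 \<notin> B \<Longrightarrow> monomial B (\<lambda>b. k b - l b) = monomial B k / monomial B l"
  using monomial_add[of B k "\<lambda>b. - l b"] by (simp add: monomial_minus field_simps)

lemma monomial_scale:
  "monomial B (\<lambda>b. int m * k b) = monomial B k ^ m"
proof -
  have "b powi (int m * k b) = (b powi k b) ^ m" for b :: complex
    by (simp add: mult.commute[of "int m"] power_int_mult)
  thus ?thesis unfolding monomial_def by (simp add: prod_power_distrib)
qed

lemma monomial_nonzero: "0 \<notin> B \<Longrightarrow> monomial B k \<noteq> 0"
  unfolding monomial_def by (cases "finite B") auto

lemma inj_on_monomial:
  assumes "mult_independent B" "0 \<notin> B" "monomial B k = monomial B l" "b \<in> B"
  shows "k b = l b"
proof -
  have "monomial B (\<lambda>b. k b - l b) = 1"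
    using assms monomial_nonzero by (simp add: monomial_diff)
  from mult_independentD[OF assms(1) this assms(4)] show ?thesis by simp
qed

context number_field
begin

lemma units:
  shows unit_in_K: "x \<in> int_units K \<Longrightarrow> x \<in> K"
    and unit_nz: "x \<in> int_units K \<Longrightarrow> x \<noteq> 0"
    and unit_int_ring: "x \<in> int_units K \<Longrightarrow> x \<in> int_ring K"
    and unit_1: "1 \<in> int_units K"
    and unit_inverse: "x \<in> int_units K \<Longrightarrow> inverse x \<in> int_units K"
    and unit_mult: "x \<in> int_units K \<Longrightarrow> y \<in> int_units K \<Longrightarrow> x * y \<in> int_units K"
proof -
  show a: "x \<in> int_units K \<Longrightarrow> x \<in> K" and b: "x \<in> int_units K \<Longrightarrow> x \<noteq> 0"
    and c: "x \<in> int_units K \<Longrightarrow> x \<in> int_ring K" for x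
    by (auto simp: int_units_def int_ring_def)
  have iff: "x \<in> int_units K \<longleftrightarrow> x \<noteq> 0 \<and> x \<in> int_ring K \<and> inverse x \<in> int_ring K" for x
  proof
    assume x: "x \<in> int_units K"
    then obtain y where y: "y \<in> int_ring K" "x * y = 1" by (auto simp: int_units_def)
    hence "y = inverse x" by (metis inverse_unique)
    thus "x \<noteq> 0 \<and> x \<in> int_ring K \<and> inverse x \<in> int_ring K" using x y b c by auto
  next
    assume "x \<noteq> 0 \<and> x \<in> int_ring K \<and> inverse x \<in> int_ring K"
    thus "x \<in> int_units K" by (auto simp: int_units_def intro!: bexI[of _ "inverse x"])
  qed
  show "1 \<in> int_units K" by (auto simp: iff int_ring_def K_closed algebraic_int_1)
  show "x \<in> int_units K \<Longrightarrow> inverse x \<in> int_units K" by (auto simp: iff)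
  show "x \<in> int_units K \<Longrightarrow> y \<in> int_units K \<Longrightarrow> x * y \<in> int_units K"
    by (auto simp: iff int_ring_def K_closed)
qed

lemma zero_notin_units: "B \<subseteq> int_units K \<Longrightarrow> 0 \<notin> B"
  using unit_nz by blast

lemma unit_div: "x \<in> int_units K \<Longrightarrow> y \<in> int_units K \<Longrightarrow> x / y \<in> int_units K"
  unfolding divide_inverse by (intro unit_mult unit_inverse)

lemma unit_power: "x \<in> int_units K \<Longrightarrow> x ^ n \<in> int_units K"
  by (induction n) (auto intro: unit_1 unit_mult)

lemma unit_powi: "x \<in> int_units K \<Longrightarrow> x powi n \<in> int_units K"
  by (auto simp: power_int_def intro: unit_power unit_inverse)

lemma unit_monomial: "B \<subseteq> int_units K \<Longrightarrow> monomial B k \<in> int_units K"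
  unfolding monomial_def
  by (induction B rule: infinite_finite_induct) (auto intro: unit_1 unit_mult unit_powi)

lemma lg_mult:
  "\<phi> \<in> embeddings K \<Longrightarrow> x \<in> K \<Longrightarrow> y \<in> K \<Longrightarrow> x \<noteq> 0 \<Longrightarrow> y \<noteq> 0 \<Longrightarrow> lg \<phi> (x * y) = lg \<phi> x + lg \<phi> y"
  using embD(9) by (simp add: lg_def embD norm_mult ln_mult)

lemma lg_1: "\<phi> \<in> embeddings K \<Longrightarrow> lg \<phi> 1 = 0"
  by (simp add: lg_def embD)

lemma lg_inverse: "\<phi> \<in> embeddings K \<Longrightarrow> x \<in> K \<Longrightarrow> x \<noteq> 0 \<Longrightarrow> lg \<phi> (inverse x) = - lg \<phi> x"
  using lg_div[of \<phi> 1 x] by (simp add: K_closed lg_1 field_simps)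

lemma lg_power: "\<phi> \<in> embeddings K \<Longrightarrow> x \<in> K \<Longrightarrow> x \<noteq> 0 \<Longrightarrow> lg \<phi> (x ^ n) = real n * lg \<phi> x"
  using embD(9) by (simp add: lg_def embD norm_power ln_realpow)

lemma lg_powi:
  assumes "\<phi> \<in> embeddings K" "x \<in> K" "x \<noteq> 0"
  shows "lg \<phi> (x powi k) = of_int k * lg \<phi> x"
  using assms by (auto simp: power_int_def lg_power lg_inverse K_closed pow_in_K)

lemma lg_monomial:
  assumes \<phi>: "\<phi> \<in> embeddings K" and B: "B \<subseteq> int_units K"
  shows "lg \<phi> (monomial B k) = (\<Sum>b\<in>B. of_int (k b) * lg \<phi> b)"
  using B
proof (induction B rule: infinite_finite_induct)
  case (insert b B)
  have "monomial (insert b B) k = b powi k b * monomial B k"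
    using insert.hyps by (simp add: monomial_def)
  moreover have "b powi k b \<in> int_units K" "monomial B k \<in> int_units K"
    using insert.prems by (auto intro: unit_powi unit_monomial)
  ultimately have "lg \<phi> (monomial (insert b B) k) = lg \<phi> (b powi k b) + lg \<phi> (monomial B k)"
    using lg_mult[OF \<phi>] unit_in_K unit_nz by metis
  also have "lg \<phi> (b powi k b) = of_int (k b) * lg \<phi> b"
    using insert.prems by (intro lg_powi \<phi> unit_in_K unit_nz) auto
  finally show ?case using insert by simp
qed (auto simp: monomial_def lg_1[OF \<phi>])

lemma cmod_le_exp_iff_lg:
  assumes "\<phi> \<in> embeddings K" "x \<in> K" "x \<noteq> 0"
  shows "cmod (\<phi> x) \<le> exp T \<longleftrightarrow> lg \<phi> x \<le> T"
proof -
  have "cmod (\<phi> x) > 0" using embD(9)[OF assms] by simp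
  thus ?thesis unfolding lg_def by (metis exp_gt_zero ln_exp ln_le_cancel_iff)
qed

lemma finite_units_bounded: "finite {\<epsilon> \<in> int_units K. \<forall>\<phi>\<in>embeddings K. lg \<phi> \<epsilon> \<le> T}"
proof (rule finite_subset[OF _ finite_int_ring_bounded])
  show "{\<epsilon> \<in> int_units K. \<forall>\<phi>\<in>embeddings K. lg \<phi> \<epsilon> \<le> T} \<subseteq>
      {y \<in> int_ring K. \<forall>\<phi>\<in>embeddings K. cmod (\<phi> y) \<le> exp T}"
    using cmod_le_exp_iff_lg unit_in_K unit_nz unit_int_ring by blast
qed

text \<open>A sum rather than a maximum: it bounds combinations with coefficients of size at most 1
  as well as single logarithms, and is defined for the empty set.\<close>

definition log_size :: "complex set \<Rightarrow> real" where
  "log_size B = (\<Sum>\<phi>\<in>embeddings K. \<Sum>b\<in>B. \<bar>lg \<phi> b\<bar>)"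

lemma log_size_nonneg: "log_size B \<ge> 0"
  unfolding log_size_def by (intro sum_nonneg) auto

lemma abs_lg_le_log_size:
  assumes "finite B" "b \<in> B" "\<phi> \<in> embeddings K"
  shows "\<bar>lg \<phi> b\<bar> \<le> log_size B"
proof -
  have "\<bar>lg \<phi> b\<bar> \<le> (\<Sum>b\<in>B. \<bar>lg \<phi> b\<bar>)" using assms by (intro member_le_sum) auto
  also have "\<dots> \<le> log_size B" unfolding log_size_def
    using assms finite_embeddings by (intro member_le_sum) (auto intro: sum_nonneg)
  finally show ?thesis .
qed

lemma abs_lg_comb_le:
  assumes \<phi>: "\<phi> \<in> embeddings K" and k: "\<And>b. b \<in> B \<Longrightarrow> \<bar>k b\<bar> \<le> c" and c: "c \<ge> 0"
  shows "\<bar>\<Sum>b\<in>B. k b * lg \<phi> b\<bar> \<le> c * log_size B"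
proof -
  have "\<bar>\<Sum>b\<in>B. k b * lg \<phi> b\<bar> \<le> (\<Sum>b\<in>B. \<bar>k b * lg \<phi> b\<bar>)" by (rule sum_abs)
  also have "\<dots> \<le> (\<Sum>b\<in>B. c * \<bar>lg \<phi> b\<bar>)"
    unfolding abs_mult using k by (intro sum_mono mult_right_mono) auto
  also have "\<dots> = c * (\<Sum>b\<in>B. \<bar>lg \<phi> b\<bar>)" by (simp add: sum_distrib_left)
  also have "\<dots> \<le> c * log_size B" unfolding log_size_def
    using c \<phi> finite_embeddings by (intro mult_left_mono member_le_sum) (auto intro: sum_nonneg)
  finally show ?thesis .
qed

lemma abs_lg_monomial_le:
  assumes "\<phi> \<in> embeddings K" "B \<subseteq> int_units K" "\<And>b. b \<in> B \<Longrightarrow> \<bar>real_of_int (k b)\<bar> \<le> c" "c \<ge> 0"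
  shows "\<bar>lg \<phi> (monomial B k)\<bar> \<le> c * log_size B"
  unfolding lg_monomial[OF assms(1,2)] using assms by (intro abs_lg_comb_le) auto

text \<open>The \<open>(A + 1) ^ card B\<close> monomials with exponents up to \<open>A\<close> have logarithms in a box of side
  \<open>O(A)\<close> in dimension \<open>d\<close>, and each unit cube contains boundedly many units.\<close>

lemma card_independent_le:
  assumes B: "finite B" "B \<subseteq> int_units K" and indep: "mult_independent B"
  shows "card B \<le> d"
proof (rule ccontr)
  assume "\<not> card B \<le> d"
  define c where "c = log_size B"
  have c0: "c \<ge> 0" by (simp add: c_def log_size_nonneg)
  define U1 where "U1 = {\<epsilon> \<in> int_units K. \<forall>\<phi>\<in>embeddings K. lg \<phi> \<epsilon> \<le> 1}"
  \<comment> \<open>There will be at most \<open>(2 * c + 2) ^ d * (A + 1) ^ d\<close> cubes with at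
    most \<open>card U1\<close> monomials each. If \<open>B\<close> had more than \<open>d\<close>
    elements, this would force \<open>A + 1 \<le> G\<close>, so any \<open>A \<ge> G\<close> gives
    the contradiction.\<close>
  define G where "G = real (card U1) * (2 * c + 2) ^ d"
  obtain A :: nat where A: "real A \<ge> G" "A \<ge> 1"
  proof -
    obtain A0 :: nat where "G \<le> real A0" using real_arch_simple by blast
    thus ?thesis using that[of "max A0 1"] by simp
  qed
  define S where "S = B \<rightarrow>\<^sub>E {0..int A}"
  define h where "h = (\<lambda>k. \<lambda>\<phi>\<in>embeddings K. \<lfloor>lg \<phi> (monomial B k)\<rfloor>)"
  define T where "T = embeddings K \<rightarrow>\<^sub>E {\<lfloor>- (c * A)\<rfloor>..\<lfloor>c * A\<rfloor>}"
  have finT: "finite T" unfolding T_def using finite_embeddings by (intro finite_PiE) auto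
  have hT: "h k \<in> T" if k: "k \<in> S" for k
    unfolding T_def
  proof (rule PiE_I)
    fix \<phi> assume \<phi>: "\<phi> \<in> embeddings K"
    have "\<bar>lg \<phi> (monomial B k)\<bar> \<le> real A * c"
      unfolding c_def
    proof (rule abs_lg_monomial_le[OF \<phi> B(2)])
      fix b assume "b \<in> B"
      hence "k b \<in> {0..int A}" using PiE_mem[OF k[unfolded S_def]] by blast
      thus "\<bar>real_of_int (k b)\<bar> \<le> real A" by auto
    qed auto
    hence "- (c * A) \<le> lg \<phi> (monomial B k)" "lg \<phi> (monomial B k) \<le> c * A"
      by (auto simp: abs_le_iff mult.commute)
    thus "h k \<phi> \<in> {\<lfloor>- (c * A)\<rfloor>..\<lfloor>c * A\<rfloor>}" using \<phi> by (auto simp: h_def intro!: floor_mono)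
  qed (auto simp: h_def)
  \<comment> \<open>Dividing by one monomial of the cube moves all the others into
    \<open>U1\<close>, since equal floors mean logarithms differing by less than 1.\<close>
  have fiber: "card {k \<in> S. h k = t} \<le> card U1" for t
  proof (cases "{k \<in> S. h k = t} = {}")
    case False
    then obtain k0 where k0: "k0 \<in> S" "h k0 = t" by blast
    show ?thesis
    proof (rule card_inj_on_le)
      show "finite U1" unfolding U1_def by (rule finite_units_bounded)
      show "inj_on (\<lambda>k. monomial B k / monomial B k0) {k \<in> S. h k = t}"
      proof (rule inj_onI)
        fix k l assume kl: "k \<in> {k \<in> S. h k = t}" "l \<in> {k \<in> S. h k = t}"
          "monomial B k / monomial B k0 = monomial B l / monomial B k0"
        hence "monomial B k = monomial B l"
          using monomial_nonzero[OF zero_notin_units[OF B(2)]] by simp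
        hence "k b = l b" if "b \<in> B" for b
          using inj_on_monomial[OF indep zero_notin_units[OF B(2)]] that by blast
        thus "k = l" using kl(1,2) by (auto simp: S_def intro: PiE_ext)
      qed
      show "(\<lambda>k. monomial B k / monomial B k0) ` {k \<in> S. h k = t} \<subseteq> U1"
      proof safe
        fix k assume k: "k \<in> S" "t = h k"
        show "monomial B k / monomial B k0 \<in> U1"
          unfolding U1_def
        proof safe
          show "monomial B k / monomial B k0 \<in> int_units K" by (intro unit_div unit_monomial B)
          fix \<phi> assume \<phi>: "\<phi> \<in> embeddings K"
          have "lg \<phi> (monomial B k / monomial B k0) = lg \<phi> (monomial B k) - lg \<phi> (monomial B k0)"
            by (intro lg_div \<phi> unit_in_K unit_nz unit_monomial B)
          moreover have "\<lfloor>lg \<phi> (monomial B k)\<rfloor> = \<lfloor>lg \<phi> (monomial B k0)\<rfloor>"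
          proof -
            have "h k \<phi> = h k0 \<phi>" using k0(2) k(2) by simp
            thus ?thesis using \<phi> by (simp add: h_def)
          qed
          ultimately show "lg \<phi> (monomial B k / monomial B k0) \<le> 1" by linarith
        qed
      qed
    qed
  next
    case True
    show ?thesis unfolding True by simp
  qed
  have "S = (\<Union>t\<in>T. {k \<in> S. h k = t})" using hT by blast
  hence "card S \<le> (\<Sum>t\<in>T. card {k \<in> S. h k = t})"
    using card_UN_le[OF finT, of "\<lambda>t. {k \<in> S. h k = t}"] by simp
  also have "\<dots> \<le> (\<Sum>t\<in>T. card U1)" by (intro sum_mono fiber)
  finally have "real (card S) \<le> real (card T) * real (card U1)" by (simp flip: of_nat_mult)
  also have "real (card T) \<le> (2 * c + 2) ^ d * (real A + 1) ^ d"
  proof -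
    have "\<lfloor>- (c * A)\<rfloor> \<le> \<lfloor>c * A\<rfloor>" using c0 by (intro floor_mono) simp
    hence "real (card {\<lfloor>- (c * A)\<rfloor>..\<lfloor>c * A\<rfloor>}) = \<lfloor>c * A\<rfloor> - \<lfloor>- (c * A)\<rfloor> + 1" by simp
    also have "\<dots> \<le> 2 * (c * A) + 2"
      using of_int_floor_le[of "c * A"] floor_correct[of "- (c * A)"] by linarith
    also have "\<dots> \<le> (2 * c + 2) * (real A + 1)" using c0 by (simp add: algebra_simps)
    finally have "real (card {\<lfloor>- (c * A)\<rfloor>..\<lfloor>c * A\<rfloor>}) ^ d \<le> ((2 * c + 2) * (real A + 1)) ^ d"
      by (intro power_mono) auto
    thus ?thesis
      unfolding T_def by (simp add: card_PiE finite_embeddings card_embeddings power_mult_distrib)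
  qed
  finally have "real (card S) \<le> G * (real A + 1) ^ d"
    by (simp add: G_def mult_ac mult_left_mono mult_right_mono)
  moreover have "real (card S) = (real A + 1) ^ card B"
    unfolding S_def using B(1) by (simp add: card_PiE nat_add_distrib add.commute)
  moreover have "(real A + 1) * (real A + 1) ^ d \<le> (real A + 1) ^ card B"
    using \<open>\<not> card B \<le> d\<close> power_increasing[of "Suc d" "card B" "real A + 1"] by simp
  ultimately have "(real A + 1) * (real A + 1) ^ d \<le> G * (real A + 1) ^ d" by linarith
  hence "real A + 1 \<le> G" by (rule mult_right_le_imp_le) simp
  thus False using A(1) by simp
qed

text \<open>\<open>GREATEST\<close> is meaningful only for a bounded nonempty predicate: the empty
  set is independent and \<open>card_independent_le\<close> supplies the bound
  \<open>d\<close>.\<close>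

lemma max_independent:
  obtains B where "finite B" "B \<subseteq> int_units K" "mult_independent B" "card B = mult_rank (int_units K)"
    "\<And>B'. finite B' \<Longrightarrow> B' \<subseteq> int_units K \<Longrightarrow> mult_independent B' \<Longrightarrow> card B' \<le> mult_rank (int_units K)"
proof -
  define P where "P = (\<lambda>n. \<exists>B \<subseteq> int_units K. finite B \<and> card B = n \<and> mult_independent B)"
  have 0: "P 0" unfolding P_def by (intro exI[of _ "{}"]) (auto simp: mult_independent_def)
  have le: "n \<le> d" if "P n" for n using that card_independent_le by (auto simp: P_def)
  have rank: "mult_rank (int_units K) = (GREATEST n. P n)" by (simp add: mult_rank_def P_def)
  have "P (GREATEST n. P n)" by (rule GreatestI_nat[of P 0 d]) (use 0 le in auto)
  then obtain B where B: "B \<subseteq> int_units K" "finite B" "card B = mult_rank (int_units K)" "mult_independent B"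
    unfolding rank P_def by auto
  show ?thesis
  proof (rule that[OF B(2,1,4,3)])
    fix B' assume "finite B'" "B' \<subseteq> int_units K" "mult_independent B'"
    hence "P (card B')" unfolding P_def by blast
    thus "card B' \<le> mult_rank (int_units K)"
      unfolding rank by (rule Greatest_le_nat[of P _ d]) (use le in auto)
  qed
qed

end

text \<open>\<open>B\<close> is maximal independent, not necessarily a system of fundamental units.
  The cosets of the subgroup it generates, including torsion, are taken up by
  \<open>reps\<close>.\<close>

locale unit_basis = number_field +
  fixes B :: "complex set"
  assumes finite_B: "finite B" and B_units: "B \<subseteq> int_units K" and B_indep: "mult_independent B"
    and card_B: "card B = mult_rank (int_units K)"
    and B_max: "\<And>B'. finite B' \<Longrightarrow> B' \<subseteq> int_units K \<Longrightarrow> mult_independent B' \<Longrightarrow> card B' \<le> card B"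
begin

lemma B_nz: "0 \<notin> B"
  by (rule zero_notin_units[OF B_units])

lemma monomial_nz: "monomial B k \<noteq> 0"
  by (rule monomial_nonzero[OF B_nz])

lemma monomial_unit: "monomial B k \<in> int_units K"
  by (rule unit_monomial[OF B_units])

text \<open>Adjoining \<epsilon> creates a relation by maximality, and independence of
  \<open>B\<close> forces its exponent at \<epsilon> to be nonzero. Only the sign of that exponent
  remains to be normalised.\<close>

lemma power_in_subgroup:
  assumes \<epsilon>: "\<epsilon> \<in> int_units K"
  obtains m k where "m > 0" "\<epsilon> ^ m = monomial B k"
proof (cases "\<epsilon> \<in> B")
  case True
  have "monomial B (\<lambda>b. if b = \<epsilon> then 1 else 0) = (\<Prod>b\<in>B. if b = \<epsilon> then b else 1)"
    unfolding monomial_def by (intro prod.cong) auto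
  also have "\<dots> = \<epsilon>" using True finite_B by simp
  finally show ?thesis using that[of 1 "\<lambda>b. if b = \<epsilon> then 1 else 0"] by simp
next
  case False
  have "card (insert \<epsilon> B) = Suc (card B)" using False finite_B by simp
  hence "\<not> mult_independent (insert \<epsilon> B)"
    using B_max[of "insert \<epsilon> B"] finite_B B_units \<epsilon> by auto
  then obtain k b where k: "monomial (insert \<epsilon> B) k = 1" and b: "b \<in> insert \<epsilon> B" "k b \<noteq> 0"
    unfolding mult_independent_def monomial_def by blast
  have eq: "\<epsilon> powi k \<epsilon> * monomial B k = 1"
    using k False finite_B by (simp add: monomial_def)
  have nz: "k \<epsilon> \<noteq> 0"
  proof
    assume 0: "k \<epsilon> = 0"
    hence "monomial B k = 1" using eq by simp
    hence "k b = 0" if "b \<in> B" using mult_independentD[OF B_indep] that by blast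
    thus False using b 0 by auto
  qed
  show ?thesis
  proof (cases "k \<epsilon> > 0")
    case True
    hence "\<epsilon> ^ nat (k \<epsilon>) * monomial B k = 1" using eq by (simp add: power_int_def)
    hence "\<epsilon> ^ nat (k \<epsilon>) = monomial B (\<lambda>b. - k b)"
      by (simp add: monomial_minus inverse_unique[symmetric] mult.commute)
    thus ?thesis using that[of "nat (k \<epsilon>)"] True by simp
  next
    case False
    hence neg: "k \<epsilon> < 0" using nz by simp
    hence "inverse (\<epsilon> ^ nat (- k \<epsilon>)) * monomial B k = 1"
      using eq by (simp add: power_int_def power_inverse)
    hence "\<epsilon> ^ nat (- k \<epsilon>) = monomial B k" using unit_nz[OF \<epsilon>] by (simp add: field_simps)
    thus ?thesis using that[of "nat (- k \<epsilon>)"] neg by simp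
  qed
qed

text \<open>A finite set meeting every coset of the subgroup generated by \<open>B\<close>, possibly
  several times. The bound is the one that survives when an \<open>m\<close>-th root is taken of a
  monomial with exponents in \<open>[0, m)\<close>.\<close>

definition reps :: "complex set" where
  "reps = {\<epsilon> \<in> int_units K. \<forall>\<phi>\<in>embeddings K. lg \<phi> \<epsilon> \<le> log_size B}"

lemma finite_reps: "finite reps"
  unfolding reps_def by (rule finite_units_bounded)

lemma reps_units: "\<delta> \<in> reps \<Longrightarrow> \<delta> \<in> int_units K"
  by (simp add: reps_def)

text \<open>If \<open>\<epsilon> ^ m\<close> is a monomial, then reducing its exponents modulo \<open>m\<close> modifies \<open>\<epsilon>\<close> to a unit whose
  logarithms are bounded independently of \<open>m\<close>.\<close>

lemma coset_decomposition:
  assumes \<epsilon>: "\<epsilon> \<in> int_units K"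
  obtains \<delta> k where "\<delta> \<in> reps" "\<epsilon> = \<delta> * monomial B k"
proof -
  obtain m k where m: "m > 0" "\<epsilon> ^ m = monomial B k" using power_in_subgroup[OF \<epsilon>] .
  define q where "q = (\<lambda>b. k b div int m)"
  define \<delta> where "\<delta> = \<epsilon> / monomial B q"
  have \<delta>U: "\<delta> \<in> int_units K" unfolding \<delta>_def by (intro unit_div \<epsilon> monomial_unit)
  have "\<delta> ^ m = monomial B k / monomial B (\<lambda>b. int m * q b)"
    by (simp add: \<delta>_def power_divide m(2) monomial_scale)
  also have "\<dots> = monomial B (\<lambda>b. k b mod int m)"
    unfolding monomial_diff[OF B_nz, symmetric]
    by (intro monomial_cong) (simp add: q_def minus_mult_div_eq_mod)
  finally have \<delta>m: "\<delta> ^ m = monomial B (\<lambda>b. k b mod int m)" .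
  have "\<delta> \<in> reps"
    unfolding reps_def
  proof safe
    show "\<delta> \<in> int_units K" by (rule \<delta>U)
    fix \<phi> assume \<phi>: "\<phi> \<in> embeddings K"
    have "real m * lg \<phi> \<delta> = lg \<phi> (\<delta> ^ m)"
      using lg_power[OF \<phi> unit_in_K unit_nz] \<delta>U by simp
    also have "\<dots> \<le> \<bar>lg \<phi> (monomial B (\<lambda>b. k b mod int m))\<bar>" by (simp add: \<delta>m)
    also have "\<dots> \<le> real m * log_size B"
    proof (rule abs_lg_monomial_le[OF \<phi> B_units])
      fix b
      have "0 \<le> k b mod int m" "k b mod int m \<le> int m" using m(1) by (auto intro: less_imp_le)
      thus "\<bar>real_of_int (k b mod int m)\<bar> \<le> real m" by linarith
    qed simp
    finally show "lg \<phi> \<delta> \<le> log_size B" using m(1) by simp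
  qed
  moreover have "\<epsilon> = \<delta> * monomial B q" using monomial_nz by (simp add: \<delta>_def)
  ultimately show ?thesis by (rule that)
qed

end

section \<open>Counting units near a given direction\<close>

context unit_basis
begin

text \<open>Generation of \<open>K\<close> recast as one inequality for each pair of distinct
  embeddings, so that the exceptions can be counted pair by pair.\<close>

definition separating :: "complex \<Rightarrow> bool" where
  "separating x \<longleftrightarrow> inj_on (\<lambda>\<phi>. \<phi> x) (embeddings K)"

text \<open>A coincidence of images at one exponent persists at its multiples. So \<open>m\<close>
  is the product of one coincidence exponent for each pair of embeddings and each \<open>b\<close>,
  with the default 1 where none exists.\<close>

lemma common_exponent:
  obtains m :: nat where "m > 0"
    "\<And>\<phi> \<psi>. \<phi> \<in> embeddings K \<Longrightarrow> \<psi> \<in> embeddings K \<Longrightarrow>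
       (\<forall>b\<in>B. \<phi> (b ^ m) = \<psi> (b ^ m)) \<or> (\<exists>b\<in>B. \<forall>j>0. \<phi> (b ^ j) \<noteq> \<psi> (b ^ j))"
proof -
  define Q where "Q = (\<lambda>p (b :: complex) j. j > 0 \<and> fst p (b ^ j) = (snd p (b ^ j) :: complex))"
  define g where "g = (\<lambda>p b. if \<exists>j :: nat. Q p b j then SOME j. Q p b j else 1)"
  have gQ: "Q p b (g p b)" if "\<exists>j. Q p b j" for p b
    using that someI_ex[OF that] by (simp add: g_def)
  have g_pos: "g p b > 0" for p b
    using gQ[of p b] by (cases "\<exists>j. Q p b j") (auto simp: Q_def g_def)
  define m where "m = (\<Prod>p\<in>embeddings K \<times> embeddings K. \<Prod>b\<in>B. g p b)"
  show ?thesis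
  proof (rule that[of m])
    show "m > 0" unfolding m_def by (intro prod_pos) (auto simp: g_pos)
    fix \<phi> \<psi> assume \<phi>: "\<phi> \<in> embeddings K" and \<psi>: "\<psi> \<in> embeddings K"
    show "(\<forall>b\<in>B. \<phi> (b ^ m) = \<psi> (b ^ m)) \<or> (\<exists>b\<in>B. \<forall>j>0. \<phi> (b ^ j) \<noteq> \<psi> (b ^ j))"
    proof (cases "\<exists>b\<in>B. \<forall>j>0. \<phi> (b ^ j) \<noteq> \<psi> (b ^ j)")
      case False
      have "\<phi> (b ^ m) = \<psi> (b ^ m)" if b: "b \<in> B" for b
      proof -
        have "\<exists>j. Q (\<phi>,\<psi>) b j" using False b by (auto simp: Q_def)
        hence "Q (\<phi>,\<psi>) b (g (\<phi>,\<psi>) b)" by (rule gQ)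
        hence eq: "\<phi> (b ^ g (\<phi>,\<psi>) b) = \<psi> (b ^ g (\<phi>,\<psi>) b)" by (simp add: Q_def)
        have "g (\<phi>,\<psi>) b dvd (\<Prod>b\<in>B. g (\<phi>,\<psi>) b)" using finite_B b by (rule dvd_prodI)
        also have "\<dots> dvd m" unfolding m_def
          by (rule dvd_prodI[where f = "\<lambda>p. \<Prod>b\<in>B. g p b"]) (auto simp: finite_embeddings \<phi> \<psi>)
        finally obtain t where t: "m = g (\<phi>,\<psi>) b * t" by (elim dvdE)
        have "b ^ g (\<phi>,\<psi>) b \<in> K" using b B_units by (intro unit_in_K unit_power) auto
        thus ?thesis unfolding t power_mult using eq embD(11)[OF \<phi>] embD(11)[OF \<psi>] by simp
      qed
      thus ?thesis by blast
    qed blast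
  qed
qed

text \<open>Cocompactness survives the restriction to exponents divisible by \<open>m\<close>: the
  coset representative and the remainders modulo \<open>m\<close> shift the logarithms by a bounded
  amount.\<close>

lemma multiples_cocompact:
  assumes m: "m > 0"
  obtains C where "\<And>v. \<lbrakk>\<And>\<phi>. \<phi> \<in> embeddings K \<Longrightarrow> v (cj \<phi>) = v \<phi>; (\<Sum>\<phi>\<in>embeddings K. v \<phi>) = 0\<rbrakk> \<Longrightarrow>
     \<exists>q. \<forall>\<phi>\<in>embeddings K. \<bar>lg \<phi> (monomial B (\<lambda>b. int m * q b)) - v \<phi>\<bar> \<le> C"
proof -
  obtain C0 where C0: "\<And>v. \<lbrakk>\<And>\<phi>. \<phi> \<in> embeddings K \<Longrightarrow> v (cj \<phi>) = v \<phi>; (\<Sum>\<phi>\<in>embeddings K. v \<phi>) = 0\<rbrakk> \<Longrightarrow>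
     \<exists>\<epsilon>\<in>int_units K. \<forall>\<phi>\<in>embeddings K. \<bar>lg \<phi> \<epsilon> - v \<phi>\<bar> \<le> C0"
    by (rule units_cocompact) blast
  show ?thesis
  proof (rule that[of "C0 + log_size reps + real m * log_size B"])
    fix v assume v: "\<And>\<phi>. \<phi> \<in> embeddings K \<Longrightarrow> v (cj \<phi>) = v \<phi>" "(\<Sum>\<phi>\<in>embeddings K. v \<phi>) = (0 :: real)"
    obtain \<epsilon> where \<epsilon>: "\<epsilon> \<in> int_units K" "\<And>\<phi>. \<phi> \<in> embeddings K \<Longrightarrow> \<bar>lg \<phi> \<epsilon> - v \<phi>\<bar> \<le> C0"
      using C0[of v] v by blast
    obtain \<delta> k where \<delta>: "\<delta> \<in> reps" "\<epsilon> = \<delta> * monomial B k" using coset_decomposition[OF \<epsilon>(1)] .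
    define q \<rho> where "q = (\<lambda>b. k b div int m)" and "\<rho> = (\<lambda>b. k b mod int m)"
    have k: "monomial B k = monomial B (\<lambda>b. int m * q b) * monomial B \<rho>"
      unfolding monomial_add[OF B_nz, symmetric] by (intro monomial_cong) (simp add: q_def \<rho>_def)
    show "\<exists>q. \<forall>\<phi>\<in>embeddings K. \<bar>lg \<phi> (monomial B (\<lambda>b. int m * q b)) - v \<phi>\<bar>
            \<le> C0 + log_size reps + real m * log_size B"
    proof (intro exI[of _ q] ballI)
      fix \<phi> assume \<phi>: "\<phi> \<in> embeddings K"
      note U = monomial_unit reps_units[OF \<delta>(1)]
      have "lg \<phi> \<epsilon> = lg \<phi> \<delta> + lg \<phi> (monomial B k)"
        unfolding \<delta>(2) by (intro lg_mult \<phi> unit_in_K unit_nz U)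
      also have "lg \<phi> (monomial B k) = lg \<phi> (monomial B (\<lambda>b. int m * q b)) + lg \<phi> (monomial B \<rho>)"
        unfolding k by (intro lg_mult \<phi> unit_in_K unit_nz U)
      finally have eq: "lg \<phi> \<epsilon> = lg \<phi> \<delta> + (lg \<phi> (monomial B (\<lambda>b. int m * q b)) + lg \<phi> (monomial B \<rho>))" .
      have "\<bar>lg \<phi> (monomial B \<rho>)\<bar> \<le> real m * log_size B"
      proof (rule abs_lg_monomial_le[OF \<phi> B_units])
        fix b
        have "0 \<le> k b mod int m" "k b mod int m \<le> int m" using m by (auto intro: less_imp_le)
        thus "\<bar>real_of_int (\<rho> b)\<bar> \<le> real m" unfolding \<rho>_def by linarith
      qed simp
      moreover have "\<bar>lg \<phi> \<delta>\<bar> \<le> log_size reps" by (rule abs_lg_le_log_size[OF finite_reps \<delta>(1) \<phi>])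
      ultimately show "\<bar>lg \<phi> (monomial B (\<lambda>b. int m * q b)) - v \<phi>\<bar>
            \<le> C0 + log_size reps + real m * log_size B"
        using \<epsilon>(2)[OF \<phi>] eq by linarith
    qed
  qed
qed

text \<open>Two points of a box on which \<open>\<phi>\<close> and \<open>\<psi>\<close> agree at \<open>\<alpha> \<epsilon>\<close> cannot differ in the \<open>b\<close>-coordinate only,
  when no power of \<open>b\<close> has equal images.\<close>

lemma card_bad_le:
  fixes A :: nat
  assumes \<phi>: "\<phi> \<in> embeddings K" and \<psi>: "\<psi> \<in> embeddings K" and \<alpha>0: "\<alpha> \<noteq> 0" and m: "m > 0"
    and b: "b \<in> B" "\<And>j. j > 0 \<Longrightarrow> \<phi> (b ^ j) \<noteq> \<psi> (b ^ j)"
  shows "(A + 1) * card {n \<in> B \<rightarrow>\<^sub>E {0..int A}.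
      \<phi> (\<alpha> * monomial B (\<lambda>b. int m * (q b + n b))) = \<psi> (\<alpha> * monomial B (\<lambda>b. int m * (q b + n b)))} \<le> (A + 1) ^ card B"
    (is "(A + 1) * card ?S \<le> _")
proof -
  let ?e = "\<lambda>n. monomial B (\<lambda>b. int m * (q b + n b))"
  let ?T = "(B - {b}) \<rightarrow>\<^sub>E {0..int A}"
  \<comment> \<open>Forgetting the \<open>b\<close>-coordinate is injective on the exceptions, which
    saves one factor \<open>A + 1\<close>.\<close>
  have "card ?S \<le> card ?T"
  proof (rule card_inj_on_le)
    show "finite ?T" using finite_B by (intro finite_PiE) auto
    show "(\<lambda>n. restrict n (B - {b})) ` ?S \<subseteq> ?T" by (auto split: if_splits)
    show "inj_on (\<lambda>n. restrict n (B - {b})) ?S"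
    proof (rule inj_onI)
      fix n l assume n: "n \<in> ?S" and l: "l \<in> ?S" and n_l: "restrict n (B - {b}) = restrict l (B - {b})"
      have off: "n c = l c" if "c \<in> B" "c \<noteq> b" for c
      proof -
        have "restrict n (B - {b}) c = restrict l (B - {b}) c" using n_l by simp
        thus ?thesis using that by simp
      qed
      have "n b = l b"
      proof (rule ccontr)
        assume ne: "n b \<noteq> l b"
        define j where "j = int m * (n b - l b)"
        have "j \<noteq> 0" using ne m by (simp add: j_def)
        have eK: "?e k \<in> K" "?e k \<noteq> 0" for k using unit_in_K[OF monomial_unit] monomial_nz by auto
        have bK: "b \<in> K" "b \<noteq> 0" using b(1) B_units unit_in_K B_nz by auto
        have "\<alpha> * ?e n / (\<alpha> * ?e l) = ?e n / ?e l" using \<alpha>0 by simp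
        also have "\<dots> = monomial B (\<lambda>b. int m * (q b + n b) - int m * (q b + l b))"
          by (rule monomial_diff[OF B_nz, symmetric])
        also have "\<dots> = (\<Prod>c\<in>B. if c = b then b powi j else 1)"
          unfolding monomial_def by (intro prod.cong) (auto simp: j_def off algebra_simps)
        also have "\<dots> = b powi j" using finite_B b(1) by simp
        finally have quot: "\<alpha> * ?e n / (\<alpha> * ?e l) = b powi j" .
        have aK: "\<alpha> * ?e n \<in> K" "\<alpha> * ?e l \<in> K" using eK alpha_in_K K_closed(4) by auto
        have "\<phi> (b powi j) = \<psi> (b powi j)"
          unfolding quot[symmetric] embD(10)[OF \<phi> aK] embD(10)[OF \<psi> aK] using n l by simp
        hence eq: "\<phi> b powi j = \<psi> b powi j"
          using embD(12)[OF \<phi> bK(1)] embD(12)[OF \<psi> bK(1)] by simp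
        have "\<phi> b ^ nat \<bar>j\<bar> = \<psi> b ^ nat \<bar>j\<bar>"
        proof (cases "j \<ge> 0")
          case True
          thus ?thesis using eq by (simp add: power_int_def)
        next
          case False
          thus ?thesis using eq by (simp add: power_int_def power_inverse)
        qed
        hence "\<phi> (b ^ nat \<bar>j\<bar>) = \<psi> (b ^ nat \<bar>j\<bar>)"
          using embD(11)[OF \<phi> bK(1)] embD(11)[OF \<psi> bK(1)] by simp
        thus False using b(2)[of "nat \<bar>j\<bar>"] \<open>j \<noteq> 0\<close> by simp
      qed
      thus "n = l" using n l off by (intro PiE_ext[of n B "\<lambda>_. {0..int A}" l]) auto
    qed
  qed
  also have "card ?T = (A + 1) ^ (card B - 1)"
    using finite_B b(1) by (simp add: card_PiE nat_add_distrib)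
  finally have "(A + 1) * card ?S \<le> (A + 1) * (A + 1) ^ (card B - 1)" by (rule mult_left_mono) simp
  also have "\<dots> = (A + 1) ^ card B"
    using finite_B b(1) by (cases "card B") auto
  finally show ?thesis .
qed

text \<open>The slice at height \<open>T\<close> of a cone about the ray through \<open>v\<close>: a
  cube of radius \<open>\<delta> * T\<close> about \<open>T * v\<close> in logarithmic
  coordinates.\<close>

definition cone :: "((complex \<Rightarrow> complex) \<Rightarrow> real) \<Rightarrow> real \<Rightarrow> real \<Rightarrow> complex set" where
  "cone v \<delta> T = {\<epsilon> \<in> int_units K. separating (\<alpha> * \<epsilon>) \<and> (\<forall>\<phi>\<in>embeddings K. \<bar>lg \<phi> \<epsilon> - T * v \<phi>\<bar> \<le> \<delta> * T)}"

lemma finite_cone: "finite (cone v \<delta> T)"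
proof (rule finite_subset[OF _ finite_units_bounded])
  define M where "M = (\<Sum>\<phi>\<in>embeddings K. \<bar>T * v \<phi>\<bar>)"
  have M: "\<bar>T * v \<phi>\<bar> \<le> M" if "\<phi> \<in> embeddings K" for \<phi>
    unfolding M_def using that finite_embeddings by (intro member_le_sum) auto
  have "lg \<phi> \<epsilon> \<le> \<delta> * T + M" if "\<epsilon> \<in> cone v \<delta> T" "\<phi> \<in> embeddings K" for \<epsilon> \<phi>
  proof -
    have "\<bar>lg \<phi> \<epsilon> - T * v \<phi>\<bar> \<le> \<delta> * T" using that by (auto simp: cone_def)
    thus ?thesis using M[OF that(2)] by linarith
  qed
  thus "cone v \<delta> T \<subseteq> {\<epsilon> \<in> int_units K. \<forall>\<phi>\<in>embeddings K. lg \<phi> \<epsilon> \<le> \<delta> * T + M}"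
    by (auto simp: cone_def)
qed

text \<open>Translates of a box by a unit near \<open>T * v\<close> stay in the slice, distinct
  exponents give distinct units, and at most half of the box is exceptional.\<close>

lemma card_cone_ge:
  assumes v: "\<And>\<phi>. \<phi> \<in> embeddings K \<Longrightarrow> v (cj \<phi>) = v \<phi>" "(\<Sum>\<phi>\<in>embeddings K. v \<phi>) = 0"
    and \<delta>: "\<delta> > 0" and \<alpha>0: "\<alpha> \<noteq> 0"
  obtains c where "c > 0" "\<forall>\<^sub>F T in at_top. real (card (cone v \<delta> T)) \<ge> c * T ^ card B"
proof -
  obtain m where m: "m > 0" "\<And>\<phi> \<psi>. \<phi> \<in> embeddings K \<Longrightarrow> \<psi> \<in> embeddings K \<Longrightarrow>
       (\<forall>b\<in>B. \<phi> (b ^ m) = \<psi> (b ^ m)) \<or> (\<exists>b\<in>B. \<forall>j>0. \<phi> (b ^ j) \<noteq> \<psi> (b ^ j))"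
    by (rule common_exponent) blast
  obtain C where C: "\<And>v. \<lbrakk>\<And>\<phi>. \<phi> \<in> embeddings K \<Longrightarrow> v (cj \<phi>) = v \<phi>; (\<Sum>\<phi>\<in>embeddings K. v \<phi>) = 0\<rbrakk> \<Longrightarrow>
     \<exists>q. \<forall>\<phi>\<in>embeddings K. \<bar>lg \<phi> (monomial B (\<lambda>b. int m * q b)) - v \<phi>\<bar> \<le> C"
    by (rule multiples_cocompact[OF m(1)]) blast
  define D where "D = real m * log_size B + 1"
  have D: "D \<ge> 1" using log_size_nonneg by (simp add: D_def)
  \<comment> \<open>A box of side \<open>\<kappa> * T\<close> moves the logarithms by at most
    \<open>D * \<kappa> * T = \<delta> * T / 2\<close>; the other half of the tolerance is for the
    approximation of \<open>T * v\<close>. The summand 1 in \<open>D\<close> keeps the quotient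
    defined when \<open>log_size B\<close> is 0.\<close>
  define \<kappa> where "\<kappa> = \<delta> / (2 * D)"
  have \<kappa>: "\<kappa> > 0" using \<delta> D by (simp add: \<kappa>_def)
  \<comment> \<open>The second threshold puts the approximation error \<open>C\<close> below
    \<open>\<delta> * T / 2\<close>; the third gives \<open>A + 1 \<ge> 2 * d ^ 2\<close>, so the
    \<open>d ^ 2\<close> exceptional sets fill at most half of the box.\<close>
  have main: "real (card (cone v \<delta> T)) \<ge> \<kappa> ^ card B / 2 * T ^ card B"
    if T: "T \<ge> 0" "\<delta> * T \<ge> 2 * C" "\<kappa> * T \<ge> 2 * real d ^ 2" for T
  proof -
    obtain q where q: "\<And>\<phi>. \<phi> \<in> embeddings K \<Longrightarrow> \<bar>lg \<phi> (monomial B (\<lambda>b. int m * q b)) - T * v \<phi>\<bar> \<le> C"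
      using C[of "\<lambda>\<phi>. T * v \<phi>"] v by (auto simp flip: sum_distrib_left)
    define A where "A = nat \<lfloor>\<kappa> * T\<rfloor>"
    have A: "real A \<le> \<kappa> * T" "\<kappa> * T \<le> real A + 1" using T(1) \<kappa> by (auto simp: A_def)
    define S where "S = B \<rightarrow>\<^sub>E {0..int A}"
    define e where "e = (\<lambda>n. monomial B (\<lambda>b. int m * (q b + n b)))"
    \<comment> \<open>\<open>P\<close> is the full square of embeddings; the inequality inside the
      set empties the diagonal, where every point would otherwise be exceptional.\<close>
    define bad where "bad = (\<lambda>p. {n \<in> S. fst p \<noteq> snd p \<and> fst p (\<alpha> * e n) = (snd p (\<alpha> * e n) :: complex)})"
    define P where "P = embeddings K \<times> embeddings K"
    have finS: "finite S" unfolding S_def using finite_B by (intro finite_PiE) auto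
    have card_S: "real (card S) = (real A + 1) ^ card B"
      unfolding S_def using finite_B by (simp add: card_PiE nat_add_distrib add.commute)
    have bad_le: "(A + 1) * card (bad p) \<le> (A + 1) ^ card B" if p: "p \<in> P" for p
    proof -
      obtain \<phi> \<psi> where p_eq: "p = (\<phi>, \<psi>)" by (cases p)
      have \<phi>: "\<phi> \<in> embeddings K" and \<psi>: "\<psi> \<in> embeddings K" using p by (auto simp: p_eq P_def)
      show ?thesis
      proof (cases "\<exists>b\<in>B. \<forall>j>0. \<phi> (b ^ j) \<noteq> \<psi> (b ^ j)")
        case True
        then obtain b where b: "b \<in> B" "\<And>j. j > 0 \<Longrightarrow> \<phi> (b ^ j) \<noteq> \<psi> (b ^ j)" by blast
        have "card (bad p) \<le> card {n \<in> B \<rightarrow>\<^sub>E {0..int A}. \<phi> (\<alpha> * e n) = \<psi> (\<alpha> * e n)}"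
          using finS by (intro card_mono) (auto simp: bad_def p_eq S_def)
        hence "(A + 1) * card (bad p) \<le> (A + 1) * card {n \<in> B \<rightarrow>\<^sub>E {0..int A}. \<phi> (\<alpha> * e n) = \<psi> (\<alpha> * e n)}"
          by (rule mult_left_mono) simp
        also have "\<dots> \<le> (A + 1) ^ card B"
          unfolding e_def by (rule card_bad_le[OF \<phi> \<psi> \<alpha>0 m(1) b])
        finally show ?thesis .
      next
        case False
        hence eq: "\<And>b. b \<in> B \<Longrightarrow> \<phi> (b ^ m) = \<psi> (b ^ m)" using m(2)[OF \<phi> \<psi>] by blast
        have emb_mono: "\<tau> (e n) = (\<Prod>b\<in>B. \<tau> (b ^ m) powi (q b + n b))" if \<tau>: "\<tau> \<in> embeddings K" for \<tau> n
        proof -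
          have "e n = (\<Prod>b\<in>B. (b ^ m) powi (q b + n b))"
            unfolding e_def monomial_def by (intro prod.cong) (simp_all add: power_int_mult)
          moreover have "(\<Prod>b\<in>B'. (b ^ m) powi (q b + n b)) \<in> K \<and> \<tau> (\<Prod>b\<in>B'. (b ^ m) powi (q b + n b)) =
              (\<Prod>b\<in>B'. \<tau> (b ^ m) powi (q b + n b))" if "B' \<subseteq> B" for B'
            using finite_subset[OF that finite_B] that
          proof (induction B' rule: finite_induct)
            case (insert b B')
            have bm: "b ^ m \<in> int_units K" using insert.prems B_units by (intro unit_power) auto
            hence "(b ^ m) powi (q b + n b) \<in> K" by (intro unit_in_K unit_powi)
            thus ?case using insert embD(3,12)[OF \<tau>] unit_in_K[OF bm] K_closed(4) by simp
          qed (auto simp: embD[OF \<tau>] K_closed)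
          ultimately show ?thesis by simp
        qed
        have "bad p = {}"
        proof (rule equals0I)
          fix n assume "n \<in> bad p"
          hence n: "\<phi> \<noteq> \<psi>" "\<phi> (\<alpha> * e n) = \<psi> (\<alpha> * e n)" by (auto simp: bad_def p_eq)
          have eK: "e n \<in> K" "e n \<noteq> 0" unfolding e_def using unit_in_K[OF monomial_unit] monomial_nz by auto
          have "\<phi> (e n) = \<psi> (e n)" unfolding emb_mono[OF \<phi>] emb_mono[OF \<psi>] using eq by simp
          hence "\<phi> \<alpha> = \<psi> \<alpha>"
            using n(2) embD(3)[OF \<phi> alpha_in_K eK(1)] embD(3)[OF \<psi> alpha_in_K eK(1)] embD(9)[OF \<psi> eK] by simp
          thus False using n(1) embedding_eqI[OF \<phi> \<psi>] by blast
        qed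
        thus ?thesis by simp
      qed
    qed
    define Bad where "Bad = (\<Union>p\<in>P. bad p)"
    have "card Bad \<le> (\<Sum>p\<in>P. card (bad p))"
      unfolding Bad_def P_def using finite_embeddings by (intro card_UN_le) auto
    hence "(A + 1) * card Bad \<le> (\<Sum>p\<in>P. (A + 1) * card (bad p))"
      unfolding sum_distrib_left[symmetric] by (rule mult_left_mono) simp
    also have "\<dots> \<le> (\<Sum>p\<in>P. (A + 1) ^ card B)" by (intro sum_mono bad_le)
    also have "\<dots> = d ^ 2 * (A + 1) ^ card B"
      by (simp add: P_def card_embeddings card_cartesian_product power2_eq_square)
    finally have "real ((A + 1) * card Bad) \<le> real (d ^ 2 * (A + 1) ^ card B)" by (simp only: of_nat_le_iff)
    hence "(real A + 1) * real (card Bad) \<le> real d ^ 2 * (real A + 1) ^ card B"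
      by (simp add: algebra_simps)
    also have "\<dots> \<le> (real A + 1) / 2 * (real A + 1) ^ card B"
      using T(3) A(2) by (intro mult_right_mono) auto
    finally have Bad: "real (card Bad) \<le> (real A + 1) ^ card B / 2" by simp
    have inj_e: "inj_on e S"
    proof (rule inj_onI)
      fix n l assume nl: "n \<in> S" "l \<in> S" "e n = e l"
      have "n b = l b" if "b \<in> B" for b
        using inj_on_monomial[OF B_indep B_nz nl(3)[unfolded e_def] that] m(1) by simp
      thus "n = l" using nl(1,2) by (auto simp: S_def intro: PiE_ext)
    qed
    have sub: "e ` (S - Bad) \<subseteq> cone v \<delta> T"
    proof safe
      fix n assume n: "n \<in> S" "n \<notin> Bad"
      show "e n \<in> cone v \<delta> T"
        unfolding cone_def
      proof safe
        show "e n \<in> int_units K" unfolding e_def by (rule monomial_unit)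
        show "separating (\<alpha> * e n)"
          using n unfolding separating_def inj_on_def Bad_def P_def bad_def by auto
        fix \<phi> assume \<phi>: "\<phi> \<in> embeddings K"
        have "e n = monomial B (\<lambda>b. int m * q b) * monomial B (\<lambda>b. int m * n b)"
          unfolding e_def monomial_add[OF B_nz, symmetric] by (simp add: distrib_left)
        hence "lg \<phi> (e n) = lg \<phi> (monomial B (\<lambda>b. int m * q b)) + lg \<phi> (monomial B (\<lambda>b. int m * n b))"
          using lg_mult[OF \<phi>] unit_in_K[OF monomial_unit] monomial_nz by simp
        moreover have "\<bar>lg \<phi> (monomial B (\<lambda>b. int m * n b))\<bar> \<le> (real m * real A) * log_size B"
        proof (rule abs_lg_monomial_le[OF \<phi> B_units])
          fix b assume "b \<in> B"
          hence "n b \<in> {0..int A}" using PiE_mem[OF n(1)[unfolded S_def]] by blast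
          thus "\<bar>real_of_int (int m * n b)\<bar> \<le> real m * real A"
            by (auto simp: abs_mult intro!: mult_left_mono)
        qed simp
        moreover have "(real m * real A) * log_size B \<le> \<delta> * T / 2"
        proof -
          have "(real m * real A) * log_size B \<le> D * real A" by (simp add: D_def algebra_simps)
          also have "\<dots> \<le> D * (\<kappa> * T)" using A(1) D by (intro mult_left_mono) auto
          also have "\<dots> = \<delta> * T / 2" using D by (simp add: \<kappa>_def)
          finally show ?thesis .
        qed
        ultimately show "\<bar>lg \<phi> (e n) - T * v \<phi>\<bar> \<le> \<delta> * T"
          using q[OF \<phi>] T(2) by linarith
      qed
    qed
    have "\<kappa> ^ card B / 2 * T ^ card B = (\<kappa> * T) ^ card B / 2" by (simp add: power_mult_distrib)
    also have "\<dots> \<le> (real A + 1) ^ card B / 2"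
      using A(2) T(1) \<kappa> by (intro divide_right_mono power_mono) auto
    also have "\<dots> \<le> real (card S) - real (card Bad)" using Bad card_S by simp
    also have "\<dots> \<le> real (card (S - Bad))"
    proof -
      have "Bad \<subseteq> S" by (auto simp: Bad_def bad_def)
      thus ?thesis using finS by (simp add: card_Diff_subset finite_subset card_mono of_nat_diff)
    qed
    also have "card (S - Bad) = card (e ` (S - Bad))"
      using inj_on_subset[OF inj_e] by (intro card_image[symmetric]) auto
    also have "real \<dots> \<le> real (card (cone v \<delta> T))"
      using card_mono[OF finite_cone sub] by simp
    finally show ?thesis .
  qed
  have "\<forall>\<^sub>F T in at_top. T \<ge> (0::real) \<and> T \<ge> 2 * C / \<delta> \<and> T \<ge> 2 * real d ^ 2 / \<kappa>"
    by (intro eventually_conj eventually_ge_at_top)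
  hence "\<forall>\<^sub>F T in at_top. real (card (cone v \<delta> T)) \<ge> \<kappa> ^ card B / 2 * T ^ card B"
  proof eventually_elim
    case (elim T)
    thus ?case using \<delta> \<kappa> by (intro main) (auto simp: field_simps)
  qed
  thus ?thesis using that[of "\<kappa> ^ card B / 2"] \<kappa> by simp
qed

end

section \<open>Asymptotic counting\<close>

text \<open>A multiplicative analogue of Fekete's lemma. For fixed \<open>s\<close> the normalised
  function at all large \<open>t\<close> is at most a factor times its value at \<open>s\<close>.
  That factor tends to \<open>h s\<close> as \<open>t\<close> grows, and \<open>h s\<close> tends to
  1 as \<open>s\<close> grows, so the upper limit cannot exceed the lower one.\<close>

lemma scaling_limit:
  fixes f :: "real \<Rightarrow> real" and r :: nat
  assumes C: "C \<ge> 0" and mono: "\<And>s t. s \<le> t \<Longrightarrow> f s \<le> f t" and nonneg: "\<And>t. f t \<ge> 0"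
    and scale: "\<And>k t. k \<ge> 1 \<Longrightarrow> f (real k * t) \<le> real k ^ r * f (t + C)"
    and c: "c > 0" and lower: "\<forall>\<^sub>F t in at_top. f t \<ge> c * t ^ r"
  shows "\<exists>L>0. ((\<lambda>t. f t / t ^ r) \<longlongrightarrow> L) at_top"
proof -
  define F where "F = (\<lambda>t. f t / t ^ r)"
  have key: "F t \<le> (s / (s - C) + s / t) ^ r * F s" if st: "s > C" "t \<ge> s - C" for s t
  proof -
    \<comment> \<open>The least \<open>k\<close> with \<open>t \<le> k * (s - C)\<close>; the
      argument \<open>s - C\<close> is chosen so that the shift by \<open>C\<close> lands exactly at
      \<open>s\<close>.\<close>
    define k where "k = nat \<lceil>t / (s - C)\<rceil>"
    have t0: "t > 0" "s > 0" using st C by auto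
    have "t / (s - C) \<ge> 1" using st by simp
    hence k: "k \<ge> 1" "t / (s - C) \<le> real k" "real k \<le> t / (s - C) + 1"
      unfolding k_def by linarith+
    have "f t \<le> f (real k * (s - C))" using k(2) st by (intro mono) (simp add: field_simps)
    also have "\<dots> \<le> real k ^ r * f s" using scale[OF k(1), of "s - C"] by simp
    also have "\<dots> \<le> (t / (s - C) + 1) ^ r * f s"
      using k(3) nonneg by (intro mult_right_mono power_mono) auto
    finally have "F t \<le> (t / (s - C) + 1) ^ r * f s / t ^ r"
      unfolding F_def using t0 by (intro divide_right_mono) auto
    also have "\<dots> = (s / (s - C) + s / t) ^ r * F s"
    proof -
      have "s / (s - C) + s / t = s * ((t / (s - C) + 1) / t)" using t0 st by (simp add: field_simps)
      thus ?thesis using t0 by (simp add: F_def power_mult_distrib power_divide)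
    qed
    finally show ?thesis .
  qed
  define h where "h = (\<lambda>s. (s / (s - C)) ^ r)"
  define Ls where "Ls = Limsup at_top (\<lambda>t. ereal (F t))"
  have Ls_le: "Ls \<le> ereal (h s * F s)" if s: "s > C" for s
  proof -
    have "((\<lambda>t. (s / (s - C) + s / t) ^ r * F s) \<longlongrightarrow> (s / (s - C) + 0) ^ r * F s) at_top"
      by (intro tendsto_intros tendsto_divide_0[OF tendsto_const] filterlim_at_top_imp_at_infinity filterlim_ident)
    hence "Limsup at_top (\<lambda>t. ereal ((s / (s - C) + s / t) ^ r * F s)) = ereal (h s * F s)"
      by (intro lim_imp_Limsup) (auto simp: h_def)
    moreover have "Ls \<le> Limsup at_top (\<lambda>t. ereal ((s / (s - C) + s / t) ^ r * F s))"
      unfolding Ls_def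
      by (intro Limsup_mono eventually_mono[OF eventually_ge_at_top[of "s - C"]]) (auto intro: key s)
    ultimately show ?thesis by simp
  qed
  have ev: "\<forall>\<^sub>F t in at_top. F t \<ge> c"
    using lower eventually_gt_at_top[of 0]
    by eventually_elim (simp add: F_def field_simps)
  have "ereal c \<le> Liminf at_top (\<lambda>t. ereal (F t))"
    using ev by (intro Liminf_bounded) auto
  also have "\<dots> \<le> Ls" unfolding Ls_def by (intro Liminf_le_Limsup) auto
  finally have c_le: "ereal c \<le> Ls" .
  have "Ls \<le> ereal (h (C + 1) * F (C + 1))" by (rule Ls_le) simp
  \<comment> \<open>A single instance of \<open>Ls_le\<close> bounds the extended upper limit from
    above, and \<open>c\<close> bounds it from below, so it is a real number.\<close>
  with c_le obtain M where M: "Ls = ereal M" "M \<ge> c"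
    by (cases Ls) auto
  have h_lim: "((\<lambda>s. M / h s) \<longlongrightarrow> M) at_top"
  proof -
    have "((\<lambda>s. 1 + C / (s - C)) \<longlongrightarrow> 1 + 0) at_top"
      by (intro tendsto_intros tendsto_divide_0[OF tendsto_const] filterlim_at_top_imp_at_infinity
            filterlim_tendsto_add_at_top[where f = "\<lambda>_. - C", simplified])
         (auto intro!: filterlim_ident)
    moreover have "\<forall>\<^sub>F s in at_top. 1 + C / (s - C) = s / (s - C)"
      using eventually_gt_at_top[of C] by eventually_elim (simp add: field_simps)
    ultimately have "((\<lambda>s. s / (s - C)) \<longlongrightarrow> 1 + 0) at_top"
      by (rule Lim_transform_eventually)
    hence "((\<lambda>s. s / (s - C)) \<longlongrightarrow> 1) at_top" by simp
    hence "((\<lambda>s. M / h s) \<longlongrightarrow> M / 1 ^ r) at_top"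
      unfolding h_def by (intro tendsto_intros) auto
    thus ?thesis by simp
  qed
  have "(F \<longlongrightarrow> M) at_top"
  proof (rule order_tendstoI)
    fix a assume "a < M"
    hence "\<forall>\<^sub>F s in at_top. a < M / h s" using h_lim by (simp add: order_tendsto_iff)
    thus "\<forall>\<^sub>F s in at_top. a < F s"
      using eventually_gt_at_top[of C]
    proof eventually_elim
      case (elim s)
      have "h s > 0" using elim(2) C by (simp add: h_def)
      moreover have "M \<le> h s * F s" using Ls_le[OF elim(2)] M(1) by simp
      ultimately have "M / h s \<le> F s" by (simp add: field_simps)
      thus ?case using elim(1) by simp
    qed
  next
    fix a assume "M < a"
    hence "Ls < ereal a" using M(1) by simp
    hence "\<forall>\<^sub>F t in at_top. ereal (F t) < ereal a" unfolding Ls_def by (rule Limsup_lessD)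
    thus "\<forall>\<^sub>F t in at_top. F t < a" by simp
  qed
  moreover have "M > 0" using M c by simp
  ultimately show ?thesis unfolding F_def by blast
qed

context unit_basis
begin

definition units_upto :: "real \<Rightarrow> complex set" where
  "units_upto t = {\<epsilon> \<in> int_units K. \<forall>\<phi>\<in>embeddings K. lg \<phi> (\<alpha> * \<epsilon>) \<le> t}"

lemma lg_alpha_mult:
  "\<alpha> \<noteq> 0 \<Longrightarrow> \<phi> \<in> embeddings K \<Longrightarrow> \<epsilon> \<in> int_units K \<Longrightarrow> lg \<phi> (\<alpha> * \<epsilon>) = lg \<phi> \<alpha> + lg \<phi> \<epsilon>"
  by (rule lg_mult[OF _ alpha_in_K]) (auto intro: unit_in_K dest: unit_nz)

lemma finite_units_upto:
  assumes "\<alpha> \<noteq> 0"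
  shows "finite (units_upto t)"
proof (rule finite_subset[OF _ finite_units_bounded])
  show "units_upto t \<subseteq> {\<epsilon> \<in> int_units K. \<forall>\<phi>\<in>embeddings K. lg \<phi> \<epsilon> \<le> t + log_size {\<alpha>}}"
  proof safe
    fix \<epsilon> \<phi> assume \<epsilon>: "\<epsilon> \<in> units_upto t" and \<phi>: "\<phi> \<in> embeddings K"
    have "lg \<phi> \<alpha> + lg \<phi> \<epsilon> \<le> t"
      using \<epsilon> \<phi> lg_alpha_mult[OF assms \<phi>] by (auto simp: units_upto_def)
    moreover have "\<bar>lg \<phi> \<alpha>\<bar> \<le> log_size {\<alpha>}" by (intro abs_lg_le_log_size \<phi>) auto
    ultimately show "lg \<phi> \<epsilon> \<le> t + log_size {\<alpha>}" by linarith
  qed (auto simp: units_upto_def)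
qed

text \<open>Dividing the exponents of a unit by \<open>k\<close> leaves \<open>k ^ card B\<close> possible remainders and divides the
  logarithms by \<open>k\<close> up to a bounded error. The coset representative is chosen canonically so that
  it can be recovered from the quotient.\<close>

lemma card_units_upto_scale:
  assumes \<alpha>0: "\<alpha> \<noteq> 0" and k: "k \<ge> 1"
  shows "card (units_upto (real k * t)) \<le>
    k ^ card B * card (units_upto (t + (2 * log_size {\<alpha>} + 2 * log_size reps + log_size B)))"
    (is "_ \<le> _ * card (units_upto (t + ?C))")
proof -
  define R where "R = (\<lambda>\<epsilon> \<delta>. \<delta> \<in> reps \<and> (\<exists>n. \<epsilon> = \<delta> * monomial B n))"
  define dl where "dl = (\<lambda>\<epsilon>. SOME \<delta>. R \<epsilon> \<delta>)"
  define nn where "nn = (\<lambda>\<epsilon>. SOME n. \<epsilon> = dl \<epsilon> * monomial B n)"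
  have R_dl: "R \<epsilon> (dl \<epsilon>)" if U: "\<epsilon> \<in> int_units K" for \<epsilon>
  proof -
    obtain \<delta> n where "\<delta> \<in> reps" "\<epsilon> = \<delta> * monomial B n" using coset_decomposition[OF U] .
    hence "R \<epsilon> \<delta>" by (auto simp: R_def)
    thus ?thesis unfolding dl_def by (rule someI)
  qed
  have nn: "\<epsilon> = dl \<epsilon> * monomial B (nn \<epsilon>)" if "\<epsilon> \<in> int_units K" for \<epsilon>
    unfolding nn_def using R_dl[OF that] by (intro someI_ex[of "\<lambda>n. \<epsilon> = dl \<epsilon> * monomial B n"]) (auto simp: R_def)
  \<comment> \<open>The predicate depends only on the coset of \<epsilon>, hence \<open>SOME\<close>
    picks the same representative throughout a coset.\<close>
  have R_shift: "R (\<epsilon> * monomial B n) = R \<epsilon>" for \<epsilon> n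
  proof
    fix \<delta>
    have "(\<exists>l. \<epsilon> * monomial B n = \<delta> * monomial B l) \<longleftrightarrow> (\<exists>l. \<epsilon> = \<delta> * monomial B l)"
    proof safe
      fix l assume "\<epsilon> * monomial B n = \<delta> * monomial B l"
      hence "\<epsilon> = \<delta> * monomial B (\<lambda>b. l b - n b)"
        using monomial_nz by (simp add: monomial_diff[OF B_nz] field_simps)
      thus "\<exists>l. \<epsilon> = \<delta> * monomial B l" by blast
    next
      fix l
      have "\<delta> * monomial B l * monomial B n = \<delta> * monomial B (\<lambda>b. l b + n b)"
        by (simp add: monomial_add[OF B_nz])
      thus "\<exists>la. \<delta> * monomial B l * monomial B n = \<delta> * monomial B la" by blast
    qed
    thus "R (\<epsilon> * monomial B n) \<delta> = R \<epsilon> \<delta>" by (simp add: R_def)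
  qed
  hence dl_shift: "dl (\<epsilon> * monomial B n) = dl \<epsilon>" for \<epsilon> n by (simp add: dl_def)
  \<comment> \<open>Only the monomial part is divided. Carrying \<open>dl \<epsilon>\<close> along
    keeps the quotient in the coset of \<epsilon>, so \<open>quo \<epsilon>\<close> determines
    \<open>dl \<epsilon>\<close>.\<close>
  define quo rem where "quo = (\<lambda>\<epsilon>. dl \<epsilon> * monomial B (\<lambda>b. nn \<epsilon> b div int k))"
    and "rem = (\<lambda>\<epsilon>. \<lambda>b\<in>B. nn \<epsilon> b mod int k)"
  have dl_unit: "dl \<epsilon> \<in> int_units K" "dl \<epsilon> \<in> reps" if "\<epsilon> \<in> int_units K" for \<epsilon>
    using R_dl[OF that] reps_units by (auto simp: R_def)
  have dl_quo: "dl (quo \<epsilon>) = dl \<epsilon>" if "\<epsilon> \<in> int_units K" for \<epsilon>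
  proof -
    have "dl (quo \<epsilon>) = dl (dl \<epsilon>)" unfolding quo_def by (rule dl_shift)
    also have "\<dots> = dl (dl \<epsilon> * monomial B (nn \<epsilon>))" by (rule dl_shift[symmetric])
    also have "\<dots> = dl \<epsilon>" using nn[OF that] by simp
    finally show ?thesis .
  qed
  let ?T = "units_upto (t + ?C) \<times> (B \<rightarrow>\<^sub>E {0..<int k})"
  have "card (units_upto (real k * t)) \<le> card ?T"
  proof (rule card_inj_on_le)
    show "finite ?T" using finite_B by (intro finite_cartesian_product finite_units_upto \<alpha>0 finite_PiE) auto
    show "inj_on (\<lambda>\<epsilon>. (quo \<epsilon>, rem \<epsilon>)) (units_upto (real k * t))"
    proof (rule inj_onI)
      fix x y assume "x \<in> units_upto (real k * t)" "y \<in> units_upto (real k * t)"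
        and eq: "(quo x, rem x) = (quo y, rem y)"
      hence U: "x \<in> int_units K" "y \<in> int_units K" by (auto simp: units_upto_def)
      have dl: "dl x = dl y" using dl_quo[OF U(1)] dl_quo[OF U(2)] eq by simp
      hence "monomial B (\<lambda>b. nn x b div int k) = monomial B (\<lambda>b. nn y b div int k)"
        using eq unit_nz[OF dl_unit(1)[OF U(2)]] by (simp add: quo_def)
      hence div: "nn x b div int k = nn y b div int k" if "b \<in> B" for b
        using inj_on_monomial[OF B_indep B_nz _ that] by blast
      have "nn x b mod int k = nn y b mod int k" if "b \<in> B" for b
      proof -
        have "rem x b = rem y b" using eq by simp
        thus ?thesis using that by (simp add: rem_def)
      qed
      hence "nn x b = nn y b" if "b \<in> B" for b
        using div that by (metis mult_div_mod_eq)
      hence "monomial B (nn x) = monomial B (nn y)" by (intro monomial_cong) auto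
      thus "x = y" using nn[OF U(1)] nn[OF U(2)] dl by simp
    qed
    show "(\<lambda>\<epsilon>. (quo \<epsilon>, rem \<epsilon>)) ` units_upto (real k * t) \<subseteq> ?T"
    proof (rule image_subsetI)
      fix \<epsilon> assume "\<epsilon> \<in> units_upto (real k * t)"
      hence \<epsilon>: "\<epsilon> \<in> int_units K" "\<And>\<phi>. \<phi> \<in> embeddings K \<Longrightarrow> lg \<phi> (\<alpha> * \<epsilon>) \<le> real k * t"
        by (auto simp: units_upto_def)
      have rem: "rem \<epsilon> \<in> B \<rightarrow>\<^sub>E {0..<int k}" using k by (auto simp: rem_def)
      define m \<rho> where "m = (\<lambda>b. nn \<epsilon> b div int k)" and "\<rho> = (\<lambda>b. nn \<epsilon> b mod int k)"
      have mono_eq: "monomial B (nn \<epsilon>) = monomial B m ^ k * monomial B \<rho>"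
        unfolding monomial_scale[symmetric] monomial_add[OF B_nz, symmetric]
        by (intro monomial_cong) (simp add: m_def \<rho>_def)
      note dU = dl_unit[OF \<epsilon>(1)]
      have "quo \<epsilon> \<in> units_upto (t + ?C)"
        unfolding units_upto_def
      proof safe
        show qU: "quo \<epsilon> \<in> int_units K"
          unfolding quo_def by (intro unit_mult dU monomial_unit)
        fix \<phi> assume \<phi>: "\<phi> \<in> embeddings K"
        have L1: "lg \<phi> (quo \<epsilon>) = lg \<phi> (dl \<epsilon>) + lg \<phi> (monomial B m)"
          unfolding quo_def m_def by (intro lg_mult \<phi> unit_in_K unit_nz dU monomial_unit)
        have "lg \<phi> (monomial B (nn \<epsilon>)) = lg \<phi> (monomial B m ^ k) + lg \<phi> (monomial B \<rho>)"
          unfolding mono_eq by (intro lg_mult \<phi> unit_in_K unit_nz unit_power monomial_unit)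
        also have "lg \<phi> (monomial B m ^ k) = real k * lg \<phi> (monomial B m)"
          by (intro lg_power \<phi> unit_in_K unit_nz monomial_unit)
        finally have L2: "lg \<phi> (monomial B (nn \<epsilon>)) = real k * lg \<phi> (monomial B m) + lg \<phi> (monomial B \<rho>)" .
        have "lg \<phi> \<epsilon> = lg \<phi> (dl \<epsilon> * monomial B (nn \<epsilon>))" using nn[OF \<epsilon>(1)] by simp
        also have "\<dots> = lg \<phi> (dl \<epsilon>) + lg \<phi> (monomial B (nn \<epsilon>))"
          by (intro lg_mult \<phi> unit_in_K unit_nz dU monomial_unit)
        finally have L3: "lg \<phi> \<epsilon> = lg \<phi> (dl \<epsilon>) + (real k * lg \<phi> (monomial B m) + lg \<phi> (monomial B \<rho>))"
          using L2 by simp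
        have b\<rho>: "\<bar>lg \<phi> (monomial B \<rho>)\<bar> \<le> real k * log_size B"
        proof (rule abs_lg_monomial_le[OF \<phi> B_units])
          fix b
          have "0 \<le> nn \<epsilon> b mod int k" "nn \<epsilon> b mod int k \<le> int k" using k by (auto intro: less_imp_le)
          thus "\<bar>real_of_int (\<rho> b)\<bar> \<le> real k" unfolding \<rho>_def by linarith
        qed simp
        have b\<alpha>: "\<bar>lg \<phi> \<alpha>\<bar> \<le> log_size {\<alpha>}" by (intro abs_lg_le_log_size \<phi>) auto
        have b\<delta>: "\<bar>lg \<phi> (dl \<epsilon>)\<bar> \<le> log_size reps" by (intro abs_lg_le_log_size finite_reps dU \<phi>)
        have "lg \<phi> \<alpha> + lg \<phi> \<epsilon> \<le> real k * t" using \<epsilon>(2)[OF \<phi>] lg_alpha_mult[OF \<alpha>0 \<phi> \<epsilon>(1)] by simp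
        hence "real k * lg \<phi> (monomial B m) \<le> real k * t + log_size {\<alpha>} + log_size reps + real k * log_size B"
          using L3 b\<rho> b\<alpha> b\<delta> by linarith
        \<comment> \<open>The nonnegative constants are inflated by \<open>k \<ge> 1\<close> so that
          \<open>k\<close> cancels. In \<open>?C\<close> the contributions of \<alpha> and of the
          representative occur twice: removed before the division, put back after it.\<close>
        also have "\<dots> \<le> real k * t + real k * log_size {\<alpha>} + real k * log_size reps + real k * log_size B"
        proof -
          have "x \<le> real k * x" if "x \<ge> 0" for x using k mult_right_mono[of 1 "real k" x] that by simp
          thus ?thesis using log_size_nonneg by (intro add_mono) auto
        qed
        also have "\<dots> = real k * (t + log_size {\<alpha>} + log_size reps + log_size B)"
          by (simp add: algebra_simps)
        finally have "lg \<phi> (monomial B m) \<le> t + log_size {\<alpha>} + log_size reps + log_size B"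
          using k by simp
        thus "lg \<phi> (\<alpha> * quo \<epsilon>) \<le> t + ?C"
          unfolding lg_alpha_mult[OF \<alpha>0 \<phi> qU] L1 using b\<alpha> b\<delta> by linarith
      qed
      with rem show "(quo \<epsilon>, rem \<epsilon>) \<in> ?T" by blast
    qed
  qed
  also have "card ?T = k ^ card B * card (units_upto (t + ?C))"
    using finite_B by (simp add: card_cartesian_product card_PiE)
  finally show ?thesis .
qed

section \<open>The house and pairs of large conjugates\<close>

lemma house_le_iff:
  "house K x \<le> b \<longleftrightarrow> (\<forall>\<phi>\<in>embeddings K. cmod (\<phi> x) \<le> b)"
  unfolding house_def using finite_embeddings id_embedding by (subst Max_le_iff) auto

lemma house_attained:
  obtains \<phi> where "\<phi> \<in> embeddings K" "cmod (\<phi> x) = house K x"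
proof -
  have "house K x \<in> (\<lambda>\<phi>. cmod (\<phi> x)) ` embeddings K"
    unfolding house_def using finite_embeddings id_embedding by (intro Max_in) auto
  thus ?thesis using that by auto
qed

lemma house_le_units:
  assumes "\<alpha> \<noteq> 0" "N > 0"
  shows "house_le K \<alpha> (int_units K) N = units_upto (ln N)"
proof -
  have "cmod (\<phi> (\<alpha> * \<epsilon>)) \<le> N \<longleftrightarrow> lg \<phi> (\<alpha> * \<epsilon>) \<le> ln N"
    if "\<phi> \<in> embeddings K" "\<epsilon> \<in> int_units K" for \<phi> \<epsilon>
    using cmod_le_exp_iff_lg[OF that(1), of "\<alpha> * \<epsilon>" "ln N"] assms that
      unit_in_K unit_nz K_closed(4) alpha_in_K by simp
  thus ?thesis unfolding house_le_def units_upto_def house_le_iff by blast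
qed

text \<open>Whichever conjugate attains the house, one of the two elements of \<open>P\<close> differs from it.\<close>

lemma two_large_conjugates:
  assumes \<gamma>: "\<gamma> \<in> K" "\<gamma> \<noteq> 0" and P: "P \<subseteq> embeddings K" "card P = 2"
    and upper: "\<And>\<phi>. \<phi> \<in> embeddings K \<Longrightarrow> lg \<phi> \<gamma> \<le> a" and lower: "\<And>\<phi>. \<phi> \<in> P \<Longrightarrow> lg \<phi> \<gamma> \<ge> \<nu> * a"
    and \<nu>: "\<nu> \<ge> 0"
  shows "\<exists>\<phi>\<^sub>1\<in>embeddings K. \<exists>\<phi>\<^sub>2\<in>embeddings K. \<phi>\<^sub>1 \<noteq> \<phi>\<^sub>2 \<and>
       cmod (\<phi>\<^sub>1 \<gamma>) = house K \<gamma> \<and> cmod (\<phi>\<^sub>2 \<gamma>) \<ge> house K \<gamma> powr \<nu>"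
proof -
  obtain \<phi> where \<phi>: "\<phi> \<in> embeddings K" "cmod (\<phi> \<gamma>) = house K \<gamma>" by (rule house_attained)
  have "P \<noteq> {\<phi>}" "P \<noteq> {}" using P(2) by auto
  then obtain \<psi> where \<psi>: "\<psi> \<in> P" "\<psi> \<noteq> \<phi>" by blast
  have \<psi>E: "\<psi> \<in> embeddings K" using \<psi>(1) P(1) by blast
  have pos: "cmod (\<phi> \<gamma>) > 0" "cmod (\<psi> \<gamma>) > 0" using embD(9)[OF _ \<gamma>] \<phi>(1) \<psi>E by auto
  have "house K \<gamma> powr \<nu> = exp (\<nu> * lg \<phi> \<gamma>)" using pos \<phi>(2) by (simp add: powr_def lg_def)
  also have "\<dots> \<le> exp (\<nu> * a)" using upper[OF \<phi>(1)] \<nu> by (simp add: mult_left_mono)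
  also have "\<dots> \<le> exp (lg \<psi> \<gamma>)" using lower[OF \<psi>(1)] by simp
  also have "\<dots> = cmod (\<psi> \<gamma>)" using pos by (simp add: lg_def)
  finally have large: "house K \<gamma> powr \<nu> \<le> cmod (\<psi> \<gamma>)" .
  show ?thesis
    by (intro bexI[OF _ \<phi>(1)] bexI[OF _ \<psi>E] conjI \<phi>(2) large) (use \<psi>(2) in auto)
qed

text \<open>Either \<open>S\<close> contains two distinct conjugate embeddings, or all its members
  are real and any two will do. Stability makes a direction that is constant on the pair and off it
  invariant under conjugation.\<close>

lemma stable_pair:
  assumes S: "S \<subseteq> embeddings K" "card S \<ge> 2" "\<And>\<phi>. \<phi> \<in> S \<Longrightarrow> cj \<phi> \<in> S"
  obtains P where "P \<subseteq> S" "card P = 2" "\<And>\<phi>. \<phi> \<in> P \<Longrightarrow> cj \<phi> \<in> P"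
proof (cases "\<exists>\<phi>\<in>S. cj \<phi> \<noteq> \<phi>")
  case True
  then obtain \<phi> where \<phi>: "\<phi> \<in> S" "cj \<phi> \<noteq> \<phi>" by blast
  have "cj (cj \<phi>) = \<phi>" using \<phi>(1) S(1) by (intro cj_cj) blast
  moreover have "cj \<phi> \<in> S" by (rule S(3)[OF \<phi>(1)])
  ultimately show ?thesis
    using \<phi> by (intro that[of "{\<phi>, cj \<phi>}"]) auto
next
  case False
  obtain P where P: "P \<subseteq> S" "card P = 2" "finite P" using obtain_subset_with_card_n[OF S(2)] .
  show ?thesis by (rule that[of P]) (use P False in auto)
qed

lemma separatingD: "x \<in> K \<Longrightarrow> separating x \<Longrightarrow> rat_adjoin x = K"
  unfolding separating_def by (rule rat_adjoin_eq_K)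

lemma separating_inverse:
  assumes "x \<in> K" "separating x"
  shows "separating (inverse x)"
  unfolding separating_def
proof (rule inj_onI)
  fix \<phi> \<psi> assume E: "\<phi> \<in> embeddings K" "\<psi> \<in> embeddings K" "\<phi> (inverse x) = \<psi> (inverse x)"
  hence "inverse (\<phi> x) = inverse (\<psi> x)"
    unfolding embD(8)[OF E(1) assms(1)] embD(8)[OF E(2) assms(1)] by blast
  hence "\<phi> x = \<psi> x" by simp
  thus "\<phi> = \<psi>" using assms(2) E by (auto simp: separating_def inj_on_def)
qed

section \<open>Units near a direction with two maximal coordinates\<close>

context
  fixes \<nu> :: real and v :: "(complex \<Rightarrow> complex) \<Rightarrow> real" and P :: "(complex \<Rightarrow> complex) set"
  assumes \<alpha>0: "\<alpha> \<noteq> 0" and \<nu>: "0 < \<nu>" "\<nu> < 1"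
    and v: "\<And>\<phi>. \<phi> \<in> embeddings K \<Longrightarrow> v (cj \<phi>) = v \<phi>" "(\<Sum>\<phi>\<in>embeddings K. v \<phi>) = 0"
    and v_le: "\<And>\<phi>. \<phi> \<in> embeddings K \<Longrightarrow> v \<phi> \<le> 1"
    and P: "P \<subseteq> embeddings K" "card P = 2" "\<And>\<phi>. \<phi> \<in> P \<Longrightarrow> v \<phi> = 1"
begin

text \<open>The solution \<open>w\<close> of \<open>1 - 2 * w = \<nu> * (1 + 2 * w)\<close>. All
  logarithms of conjugates of \<open>\<alpha> * \<epsilon>\<close> are at most
  \<open>T * (1 + 2 * w)\<close> and those in \<open>P\<close> at least
  \<open>T * (1 - 2 * w)\<close>; of the tolerance \<open>2 * w\<close>, one half belongs to the
  cone and the other absorbs \<alpha> for large \<open>T\<close>.\<close>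

definition width :: real where "width = (1 - \<nu>) / (2 * (1 + \<nu>))"

lemma width: "width > 0" "width < 1 / 2" "1 - 2 * width = \<nu> * (1 + 2 * width)"
  using \<nu> by (auto simp: width_def field_simps)

lemma cone_lg:
  assumes T: "T \<ge> log_size {\<alpha>} / width" and \<epsilon>: "\<epsilon> \<in> cone v width T" and \<phi>: "\<phi> \<in> embeddings K"
  shows "\<bar>lg \<phi> (\<alpha> * \<epsilon>) - T * v \<phi>\<bar> \<le> 2 * width * T"
proof -
  have "\<epsilon> \<in> int_units K" "\<bar>lg \<phi> \<epsilon> - T * v \<phi>\<bar> \<le> width * T" using \<epsilon> \<phi> by (auto simp: cone_def)
  moreover have "\<bar>lg \<phi> \<alpha>\<bar> \<le> log_size {\<alpha>}" by (intro abs_lg_le_log_size \<phi>) auto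
  moreover have "log_size {\<alpha>} \<le> width * T" using T width(1) by (simp add: field_simps)
  ultimately show ?thesis using lg_alpha_mult[OF \<alpha>0 \<phi>] by fastforce
qed

lemma cone_in_K:
  assumes "\<epsilon> \<in> cone v width T"
  shows "\<epsilon> \<in> int_units K" "\<alpha> * \<epsilon> \<in> K" "\<alpha> * \<epsilon> \<noteq> 0" "separating (\<alpha> * \<epsilon>)"
  using assms \<alpha>0 unit_in_K unit_nz K_closed(4) alpha_in_K by (auto simp: cone_def)

lemma cone_upper:
  assumes T: "T \<ge> log_size {\<alpha>} / width" "T \<ge> 0" and \<epsilon>: "\<epsilon> \<in> cone v width T" and \<phi>: "\<phi> \<in> embeddings K"
  shows "lg \<phi> (\<alpha> * \<epsilon>) \<le> T * (1 + 2 * width)"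
proof -
  have "T * v \<phi> \<le> T * 1" using v_le[OF \<phi>] T(2) by (intro mult_left_mono) auto
  thus ?thesis using cone_lg[OF T(1) \<epsilon> \<phi>] by (simp add: algebra_simps)
qed

lemma cone_subset_nu:
  assumes T: "T \<ge> log_size {\<alpha>} / width" "T \<ge> 0"
  shows "cone v width T \<subseteq> gen_units_nu K \<nu> \<alpha>"
proof
  fix \<epsilon> assume \<epsilon>: "\<epsilon> \<in> cone v width T"
  note \<epsilon>K = cone_in_K[OF \<epsilon>]
  have "\<exists>\<phi>\<^sub>1\<in>embeddings K. \<exists>\<phi>\<^sub>2\<in>embeddings K. \<phi>\<^sub>1 \<noteq> \<phi>\<^sub>2 \<and>
       cmod (\<phi>\<^sub>1 (\<alpha> * \<epsilon>)) = house K (\<alpha> * \<epsilon>) \<and> cmod (\<phi>\<^sub>2 (\<alpha> * \<epsilon>)) \<ge> house K (\<alpha> * \<epsilon>) powr \<nu>"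
  proof (rule two_large_conjugates[OF \<epsilon>K(2,3) P(1,2)])
    show "lg \<phi> (\<alpha> * \<epsilon>) \<le> T * (1 + 2 * width)" if "\<phi> \<in> embeddings K" for \<phi>
      by (rule cone_upper[OF T \<epsilon> that])
    fix \<phi> assume \<phi>: "\<phi> \<in> P"
    hence "\<bar>lg \<phi> (\<alpha> * \<epsilon>) - T\<bar> \<le> 2 * width * T" using cone_lg[OF T(1) \<epsilon>, of \<phi>] P by auto
    hence "lg \<phi> (\<alpha> * \<epsilon>) \<ge> T * (1 - 2 * width)" by (simp add: algebra_simps)
    thus "lg \<phi> (\<alpha> * \<epsilon>) \<ge> \<nu> * (T * (1 + 2 * width))" unfolding width(3) by (simp add: mult_ac)
  qed (use \<nu> in auto)
  thus "\<epsilon> \<in> gen_units_nu K \<nu> \<alpha>"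
    using \<epsilon>K separatingD by (auto simp: gen_units_nu_def gen_units_def)
qed

text \<open>Inversion negates the logarithms, so \<open>Q\<close> and \<open>- v\<close> take the
  places of \<open>P\<close> and \<open>v\<close>.\<close>

lemma cone_inverse_nu:
  assumes T: "T \<ge> log_size {\<alpha>} / width" "T \<ge> 0" and \<epsilon>: "\<epsilon> \<in> cone v width T"
    and v_ge: "\<And>\<phi>. \<phi> \<in> embeddings K \<Longrightarrow> v \<phi> \<ge> -1"
    and Q: "Q \<subseteq> embeddings K" "card Q = 2" "\<And>\<phi>. \<phi> \<in> Q \<Longrightarrow> v \<phi> = -1"
  shows "inverse \<epsilon> \<in> gen_units_nu K \<nu> (1 / \<alpha>)"
proof -
  note \<epsilon>K = cone_in_K[OF \<epsilon>]
  have eq: "1 / \<alpha> * inverse \<epsilon> = inverse (\<alpha> * \<epsilon>)" by (simp add: field_simps)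
  have iK: "inverse (\<alpha> * \<epsilon>) \<in> K" "inverse (\<alpha> * \<epsilon>) \<noteq> 0"
    using K_closed(6)[OF \<epsilon>K(2)] \<epsilon>K(3) by auto
  have lg_inv: "lg \<phi> (inverse (\<alpha> * \<epsilon>)) = - lg \<phi> (\<alpha> * \<epsilon>)" if "\<phi> \<in> embeddings K" for \<phi>
    by (intro lg_inverse that \<epsilon>K)
  have "\<exists>\<phi>\<^sub>1\<in>embeddings K. \<exists>\<phi>\<^sub>2\<in>embeddings K. \<phi>\<^sub>1 \<noteq> \<phi>\<^sub>2 \<and>
       cmod (\<phi>\<^sub>1 (inverse (\<alpha> * \<epsilon>))) = house K (inverse (\<alpha> * \<epsilon>)) \<and>
       cmod (\<phi>\<^sub>2 (inverse (\<alpha> * \<epsilon>))) \<ge> house K (inverse (\<alpha> * \<epsilon>)) powr \<nu>"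
  proof (rule two_large_conjugates[OF iK Q(1,2)])
    fix \<phi> assume \<phi>: "\<phi> \<in> embeddings K"
    have "T * v \<phi> \<ge> T * (-1)" using v_ge[OF \<phi>] T(2) by (intro mult_left_mono) auto
    thus "lg \<phi> (inverse (\<alpha> * \<epsilon>)) \<le> T * (1 + 2 * width)"
      using cone_lg[OF T(1) \<epsilon> \<phi>] unfolding lg_inv[OF \<phi>] by (simp add: algebra_simps)
  next
    fix \<phi> assume \<phi>: "\<phi> \<in> Q"
    hence \<phi>E: "\<phi> \<in> embeddings K" using Q by blast
    have "\<bar>lg \<phi> (\<alpha> * \<epsilon>) + T\<bar> \<le> 2 * width * T" using cone_lg[OF T(1) \<epsilon> \<phi>E] Q(3)[OF \<phi>] by simp
    hence "- lg \<phi> (\<alpha> * \<epsilon>) \<ge> T * (1 - 2 * width)" by (simp add: algebra_simps)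
    thus "lg \<phi> (inverse (\<alpha> * \<epsilon>)) \<ge> \<nu> * (T * (1 + 2 * width))"
      unfolding width(3) lg_inv[OF \<phi>E] by (simp add: mult_ac)
  qed (use \<nu> in auto)
  moreover have "rat_adjoin (inverse (\<alpha> * \<epsilon>)) = K"
    by (intro separatingD iK separating_inverse \<epsilon>K)
  ultimately show ?thesis
    using unit_inverse[OF \<epsilon>K(1)] unfolding gen_units_nu_def gen_units_def mem_Collect_eq eq by blast
qed

lemma cone_subset_count:
  assumes sub: "\<And>T. T \<ge> log_size {\<alpha>} / width \<Longrightarrow> T \<ge> 0 \<Longrightarrow> cone v width T \<subseteq> E" and E: "E \<subseteq> int_units K"
  shows "\<exists>c>0. \<forall>\<^sub>F N in at_top. real (card (house_le K \<alpha> E N)) \<ge> c * ln N ^ card B"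
proof -
  obtain c where c: "c > 0" "\<forall>\<^sub>F T in at_top. real (card (cone v width T)) \<ge> c * T ^ card B"
    using card_cone_ge[OF v width(1) \<alpha>0] by metis
  have lim: "filterlim (\<lambda>N. ln N / 2) at_top (at_top :: real filter)"
    by (rule filterlim_compose[OF _ ln_at_top]) 
       (auto intro!: filterlim_tendsto_pos_mult_at_top[where f = "\<lambda>_. 1/2", simplified] filterlim_ident)
  have "\<forall>\<^sub>F T in at_top. real (card (cone v width T)) \<ge> c * T ^ card B \<and> T \<ge> log_size {\<alpha>} / width \<and> T \<ge> 0"
    by (intro eventually_conj c eventually_ge_at_top)
  from eventually_compose_filterlim[OF this lim] eventually_gt_at_top[of 0]
  have "\<forall>\<^sub>F N in at_top. real (card (house_le K \<alpha> E N)) \<ge> c / 2 ^ card B * ln N ^ card B"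
  proof eventually_elim
    case (elim N)
    \<comment> \<open>Since \<open>1 + 2 * width \<le> 2\<close>, this height keeps every conjugate
      at most \<open>N\<close>; the halving costs the factor \<open>2 ^ card B\<close> in the
      constant.\<close>
    define T where "T = ln N / 2"
    have T: "real (card (cone v width T)) \<ge> c * T ^ card B" "T \<ge> log_size {\<alpha>} / width" "T \<ge> 0"
      using elim by (auto simp: T_def)
    have "cone v width T \<subseteq> house_le K \<alpha> E N"
    proof
      fix \<epsilon> assume \<epsilon>: "\<epsilon> \<in> cone v width T"
      have "lg \<phi> (\<alpha> * \<epsilon>) \<le> ln N" if \<phi>: "\<phi> \<in> embeddings K" for \<phi>
      proof -
        have "lg \<phi> (\<alpha> * \<epsilon>) \<le> T * (1 + 2 * width)" by (rule cone_upper[OF T(2,3) \<epsilon> \<phi>])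
        also have "\<dots> \<le> T * 2" using width(2) T(3) by (intro mult_left_mono) auto
        finally show ?thesis by (simp add: T_def)
      qed
      hence "\<epsilon> \<in> house_le K \<alpha> (int_units K) N"
        using cone_in_K[OF \<epsilon>] elim(2) by (auto simp: house_le_units[OF \<alpha>0] units_upto_def)
      thus "\<epsilon> \<in> house_le K \<alpha> E N" using sub[OF T(2,3)] \<epsilon> by (auto simp: house_le_def)
    qed
    moreover have "finite (house_le K \<alpha> E N)"
    proof (rule finite_subset)
      show "house_le K \<alpha> E N \<subseteq> house_le K \<alpha> (int_units K) N" using E by (auto simp: house_le_def)
      show "finite (house_le K \<alpha> (int_units K) N)"
        using elim(2) by (simp add: house_le_units[OF \<alpha>0] finite_units_upto[OF \<alpha>0])
    qed
    ultimately have "card (cone v width T) \<le> card (house_le K \<alpha> E N)" by (intro card_mono)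
    thus ?case using T(1) by (simp add: T_def power_divide)
  qed
  thus ?thesis using c(1) by (intro exI[of _ "c / 2 ^ card B"]) auto
qed

end

lemma card_gen_units_nu:
  assumes d3: "d \<ge> 3" and \<alpha>0: "\<alpha> \<noteq> 0" and \<nu>: "0 < \<nu>" "\<nu> < 1"
  shows "\<exists>c>0. \<forall>\<^sub>F N in at_top. real (card (house_le K \<alpha> (gen_units_nu K \<nu> \<alpha>) N)) \<ge> c * ln N ^ card B"
proof -
  obtain P where P: "P \<subseteq> embeddings K" "card P = 2" "\<And>\<phi>. \<phi> \<in> P \<Longrightarrow> cj \<phi> \<in> P"
    by (rule stable_pair[of "embeddings K"]) (use d3 in \<open>auto simp: card_embeddings cj_embedding\<close>)
  \<comment> \<open>The \<open>d - 2\<close> embeddings outside \<open>P\<close> share the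
    compensation of the total 2 on \<open>P\<close> equally.\<close>
  define v :: "(complex \<Rightarrow> complex) \<Rightarrow> real" where "v = (\<lambda>\<phi>. if \<phi> \<in> P then 1 else - 2 / (real d - 2))"
  have cjP: "cj \<phi> \<in> P \<longleftrightarrow> \<phi> \<in> P" if "\<phi> \<in> embeddings K" for \<phi>
    using P(3)[of \<phi>] P(3)[of "cj \<phi>"] cj_cj[OF that] by auto
  have v: "v (cj \<phi>) = v \<phi>" if "\<phi> \<in> embeddings K" for \<phi>
    using cjP[OF that] by (simp add: v_def)
  have "(\<Sum>\<phi>\<in>embeddings K. v \<phi>) = (\<Sum>\<phi>\<in>embeddings K - P. v \<phi>) + (\<Sum>\<phi>\<in>P. v \<phi>)"
    by (rule sum.subset_diff[OF P(1) finite_embeddings])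
  also have "(\<Sum>\<phi>\<in>P. v \<phi>) = 2" by (simp add: v_def P(2))
  also have "(\<Sum>\<phi>\<in>embeddings K - P. v \<phi>) = real (card (embeddings K - P)) * (- 2 / (real d - 2))"
    by (simp add: v_def)
  also have "real (card (embeddings K - P)) = real d - 2"
    using P d3 finite_subset[OF P(1) finite_embeddings]
    by (simp add: card_Diff_subset card_embeddings of_nat_diff)
  finally have sum0: "(\<Sum>\<phi>\<in>embeddings K. v \<phi>) = 0" using d3 by (simp add: field_simps)
  have v_le: "v \<phi> \<le> 1" for \<phi> using d3 by (simp add: v_def field_simps)
  have vP: "v \<phi> = 1" if "\<phi> \<in> P" for \<phi> using that by (simp add: v_def)
  show ?thesis
  proof (rule cone_subset_count[OF \<alpha>0 \<nu> v sum0 v_le P(1,2) vP])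
    show "cone v (width \<nu>) T \<subseteq> gen_units_nu K \<nu> \<alpha>" if "T \<ge> log_size {\<alpha>} / width \<nu>" "T \<ge> 0" for T
      by (rule cone_subset_nu[OF \<alpha>0 \<nu> v sum0 v_le P(1,2) vP that])
    show "gen_units_nu K \<nu> \<alpha> \<subseteq> int_units K" by (auto simp: gen_units_nu_def gen_units_def)
  qed
qed

lemma card_gen_units_nu_tilde:
  assumes d4: "d \<ge> 4" and \<alpha>0: "\<alpha> \<noteq> 0" and \<nu>: "0 < \<nu>" "\<nu> < 1"
  shows "\<exists>c>0. \<forall>\<^sub>F N in at_top. real (card (house_le K \<alpha> (gen_units_nu_tilde K \<nu> \<alpha>) N)) \<ge> c * ln N ^ card B"
proof -
  obtain P where P: "P \<subseteq> embeddings K" "card P = 2" "\<And>\<phi>. \<phi> \<in> P \<Longrightarrow> cj \<phi> \<in> P"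
    by (rule stable_pair[of "embeddings K"]) (use d4 in \<open>auto simp: card_embeddings cj_embedding\<close>)
  have finP: "finite P" by (rule finite_subset[OF P(1) finite_embeddings])
  have cjP: "cj \<phi> \<in> P \<longleftrightarrow> \<phi> \<in> P" if "\<phi> \<in> embeddings K" for \<phi>
    using P(3)[of \<phi>] P(3)[of "cj \<phi>"] cj_cj[OF that] by auto
  \<comment> \<open>The complement of a stable pair is stable and, as \<open>d \<ge> 4\<close>,
    still has two elements.\<close>
  obtain Q where Q: "Q \<subseteq> embeddings K - P" "card Q = 2" "\<And>\<phi>. \<phi> \<in> Q \<Longrightarrow> cj \<phi> \<in> Q"
  proof (rule stable_pair[of "embeddings K - P"])
    show "card (embeddings K - P) \<ge> 2" using P finP d4 by (simp add: card_Diff_subset card_embeddings)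
  qed (use cjP cj_embedding in auto)
  have QE: "Q \<subseteq> embeddings K" and finQ: "finite Q"
    using Q(1) finite_embeddings by (auto intro: finite_subset)
  have cjQ: "cj \<phi> \<in> Q \<longleftrightarrow> \<phi> \<in> Q" if "\<phi> \<in> embeddings K" for \<phi>
    using Q(3)[of \<phi>] Q(3)[of "cj \<phi>"] cj_cj[OF that] by auto
  define v :: "(complex \<Rightarrow> complex) \<Rightarrow> real" where "v = (\<lambda>\<phi>. if \<phi> \<in> P then 1 else if \<phi> \<in> Q then -1 else 0)"
  have v: "v (cj \<phi>) = v \<phi>" if "\<phi> \<in> embeddings K" for \<phi>
    using cjP[OF that] cjQ[OF that] by (simp add: v_def)
  have "(\<Sum>\<phi>\<in>embeddings K. v \<phi>) = (\<Sum>\<phi>\<in>P \<union> Q. v \<phi>)"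
    using P(1) QE finite_embeddings by (intro sum.mono_neutral_right) (auto simp: v_def)
  also have "\<dots> = (\<Sum>\<phi>\<in>P. v \<phi>) + (\<Sum>\<phi>\<in>Q. v \<phi>)"
    using finP finQ Q(1) by (intro sum.union_disjoint) auto
  also have "(\<Sum>\<phi>\<in>P. v \<phi>) = 2" by (simp add: v_def P(2))
  also have "(\<Sum>\<phi>\<in>Q. v \<phi>) = (\<Sum>\<phi>\<in>Q. -1)" using Q(1) by (intro sum.cong) (auto simp: v_def)
  finally have sum0: "(\<Sum>\<phi>\<in>embeddings K. v \<phi>) = 0" using Q(2) by simp
  have v_le: "v \<phi> \<le> 1" and v_ge: "v \<phi> \<ge> -1" for \<phi> by (auto simp: v_def)
  have vP: "v \<phi> = 1" if "\<phi> \<in> P" for \<phi> using that by (simp add: v_def)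
  have vQ: "v \<phi> = -1" if "\<phi> \<in> Q" for \<phi> using that Q(1) by (auto simp: v_def)
  show ?thesis
  proof (rule cone_subset_count[OF \<alpha>0 \<nu> v sum0 v_le P(1,2) vP])
    fix T assume T: "T \<ge> log_size {\<alpha>} / width \<nu>" "T \<ge> 0"
    show "cone v (width \<nu>) T \<subseteq> gen_units_nu_tilde K \<nu> \<alpha>"
      using cone_subset_nu[OF \<alpha>0 \<nu> v sum0 v_le P(1,2) vP T]
        cone_inverse_nu[OF \<alpha>0 \<nu> v sum0 v_le P(1,2) vP T _ v_ge QE Q(2) vQ]
      by (auto simp: gen_units_nu_tilde_def)
  next
    show "gen_units_nu_tilde K \<nu> \<alpha> \<subseteq> int_units K"
      by (auto simp: gen_units_nu_tilde_def gen_units_nu_def gen_units_def)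
  qed
qed

lemma card_units_limit:
  assumes d3: "d \<ge> 3" and \<alpha>0: "\<alpha> \<noteq> 0"
  shows "\<exists>L>0. ((\<lambda>N. real (card (house_le K \<alpha> (int_units K) N)) / ln N ^ card B) \<longlongrightarrow> L) at_top"
proof -
  define f where "f = (\<lambda>t. real (card (units_upto t)))"
  \<comment> \<open>The lower bound demanded by \<open>scaling_limit\<close> is inherited from a
    subset of the units; \<open>1/4\<close> is an arbitrary admissible exponent.\<close>
  obtain c where c: "c > 0"
    "\<forall>\<^sub>F N in at_top. real (card (house_le K \<alpha> (gen_units_nu K (1/4) \<alpha>) N)) \<ge> c * ln N ^ card B"
    using card_gen_units_nu[OF d3 \<alpha>0, of "1/4"] by auto
  have "\<exists>L>0. ((\<lambda>t. f t / t ^ card B) \<longlongrightarrow> L) at_top"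
  proof (rule scaling_limit)
    show "2 * log_size {\<alpha>} + 2 * log_size reps + log_size B \<ge> 0"
      by (intro add_nonneg_nonneg mult_nonneg_nonneg log_size_nonneg) auto
    show "f s \<le> f t" if "s \<le> t" for s t
      unfolding f_def using that
      by (intro of_nat_mono card_mono finite_units_upto \<alpha>0) (auto simp: units_upto_def)
    show "f t \<ge> 0" for t by (simp add: f_def)
    show "f (real k * t) \<le> real k ^ card B * f (t + (2 * log_size {\<alpha>} + 2 * log_size reps + log_size B))"
      if "k \<ge> 1" for k t
      using of_nat_mono[OF card_units_upto_scale[OF \<alpha>0 that], of t] by (simp add: f_def)
    show "c > 0" by (rule c)
    have "\<forall>\<^sub>F t in at_top. real (card (house_le K \<alpha> (gen_units_nu K (1/4) \<alpha>) (exp t))) \<ge> c * ln (exp t) ^ card B"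
      using eventually_compose_filterlim[OF c(2) exp_at_top] .
    thus "\<forall>\<^sub>F t in at_top. f t \<ge> c * t ^ card B"
    proof eventually_elim
      case (elim t)
      have "card (house_le K \<alpha> (gen_units_nu K (1/4) \<alpha>) (exp t)) \<le> card (units_upto t)"
        using house_le_units[OF \<alpha>0, of "exp t"]
        by (intro card_mono finite_units_upto \<alpha>0)
           (auto simp: house_le_def gen_units_nu_def gen_units_def)
      thus ?case using elim by (simp add: f_def)
    qed
  qed
  then obtain L where L: "L > 0" "((\<lambda>t. f t / t ^ card B) \<longlongrightarrow> L) at_top" by blast
  have "((\<lambda>N. f (ln N) / ln N ^ card B) \<longlongrightarrow> L) at_top"
    by (rule filterlim_compose[OF L(2) ln_at_top])
  moreover have "\<forall>\<^sub>F N in at_top. f (ln N) / ln N ^ card B =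
      real (card (house_le K \<alpha> (int_units K) N)) / ln N ^ card B"
    using eventually_gt_at_top[of 0] by eventually_elim (simp add: f_def house_le_units[OF \<alpha>0])
  ultimately have "((\<lambda>N. real (card (house_le K \<alpha> (int_units K) N)) / ln N ^ card B) \<longlongrightarrow> L) at_top"
    using tendsto_cong by fast
  thus ?thesis using L(1) by blast
qed

end

section \<open>Positive lower limits and the four assertions\<close>

lemma Liminf_ratio_pos:
  fixes f g :: "real \<Rightarrow> real"
  assumes c: "c > 0" and f: "\<forall>\<^sub>F N in at_top. f N \<ge> c * g N" and g: "\<forall>\<^sub>F N in at_top. g N > 0"
  shows "Liminf at_top (\<lambda>N. ereal (f N / g N)) > 0"
proof -
  have "\<forall>\<^sub>F N in at_top. ereal c \<le> ereal (f N / g N)"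
    using f g by eventually_elim (simp add: field_simps)
  hence "ereal c \<le> Liminf at_top (\<lambda>N. ereal (f N / g N))" by (rule Liminf_bounded)
  thus ?thesis using c by (metis ereal_less(2) less_le_trans)
qed

theorem proposition1:
  fixes \<alpha> :: complex and d r :: nat and K :: "complex set"
  assumes "algebraic \<alpha>" and "rat_degree \<alpha> = d" and "d \<ge> 3"
    and "K = rat_adjoin \<alpha>"
    and "r = mult_rank (int_units K)"
  shows
    "(\<exists>L > 0. ((\<lambda>N :: real. real (card (house_le K \<alpha> (int_units K) N)) / ln N ^ r)
        \<longlongrightarrow> L) at_top)
     \<and> Liminf at_top (\<lambda>N :: real. ereal (real (card (house_le K \<alpha> (gen_units K \<alpha>) N)) /
          real (card (house_le K \<alpha> (int_units K) N)))) > 0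
     \<and> (\<forall>\<nu> :: real. 0 < \<nu> \<and> \<nu> < 1 / 2 \<longrightarrow>
          Liminf at_top (\<lambda>N :: real.
            ereal (real (card (house_le K \<alpha> (gen_units_nu K \<nu> \<alpha>) N)) / ln N ^ r)) > 0)
     \<and> (\<forall>\<nu> :: real. 0 < \<nu> \<and> \<nu> < 1 \<and> d \<ge> 4 \<longrightarrow>
          Liminf at_top (\<lambda>N :: real.
            ereal (real (card (house_le K \<alpha> (gen_units_nu_tilde K \<nu> \<alpha>) N)) / ln N ^ r)) > 0)"
proof -
  interpret number_field \<alpha> d K using assms by unfold_locales
  obtain B where B: "finite B" "B \<subseteq> int_units K" "mult_independent B" "card B = mult_rank (int_units K)"
    "\<And>B'. finite B' \<Longrightarrow> B' \<subseteq> int_units K \<Longrightarrow> mult_independent B' \<Longrightarrow> card B' \<le> mult_rank (int_units K)"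
    by (rule max_independent) blast
  interpret unit_basis \<alpha> d K B using B by unfold_locales auto
  have r: "r = card B" using B(4) assms(5) by simp
  \<comment> \<open>The polynomial \<open>X\<close> would give 0 degree at most 1.\<close>
  have \<alpha>0: "\<alpha> \<noteq> 0"
  proof
    assume "\<alpha> = 0"
    hence "d \<le> degree [:0, 1 :: rat:]" by (intro degree_ge) auto
    thus False using assms(3) by simp
  qed
  have ln_pos: "\<forall>\<^sub>F N in at_top. ln N ^ r > (0 :: real)"
    using eventually_gt_at_top[of 1] by eventually_elim simp
  have lim: "\<exists>L>0. ((\<lambda>N. real (card (house_le K \<alpha> (int_units K) N)) / ln N ^ r) \<longlongrightarrow> L) at_top"
    unfolding r by (rule card_units_limit[OF assms(3) \<alpha>0])
  have nu: "Liminf at_top (\<lambda>N :: real.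
            ereal (real (card (house_le K \<alpha> (gen_units_nu K \<nu> \<alpha>) N)) / ln N ^ r)) > 0"
    if "0 < \<nu>" "\<nu> < 1 / 2" for \<nu>
    using card_gen_units_nu[OF assms(3) \<alpha>0, of \<nu>] that ln_pos Liminf_ratio_pos unfolding r[symmetric] by fastforce
  have tilde: "Liminf at_top (\<lambda>N :: real.
            ereal (real (card (house_le K \<alpha> (gen_units_nu_tilde K \<nu> \<alpha>) N)) / ln N ^ r)) > 0"
    if "0 < \<nu>" "\<nu> < 1" "d \<ge> 4" for \<nu>
    using card_gen_units_nu_tilde[OF that(3) \<alpha>0 that(1,2)] ln_pos Liminf_ratio_pos unfolding r[symmetric] by fastforce
  \<comment> \<open>Assertion (b) compares orders of growth: the generating units include those
    counted with \<nu> = 1/4, at least \<open>c * ln N ^ r\<close>, while all units number at most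
    \<open>2 * L * ln N ^ r\<close> eventually. The quotient of the two constants is the
    bound.\<close>
  have gen: "Liminf at_top (\<lambda>N :: real. ereal (real (card (house_le K \<alpha> (gen_units K \<alpha>) N)) /
          real (card (house_le K \<alpha> (int_units K) N)))) > 0"
  proof -
    obtain c where c: "c > 0"
      "\<forall>\<^sub>F N in at_top. real (card (house_le K \<alpha> (gen_units_nu K (1/4) \<alpha>) N)) \<ge> c * ln N ^ r"
      using card_gen_units_nu[OF assms(3) \<alpha>0, of "1/4"] unfolding r by auto
    obtain L where L: "L > 0"
      "((\<lambda>N. real (card (house_le K \<alpha> (int_units K) N)) / ln N ^ r) \<longlongrightarrow> L) at_top"
      using lim by blast
    have ev: "\<forall>\<^sub>F N in at_top. real (card (house_le K \<alpha> (int_units K) N)) / ln N ^ r < 2 * L"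
      "\<forall>\<^sub>F N in at_top. real (card (house_le K \<alpha> (int_units K) N)) / ln N ^ r > 0"
      using order_tendstoD[OF L(2)] L(1) by auto
    show ?thesis
    proof (rule Liminf_ratio_pos)
      show "c / (2 * L) > 0" using c L by simp
      show "\<forall>\<^sub>F N in at_top. real (card (house_le K \<alpha> (int_units K) N)) > 0"
        using ev(2) ln_pos by eventually_elim (simp add: zero_less_divide_iff)
      show "\<forall>\<^sub>F N in at_top. real (card (house_le K \<alpha> (gen_units K \<alpha>) N))
              \<ge> c / (2 * L) * real (card (house_le K \<alpha> (int_units K) N))"
        using ev(1) c(2) ln_pos eventually_gt_at_top[of 0]
      proof eventually_elim
        case (elim N)
        have fin: "finite (house_le K \<alpha> (int_units K) N)"
          using elim(4) by (simp add: house_le_units[OF \<alpha>0] finite_units_upto[OF \<alpha>0])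
        have "real (card (house_le K \<alpha> (int_units K) N)) \<le> 2 * L * ln N ^ r"
          using elim(1,3) by (simp add: field_simps)
        hence "c / (2 * L) * real (card (house_le K \<alpha> (int_units K) N)) \<le> c / (2 * L) * (2 * L * ln N ^ r)"
          using c L by (intro mult_left_mono) auto
        also have "\<dots> = c * ln N ^ r" using L by simp
        also have "\<dots> \<le> real (card (house_le K \<alpha> (gen_units_nu K (1/4) \<alpha>) N))" by (rule elim(2))
        also have "\<dots> \<le> real (card (house_le K \<alpha> (gen_units K \<alpha>) N))"
          by (intro of_nat_mono card_mono finite_subset[OF _ fin])
             (auto simp: house_le_def gen_units_nu_def gen_units_def)
        finally show ?case .
      qed
    qed
  qed
  show ?thesis using lim gen nu tilde by blast
qed

end
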